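(* Let $k$ be an algebraically closed field of prime characteristic $p>0$, let $V$ be a $d$-dimensional $k$-vector space, and let $G\subset \mathrm{GL}(V)$ be a finite subgroup whose order is not divisible by $p$ and which contains no pseudo-reflections. Let $S=\mathrm{Sym}(V)$ and $R=S^G$. Let $V_0=k,V_1,\dots,V_n$ be a complete set of pairwise non-isomorphic irreducible representations of $G$ over $k$, and set $M_i=(S\otimes_k V_i)^G$ for $i=0,\dots,n$. Then each $R$-module $M_i$ is indecomposable, and for each $e\in\mathbb{N}$ the multiplicities $c_{0,e},\dots,c_{n,e}$ in a decomposition of $R$-modules $${}^eR\cong M_0^{\oplus c_{0,e}}\oplus M_1^{\oplus c_{1,e}}\oplus\cdots\oplus M_n^{\oplus c_{n,e}}$$ are uniquely determined.
   Context: A pseudo-reflection is an element $g\in \mathrm{GL}(V)$, $g\neq 1$, of finite order that fixes a hyperplane of $V$ pointwise. The group $G$ acts on $S=\mathrm{Sym}(V)$ (a polynomial ring in $d$ variables over $k$) by $k$-algebra automorphisms extending its action on $V$; $V_0=k$ denotes the trivial representation. $G$ acts diagonally on $S\otimes_k V_i$, and $(S\otimes_k V_i)^G$ is an $R$-module via multiplication on the factor $S$; $M_0\cong R$. For an $R$-module $M$ and $e\in\mathbb{N}$, ${}^eM$ denotes the abelian group $M$ with the $R$-module structure $r\cdot m=r^{p^e}m$ (pull-back along the $e$-th iterated Frobenius map). It is known that for each $e$ the $R$-module ${}^eR$ is isomorphic to a finite direct sum of copies of $M_0,\dots,M_n$. *)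

theory Defs
  imports
    "HOL-Computational_Algebra.Polynomial"
    "HOL-Computational_Algebra.Primes"
    "HOL-Algebra.Module"
    "HOL-Algebra.QuotRing"
    "HOL-Algebra.Free_Abelian_Groups"
begin

section \<open>Linear groups and pseudo-reflections\<close>

definition GL :: "('k::field \<Rightarrow> 'v::ab_group_add \<Rightarrow> 'v) \<Rightarrow> ('v \<Rightarrow> 'v) monoid" where
  "GL sV = \<lparr>carrier = {g. Vector_Spaces.linear sV sV g \<and> bij g},
            monoid.mult = (\<circ>), monoid.one = id\<rparr>"

definition pseudo_reflection ::
    "('k::field \<Rightarrow> 'v::ab_group_add \<Rightarrow> 'v) \<Rightarrow> ('v \<Rightarrow> 'v) \<Rightarrow> bool" where
  "pseudo_reflection sV g \<longleftrightarrow>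
     g \<in> carrier (GL sV) \<and> g \<noteq> id \<and> (\<exists>m>0. g ^^ m = id) \<and>
     (\<exists>H. module.subspace sV H \<and>
          vector_space.dim sV H + 1 = vector_space.dim sV UNIV \<and>
          (\<forall>v\<in>H. g v = v))"


section \<open>Representations of a group of functions\<close>

text \<open>
  A representation of \<open>G\<close> is given by a linear subspace \<open>U\<close> of an ambient vector
  space together with a map \<open>\<rho>\<close>, of which only the values \<open>\<rho> g u\<close> with
  \<open>g \<in> G\<close> and \<open>u \<in> U\<close> matter.
\<close>

definition representation_on ::
    "('v \<Rightarrow> 'v) set \<Rightarrow> ('k::field \<Rightarrow> 'w::ab_group_add \<Rightarrow> 'w) \<Rightarrow> 'w set \<Rightarrow>
     (('v \<Rightarrow> 'v) \<Rightarrow> 'w \<Rightarrow> 'w) \<Rightarrow> bool" where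
  "representation_on G sW U \<rho> \<longleftrightarrow>
     module.subspace sW U \<and>
     (\<forall>g\<in>G. \<forall>u\<in>U. \<rho> g u \<in> U) \<and>
     (\<forall>g\<in>G. \<forall>u\<in>U. \<forall>u'\<in>U. \<rho> g (u + u') = \<rho> g u + \<rho> g u') \<and>
     (\<forall>g\<in>G. \<forall>a. \<forall>u\<in>U. \<rho> g (sW a u) = sW a (\<rho> g u)) \<and>
     (\<forall>u\<in>U. \<rho> id u = u) \<and>
     (\<forall>g\<in>G. \<forall>h\<in>G. \<forall>u\<in>U. \<rho> (g \<circ> h) u = \<rho> g (\<rho> h u))"

definition irreducible_representation ::
    "('v \<Rightarrow> 'v) set \<Rightarrow> ('k::field \<Rightarrow> 'w::ab_group_add \<Rightarrow> 'w) \<Rightarrow> 'w set \<Rightarrow>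
     (('v \<Rightarrow> 'v) \<Rightarrow> 'w \<Rightarrow> 'w) \<Rightarrow> bool" where
  "irreducible_representation G sW U \<rho> \<longleftrightarrow>
     representation_on G sW U \<rho> \<and> U \<noteq> {0} \<and>
     (\<forall>U'. module.subspace sW U' \<and> U' \<subseteq> U \<and> (\<forall>g\<in>G. \<rho> g ` U' \<subseteq> U') \<longrightarrow>
           U' = {0} \<or> U' = U)"

definition representation_iso ::
    "('v \<Rightarrow> 'v) set \<Rightarrow>
     ('k::field \<Rightarrow> 'w::ab_group_add \<Rightarrow> 'w) \<Rightarrow> 'w set \<Rightarrow> (('v \<Rightarrow> 'v) \<Rightarrow> 'w \<Rightarrow> 'w) \<Rightarrow>
     ('k \<Rightarrow> 'x::ab_group_add \<Rightarrow> 'x) \<Rightarrow> 'x set \<Rightarrow> (('v \<Rightarrow> 'v) \<Rightarrow> 'x \<Rightarrow> 'x) \<Rightarrow> bool" where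
  "representation_iso G sW U \<rho> sX X \<tau> \<longleftrightarrow>
     (\<exists>f. bij_betw f U X \<and>
          (\<forall>u\<in>U. \<forall>u'\<in>U. f (u + u') = f u + f u') \<and>
          (\<forall>a. \<forall>u\<in>U. f (sW a u) = sX a (f u)) \<and>
          (\<forall>g\<in>G. \<forall>u\<in>U. f (\<rho> g u) = \<tau> g (f u)))"

text \<open>
  Completeness is tested against all irreducible representations carried by subspaces of
  the space \<open>nat \<Rightarrow>\<^sub>0 'k\<close> of finitely supported sequences.  For a finite group this reaches
  every irreducible representation up to isomorphism: these are finite-dimensional, and
  every finite-dimensional space is isomorphic to a subspace of \<open>nat \<Rightarrow>\<^sub>0 'k\<close>.
\<close>

definition complete_irreps ::
    "('v \<Rightarrow> 'v) set \<Rightarrow> ('k::field \<Rightarrow> 'w::ab_group_add \<Rightarrow> 'w) \<Rightarrow> nat \<Rightarrow>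
     (nat \<Rightarrow> 'w set) \<Rightarrow> (nat \<Rightarrow> ('v \<Rightarrow> 'v) \<Rightarrow> 'w \<Rightarrow> 'w) \<Rightarrow> bool" where
  "complete_irreps G sW n U \<rho> \<longleftrightarrow>
     (\<forall>i\<le>n. irreducible_representation G sW (U i) (\<rho> i)) \<and>
     (\<forall>i\<le>n. \<forall>j\<le>n. i \<noteq> j \<longrightarrow> \<not> representation_iso G sW (U i) (\<rho> i) sW (U j) (\<rho> j)) \<and>
     (\<forall>(X :: (nat \<Rightarrow>\<^sub>0 'k) set) \<tau>.
        irreducible_representation G (\<lambda>a. Poly_Mapping.map ((*) a)) X \<tau> \<longrightarrow>
        (\<exists>i\<le>n. representation_iso G (\<lambda>a. Poly_Mapping.map ((*) a)) X \<tau> sW (U i) (\<rho> i)))"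


section \<open>The symmetric algebra and its group action\<close>

text \<open>
  \<open>Sym(V)\<close> is the quotient of the free commutative \<open>k\<close>-algebra on the set \<open>V\<close> by the
  ideal which makes the map sending \<open>v\<close> to the class of its variable linear.
\<close>

type_synonym ('v, 'k) free_alg = "('v \<Rightarrow>\<^sub>0 nat) \<Rightarrow>\<^sub>0 'k"

definition free_alg_ring :: "('v, 'k::comm_ring_1) free_alg ring" where
  "free_alg_ring =
     \<lparr>carrier = UNIV, monoid.mult = (*), monoid.one = 1, ring.zero = 0, ring.add = (+)\<rparr>"

definition Const :: "'k::comm_ring_1 \<Rightarrow> ('v, 'k) free_alg" where
  "Const a = Poly_Mapping.single 0 a"

definition Var :: "'v \<Rightarrow> ('v, 'k::comm_ring_1) free_alg" where
  "Var v = Poly_Mapping.single (Poly_Mapping.single v 1) 1"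

definition substitute ::
    "('v \<Rightarrow> ('v, 'k::comm_ring_1) free_alg) \<Rightarrow> ('v, 'k) free_alg \<Rightarrow> ('v, 'k) free_alg" where
  "substitute f q =
     (\<Sum>m\<in>Poly_Mapping.keys q. Const (Poly_Mapping.lookup q m) *
        (\<Prod>v\<in>Poly_Mapping.keys m. f v ^ Poly_Mapping.lookup m v))"

definition sym_ideal ::
    "('k::field \<Rightarrow> 'v::ab_group_add \<Rightarrow> 'v) \<Rightarrow> ('v, 'k) free_alg set" where
  "sym_ideal sV = Idl\<^bsub>free_alg_ring\<^esub>
     ({Var (u + v) - Var u - Var v | u v. True} \<union>
      {Var (sV a v) - Const a * Var v | a v. True})"

definition sym_alg ::
    "('k::field \<Rightarrow> 'v::ab_group_add \<Rightarrow> 'v) \<Rightarrow> ('k, ('v, 'k) free_alg set) module" where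
  "sym_alg sV =
     (let Q = free_alg_ring Quot sym_ideal sV
      in \<lparr>carrier = carrier Q, monoid.mult = monoid.mult Q, monoid.one = monoid.one Q,
          ring.zero = ring.zero Q, ring.add = ring.add Q,
          smult = (\<lambda>a s. (sym_ideal sV +>\<^bsub>free_alg_ring\<^esub> Const a) \<otimes>\<^bsub>Q\<^esub> s)\<rparr>)"

text \<open>
  On cosets, the map induced by a map of representatives is written as
  (subgroup) + (image of the coset); this is again a coset as soon as the map on
  representatives is additive and preserves the subgroup.  For \<open>g \<in> GL(V)\<close> the
  following is thus the algebra automorphism of \<open>Sym(V)\<close> with \<open>[v] \<mapsto> [g v]\<close>.
\<close>

definition sym_act ::
    "('k::field \<Rightarrow> 'v::ab_group_add \<Rightarrow> 'v) \<Rightarrow> ('v \<Rightarrow> 'v) \<Rightarrow>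
     ('v, 'k) free_alg set \<Rightarrow> ('v, 'k) free_alg set" where
  "sym_act sV g A = sym_ideal sV <+>\<^bsub>free_alg_ring\<^esub> substitute (\<lambda>v. Var (g v)) ` A"

definition invariant_ring ::
    "('k::field \<Rightarrow> 'v::ab_group_add \<Rightarrow> 'v) \<Rightarrow> ('v \<Rightarrow> 'v) set \<Rightarrow>
     ('k, ('v, 'k) free_alg set) module" where
  "invariant_ring sV G =
     (sym_alg sV)\<lparr>carrier := {s \<in> carrier (sym_alg sV). \<forall>g\<in>G. sym_act sV g s = s}\<rparr>"


section \<open>Tensor products\<close>

text \<open>
  \<open>S \<otimes>\<^sub>k U\<close>, for a \<open>k\<close>-algebra \<open>S\<close> and a \<open>k\<close>-vector space \<open>U\<close>, is the free abelian group
  on \<open>S \<times> U\<close> modulo the biadditive and \<open>k\<close>-balanced relations, and an \<open>S\<close>-module via the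
  first factor.
\<close>

definition tensor_relations ::
    "('k::field, 's) module \<Rightarrow> ('k \<Rightarrow> 'w::ab_group_add \<Rightarrow> 'w) \<Rightarrow> 'w set \<Rightarrow>
     ('s \<times> 'w \<Rightarrow>\<^sub>0 int) set" where
  "tensor_relations S sW U =
     {frag_of (s \<oplus>\<^bsub>S\<^esub> s', u) - frag_of (s, u) - frag_of (s', u) | s s' u.
        s \<in> carrier S \<and> s' \<in> carrier S \<and> u \<in> U} \<union>
     {frag_of (s, u + u') - frag_of (s, u) - frag_of (s, u') | s u u'.
        s \<in> carrier S \<and> u \<in> U \<and> u' \<in> U} \<union>
     {frag_of (a \<odot>\<^bsub>S\<^esub> s, u) - frag_of (s, sW a u) | a s u.
        s \<in> carrier S \<and> u \<in> U}"

definition tensor_null ::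
    "('k::field, 's) module \<Rightarrow> ('k \<Rightarrow> 'w::ab_group_add \<Rightarrow> 'w) \<Rightarrow> 'w set \<Rightarrow>
     ('s \<times> 'w \<Rightarrow>\<^sub>0 int) set" where
  "tensor_null S sW U =
     generate (free_Abelian_group (carrier S \<times> U)) (tensor_relations S sW U)"

definition tensor_map ::
    "('k::field, 's) module \<Rightarrow> ('k \<Rightarrow> 'w::ab_group_add \<Rightarrow> 'w) \<Rightarrow> 'w set \<Rightarrow>
     ('s \<Rightarrow> 's) \<Rightarrow> ('w \<Rightarrow> 'w) \<Rightarrow> ('s \<times> 'w \<Rightarrow>\<^sub>0 int) set \<Rightarrow> ('s \<times> 'w \<Rightarrow>\<^sub>0 int) set" where
  "tensor_map S sW U \<alpha> \<beta> T =
     tensor_null S sW U <#>\<^bsub>free_Abelian_group (carrier S \<times> U)\<^esub>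
     frag_extend (\<lambda>(s, u). frag_of (\<alpha> s, \<beta> u)) ` T"

text \<open>The ring multiplication of a \<^typ>\<open>('a, 'b) module\<close> record plays no role for modules.\<close>

definition tensor_module ::
    "('k::field, 's) module \<Rightarrow> ('k \<Rightarrow> 'w::ab_group_add \<Rightarrow> 'w) \<Rightarrow> 'w set \<Rightarrow>
     ('s, ('s \<times> 'w \<Rightarrow>\<^sub>0 int) set) module" where
  "tensor_module S sW U =
     (let T = free_Abelian_group (carrier S \<times> U) Mod tensor_null S sW U
      in \<lparr>carrier = carrier T, monoid.mult = undefined, monoid.one = undefined,
          ring.zero = monoid.one T, ring.add = monoid.mult T,
          smult = (\<lambda>s. tensor_map S sW U (\<lambda>t. s \<otimes>\<^bsub>S\<^esub> t) (\<lambda>u. u))\<rparr>)"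

text \<open>\<open>(Sym(V) \<otimes>\<^sub>k U)\<^sup>G\<close> for the diagonal action, as a module over \<open>Sym(V)\<^sup>G\<close>.\<close>

definition covariants ::
    "('k::field \<Rightarrow> 'v::ab_group_add \<Rightarrow> 'v) \<Rightarrow> ('v \<Rightarrow> 'v) set \<Rightarrow>
     ('k \<Rightarrow> 'w::ab_group_add \<Rightarrow> 'w) \<Rightarrow> 'w set \<Rightarrow> (('v \<Rightarrow> 'v) \<Rightarrow> 'w \<Rightarrow> 'w) \<Rightarrow>
     (('v, 'k) free_alg set, (('v, 'k) free_alg set \<times> 'w \<Rightarrow>\<^sub>0 int) set) module" where
  "covariants sV G sW U \<rho> =
     (tensor_module (sym_alg sV) sW U)\<lparr>carrier :=
        {t \<in> carrier (tensor_module (sym_alg sV) sW U).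
           \<forall>g\<in>G. tensor_map (sym_alg sV) sW U (sym_act sV g) (\<rho> g) t = t}\<rparr>"


section \<open>Modules\<close>

definition regular_module :: "('a, 'm) ring_scheme \<Rightarrow> ('a, 'a) module" where
  "regular_module R =
     \<lparr>carrier = carrier R, monoid.mult = monoid.mult R, monoid.one = monoid.one R,
      ring.zero = ring.zero R, ring.add = ring.add R, smult = monoid.mult R\<rparr>"

definition frobenius_pullback ::
    "nat \<Rightarrow> nat \<Rightarrow> ('a, 'm) ring_scheme \<Rightarrow> ('a, 'b) module \<Rightarrow> ('a, 'b) module" where
  "frobenius_pullback p e R M = M\<lparr>smult := (\<lambda>r x. (r [^]\<^bsub>R\<^esub> (p ^ e)) \<odot>\<^bsub>M\<^esub> x)\<rparr>"

definition direct_sum_module :: "'i set \<Rightarrow> ('i \<Rightarrow> ('a, 'b) module) \<Rightarrow> ('a, 'i \<Rightarrow> 'b) module" where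
  "direct_sum_module I M =
     \<lparr>carrier = {x \<in> (\<Pi>\<^sub>E i\<in>I. carrier (M i)). finite {i\<in>I. x i \<noteq> \<zero>\<^bsub>M i\<^esub>}},
      monoid.mult = undefined, monoid.one = undefined,
      ring.zero = (\<lambda>i\<in>I. \<zero>\<^bsub>M i\<^esub>),
      ring.add = (\<lambda>x y. \<lambda>i\<in>I. x i \<oplus>\<^bsub>M i\<^esub> y i),
      smult = (\<lambda>r x. \<lambda>i\<in>I. r \<odot>\<^bsub>M i\<^esub> x i)\<rparr>"

definition module_isomorphic ::
    "('a, 'm) ring_scheme \<Rightarrow> ('a, 'b) module \<Rightarrow> ('a, 'c) module \<Rightarrow> bool" where
  "module_isomorphic R M N \<longleftrightarrow>
     (\<exists>f. bij_betw f (carrier M) (carrier N) \<and>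
          (\<forall>x\<in>carrier M. \<forall>y\<in>carrier M. f (x \<oplus>\<^bsub>M\<^esub> y) = f x \<oplus>\<^bsub>N\<^esub> f y) \<and>
          (\<forall>r\<in>carrier R. \<forall>x\<in>carrier M. f (r \<odot>\<^bsub>M\<^esub> x) = r \<odot>\<^bsub>N\<^esub> f x))"

definition indecomposable_module :: "('a, 'm) ring_scheme \<Rightarrow> ('a, 'b) module \<Rightarrow> bool" where
  "indecomposable_module R M \<longleftrightarrow>
     module R M \<and> carrier M \<noteq> {\<zero>\<^bsub>M\<^esub>} \<and>
     (\<forall>A B. submodule A R M \<and> submodule B R M \<and>
            A \<inter> B = {\<zero>\<^bsub>M\<^esub>} \<and> A <+>\<^bsub>M\<^esub> B = carrier M \<longrightarrow>
            A = {\<zero>\<^bsub>M\<^esub>} \<or> B = {\<zero>\<^bsub>M\<^esub>})"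

definition multiplicity_sum ::
    "nat \<Rightarrow> (nat \<Rightarrow> nat) \<Rightarrow> (nat \<Rightarrow> ('a, 'b) module) \<Rightarrow> ('a, nat \<times> nat \<Rightarrow> 'b) module" where
  "multiplicity_sum n c M = direct_sum_module (SIGMA i:{..n}. {..<c i}) (\<lambda>(i, j). M i)"

end

theory Submission
  imports Defs "HOL-Library.Function_Algebras"
begin

text \<open>
  Elements of \<open>Sym(V)\<close> are polynomial functions on \<open>V\<^sup>*\<close>, and \<open>M\<^sub>i\<close> consists of the equivariant
  polynomial maps \<open>V\<^sup>* \<rightarrow> V\<^sub>i\<close>.  Every \<open>R\<close>-linear map \<open>M\<^sub>i \<rightarrow> M\<^sub>j\<close> is given pointwise by a matrix with
  entries in \<open>Sym(V)\<close>: a trace argument produces this matrix up to the denominator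
  \<open>\<Prod>g\<noteq>1. (s\<^sub>g - g s\<^sub>g)\<close>, for any choice of vectors \<open>s\<^sub>g\<close>, and since in the absence of
  pseudo-reflections the image of \<open>1 - g\<close> has dimension at least two, two coprime denominators can
  be chosen, so that no denominator is needed.  Evaluating this matrix at the origin gives an intertwiner \<open>V\<^sub>i \<rightarrow> V\<^sub>j\<close>, to
  which Schur's lemma applies.  An idempotent matrix that vanishes at the origin is zero, hence \<open>M\<^sub>i\<close> is
  indecomposable; and an isomorphism between direct sums of the \<open>M\<^sub>i\<close> gives an isomorphism between the
  corresponding sums of the \<open>V\<^sub>i\<close>, whose multiplicities are determined by dimensions.
\<close>

section \<open>Polynomial functions on the dual space\<close>

text \<open>In general R is not local, so uniqueness of the decomposition is not automatic; the
  origin of the dual space, a point fixed by all of G, takes the place of a residue field.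
  Evaluating the elements of M_i there is useless, since for nontrivial V_i they all vanish at 0.
  Matrices do better: the values of equivariant maps span V_i at generic points
  (\<open>Equi_generic\<close>), so a homomorphism has only one matrix, identities between
  homomorphisms become identities between matrices, and these can be specialised to 0. The obstacle
  is to produce the matrix, as a homomorphism is merely R-linear and knows nothing of points. The
  product of all h s_g - g s_g with g \<noteq> 1 vanishes for h \<noteq> 1 in G and is the
  denominator for h = 1. Expanded into terms a_i(x) c_i(xh), it writes the denominator times any
  polynomial map as an S-combination of traces, and to traces the homomorphism can be applied. Two
  denominators give two fractions for the same matrix; if no linear factor of one is proportional to
  a factor of the other, the matrix is polynomial.\<close>

lemma infinite_alg_closed_field: "infinite (UNIV :: 'k::alg_closed_field set)"
proof
  assume fin: "finite (UNIV :: 'k set)"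
  \<comment> \<open>Over a finite field the product of all X - a vanishes everywhere, so this
    polynomial has positive degree but takes only the value 1.\<close>
  define p :: "'k poly" where "p = (\<Prod>a\<in>UNIV. [:-a, 1:]) + 1"
  have "degree (\<Prod>a\<in>(UNIV::'k set). [:-a, 1:]) = card (UNIV :: 'k set)"
    by (subst degree_prod_eq_sum_degree) auto
  moreover have "card (UNIV :: 'k set) > 0"
    using fin by (simp add: card_gt_0_iff)
  ultimately have "degree p > 0"
    unfolding p_def by (subst degree_add_eq_left) auto
  then obtain x where "poly p x = 0"
    using alg_closed_imp_poly_has_root by blast
  moreover have "poly p x = 1"
    using fin by (auto simp: p_def poly_prod)
  ultimately show False by simp
qed

text \<open>Infinite, so that a polynomial in one variable is determined by its values; the density
  arguments below restrict to a line and use this.\<close>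

locale dual_points = finite_dimensional_vector_space sV basis
  for sV :: "'k::field \<Rightarrow> 'v::ab_group_add \<Rightarrow> 'v" and basis :: "'v set" +
  assumes infinite_field: "infinite (UNIV :: 'k set)"
begin

text \<open>
  The points of the dual space \<open>V\<^sup>*\<close> are parametrised by arbitrary functions \<open>x\<close>: only the
  values of \<open>x\<close> on the basis matter, and \<open>pt x\<close> is their linear extension.
\<close>

definition pt :: "('v \<Rightarrow> 'k) \<Rightarrow> 'v \<Rightarrow> 'k" where
  "pt x v = (\<Sum>b\<in>basis. representation basis v b * x b)"

lemma pt_add: "pt x (u + v) = pt x u + pt x v"
  unfolding pt_def
  by (simp add: representation_add[OF independent_Basis] span_Basis sum.distrib algebra_simps)

lemma pt_scale: "pt x (sV a v) = a * pt x v"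
  unfolding pt_def
  by (simp add: representation_scale[OF independent_Basis] span_Basis sum_distrib_left algebra_simps)

lemma pt_diff: "pt x (u - v) = pt x u - pt x v"
  by (metis add_diff_cancel_right' diff_add_cancel pt_add)

lemma pt_basis: "b \<in> basis \<Longrightarrow> pt x b = x b"
  unfolding pt_def
  by (simp add: representation_basis[OF independent_Basis] if_distribR if_distrib[of "\<lambda>t. t * _"]
      finite_Basis sum.delta' cong: if_cong)

text \<open>Together with \<open>pt_add\<close> and \<open>pt_scale\<close>: the linear functionals
  are exactly the fixed points of \<open>pt\<close>, which is thus a projection of all functions
  onto the dual space.\<close>

lemma pt_eq_linear:
  assumes "\<And>u v. f (u + v) = f u + f v" "\<And>a v. f (sV a v) = a * f v"
  shows "pt f = f"
proof
  fix v
  have f0: "f 0 = 0" using assms(2)[of 0 0] by simp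
  have "f (\<Sum>b\<in>B. sV (representation basis v b) b) = (\<Sum>b\<in>B. representation basis v b * f b)"
    if "finite B" for B
    using that by induction (auto simp: assms f0)
  then have "f (\<Sum>b\<in>basis. sV (representation basis v b) b) = pt f v"
    unfolding pt_def using finite_Basis by blast
  then show "pt f v = f v"
    by (simp add: sum_representation_eq[OF independent_Basis] span_Basis finite_Basis)
qed

lemma pt_pt [simp]: "pt (pt x) = pt x"
  by (rule pt_eq_linear) (auto simp: pt_add pt_scale)

lemma pt_line: "pt (\<lambda>v. x v + t * y v) v = pt x v + t * pt y v"
  unfolding pt_def by (simp add: algebra_simps sum.distrib sum_distrib_left)

lemma pt_origin [simp]: "pt (\<lambda>v. 0) v = 0"
  unfolding pt_def by simp

lemma pt_separates:
  assumes "v \<noteq> 0" shows "\<exists>x. pt x v = 1"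
proof -
  have "\<exists>b\<in>basis. representation basis v b \<noteq> 0"
  proof (rule ccontr)
    assume "\<not> ?thesis"
    then have "(\<Sum>b\<in>basis. sV (representation basis v b) b) = 0" by simp
    then show False
      using assms by (simp add: sum_representation_eq[OF independent_Basis] span_Basis finite_Basis)
  qed
  then obtain b where b: "b \<in> basis" "representation basis v b \<noteq> 0" by blast
  have "pt (\<lambda>c. if c = b then inverse (representation basis v b) else 0) v = 1"
    unfolding pt_def using b finite_Basis by (simp add: if_distrib sum.delta cong: if_cong)
  then show ?thesis by blast
qed

lemma pt_separates2:
  assumes "l \<noteq> 0" "\<And>a. l' \<noteq> sV a l"
  shows "\<exists>x. pt x l = 0 \<and> pt x l' \<noteq> 0"
proof -
  obtain y where y: "pt y l = 1" using pt_separates assms(1) by blast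
  define w where "w = l' - sV (pt y l') l"
  have "w \<noteq> 0" using assms(2) unfolding w_def by auto
  then obtain z where z: "pt z w = 1" using pt_separates by blast
  \<comment> \<open>Correcting z by a multiple of y makes it vanish at l; since y kills w, the value
    1 at w survives.\<close>
  let ?x = "\<lambda>v. z v + (- pt z l) * y v"
  have yw: "pt y w = 0" unfolding w_def by (simp add: pt_diff pt_scale y)
  have "pt ?x l = 0" by (simp only: pt_line y) simp
  moreover have "pt ?x w = 1" by (simp only: pt_line z yw) simp
  moreover have "l' = w + sV (pt y l') l" unfolding w_def by simp
  ultimately have "pt ?x l' = 1" using pt_add[of ?x w "sV (pt y l') l"] pt_scale[of ?x "pt y l'" l]
    by simp
  with \<open>pt ?x l = 0\<close> show ?thesis by (metis zero_neq_one)
qed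

text \<open>Generated by the evaluations at all vectors, not only at the basis, so that stability
  under G is immediate (\<open>Pol_act\<close>).\<close>

inductive_set Pol :: "(('v \<Rightarrow> 'k) \<Rightarrow> 'k) set" where
  Pol_const: "(\<lambda>x. a) \<in> Pol"
| Pol_pt: "(\<lambda>x. pt x v) \<in> Pol"
| Pol_add: "f \<in> Pol \<Longrightarrow> h \<in> Pol \<Longrightarrow> (\<lambda>x. f x + h x) \<in> Pol"
| Pol_mult: "f \<in> Pol \<Longrightarrow> h \<in> Pol \<Longrightarrow> (\<lambda>x. f x * h x) \<in> Pol"

lemma Pol_uminus: "f \<in> Pol \<Longrightarrow> (\<lambda>x. - f x) \<in> Pol"
  using Pol_mult[OF Pol_const[of "-1"], of f] by simp

lemma Pol_diff: "f \<in> Pol \<Longrightarrow> h \<in> Pol \<Longrightarrow> (\<lambda>x. f x - h x) \<in> Pol"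
  using Pol_add[OF _ Pol_uminus, of f h] by simp

lemma Pol_sum: "(\<And>i. i \<in> I \<Longrightarrow> f i \<in> Pol) \<Longrightarrow> (\<lambda>x. \<Sum>i\<in>I. f i x) \<in> Pol"
  by (induction I rule: infinite_finite_induct) (auto intro: Pol_const Pol_add)

lemma Pol_prod: "(\<And>i. i \<in> I \<Longrightarrow> f i \<in> Pol) \<Longrightarrow> (\<lambda>x. \<Prod>i\<in>I. f i x) \<in> Pol"
  by (induction I rule: infinite_finite_induct) (auto intro: Pol_const Pol_mult)

lemma Pol_at_pt: "f \<in> Pol \<Longrightarrow> f (pt x) = f x"
  by (induction rule: Pol.induct) auto

text \<open>Reduces questions of vanishing to polynomials in one variable.\<close>

lemma Pol_line: "f \<in> Pol \<Longrightarrow> \<exists>p. \<forall>t. f (\<lambda>v. x v + t * y v) = poly p t"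
proof (induction rule: Pol.induct)
  case (Pol_const a)
  show ?case by (rule exI[of _ "[:a:]"]) simp
next
  case (Pol_pt v)
  show ?case by (rule exI[of _ "[:pt x v, pt y v:]"]) (simp add: pt_line)
next
  case (Pol_add f h)
  then show ?case by (metis poly_add)
next
  case (Pol_mult f h)
  then show ?case by (metis poly_mult)
qed

text \<open>Affine subspaces, described by containing the line through any two of their points. The
  instances used are the whole space and the hyperplane \<open>pt x l = 0\<close>.\<close>

definition flat :: "('v \<Rightarrow> 'k) set \<Rightarrow> bool" where
  "flat W \<longleftrightarrow> (\<forall>x\<in>W. \<forall>y\<in>W. \<forall>t. (\<lambda>v. x v + t * (y v - x v)) \<in> W)"

lemma flat_UNIV: "flat UNIV"
  by (simp add: flat_def)

lemma flat_hyperplane: "flat {x. pt x l = 0}"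
proof -
  have "pt (\<lambda>v. x v + t * (y v - x v)) l = 0" if "pt x l = 0" "pt y l = 0" for x y t
  proof -
    have "pt (\<lambda>v. y v + (-1) * x v) l = 0" by (simp only: pt_line that) simp
    then show ?thesis using that pt_line[of x t "\<lambda>v. y v - x v" l] by simp
  qed
  then show ?thesis by (simp add: flat_def)
qed

text \<open>Join x to x0 by a line inside W. Along it f becomes a polynomial that is nonzero at the
  parameter 1, so h becomes the zero polynomial, and x is the parameter 0. In other words, the
  functions on W form an integral domain.\<close>

lemma Pol_domain:
  assumes "flat W" "f \<in> Pol" "h \<in> Pol" "x0 \<in> W" "f x0 \<noteq> 0"
    and fh: "\<And>x. x \<in> W \<Longrightarrow> f x * h x = 0" and "x \<in> W"
  shows "h x = 0"
proof -
  let ?L = "\<lambda>t v. x v + t * (x0 v - x v)"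
  obtain p where p: "\<And>t. f (?L t) = poly p t"
    using Pol_line[OF assms(2), of x "\<lambda>v. x0 v - x v"] by blast
  obtain q where q: "\<And>t. h (?L t) = poly q t"
    using Pol_line[OF assms(3), of x "\<lambda>v. x0 v - x v"] by blast
  have "?L t \<in> W" for t using assms(1,4,7) by (simp add: flat_def)
  then have "poly (p * q) t = 0" for t using fh p q by (metis poly_mult)
  then have "p * q = 0"
    using poly_roots_finite[of "p * q"] infinite_field by auto
  moreover have "poly p 1 \<noteq> 0" using p[of 1] assms(5) by simp
  ultimately have "q = 0" by auto
  then show ?thesis using q[of 0] by simp
qed

lemma Pol_cancel:
  assumes "f \<in> Pol" "h \<in> Pol" "h' \<in> Pol" "f x0 \<noteq> 0" "\<And>x. f x * h x = f x * h' x"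
  shows "h x = h' x"
  using Pol_domain[OF flat_UNIV assms(1) Pol_diff[OF assms(2,3)], of x0 x] assms(4,5)
  by (simp add: right_diff_distrib)

text \<open>Along the projection of \<open>V\<close> with kernel spanned by \<open>l\<close>, every polynomial function changes by a
  multiple of \<open>l\<close>.\<close>

lemma Pol_div_linear:
  assumes "l \<noteq> 0" "f \<in> Pol" and van: "\<And>x. pt x l = 0 \<Longrightarrow> f x = 0"
  shows "\<exists>h\<in>Pol. \<forall>x. f x = pt x l * h x"
proof -
  obtain y where y: "pt y l = 1" using pt_separates assms(1) by blast
  define pr where "pr x = (\<lambda>v. pt x v - pt y v * pt x l)" for x
  have pr: "pt (pr x) = pr x" for x
    by (rule pt_eq_linear) (auto simp: pr_def pt_add pt_scale algebra_simps)
  have prl: "pt (pr x) l = 0" for x unfolding pr by (simp add: pr_def y)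
  have inv: "(\<lambda>x. f (pr x)) \<in> Pol" if "f \<in> Pol" for f
    using that
  proof (induction rule: Pol.induct)
    case (Pol_pt v)
    show ?case unfolding pr unfolding pr_def
      by (intro Pol_diff Pol_mult Pol.intros)
  qed (auto intro: Pol.intros)
  have "\<exists>h\<in>Pol. \<forall>x. f x - f (pr x) = pt x l * h x"
    using assms(2)
  proof (induction rule: Pol.induct)
    case (Pol_const a)
    show ?case by (rule bexI[of _ "\<lambda>x. 0"]) (auto intro: Pol.intros)
  next
    case (Pol_pt v)
    show ?case by (rule bexI[of _ "\<lambda>x. pt y v"]) (auto intro: Pol.intros simp: pr, simp add: pr_def)
  next
    case (Pol_add f f')
    then obtain h h' where h: "h \<in> Pol" "h' \<in> Pol" "\<And>x. f x - f (pr x) = pt x l * h x"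
      "\<And>x. f' x - f' (pr x) = pt x l * h' x" by blast
    show ?case
    proof (intro bexI[of _ "\<lambda>x. h x + h' x"] allI)
      fix x
      have "f x + f' x - (f (pr x) + f' (pr x)) = (f x - f (pr x)) + (f' x - f' (pr x))" by simp
      then show "f x + f' x - (f (pr x) + f' (pr x)) = pt x l * (h x + h' x)"
        unfolding h distrib_left .
    qed (rule Pol.Pol_add[OF h(1,2)])
  next
    case (Pol_mult f f')
    then obtain h h' where h: "h \<in> Pol" "h' \<in> Pol" "\<And>x. f x - f (pr x) = pt x l * h x"
      "\<And>x. f' x - f' (pr x) = pt x l * h' x" by blast
    show ?case
    proof (intro bexI[of _ "\<lambda>x. h x * f' x + f (pr x) * h' x"] allI)
      fix x
      have "f x * f' x - f (pr x) * f' (pr x)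
          = (f x - f (pr x)) * f' x + f (pr x) * (f' x - f' (pr x))" by (simp add: algebra_simps)
      also have "\<dots> = pt x l * (h x * f' x + f (pr x) * h' x)"
        unfolding h by (simp add: algebra_simps)
      finally show "f x * f' x - f (pr x) * f' (pr x) = pt x l * (h x * f' x + f (pr x) * h' x)" .
    qed (rule Pol.Pol_add[OF Pol.Pol_mult[OF h(1) Pol_mult.hyps(2)]
          Pol.Pol_mult[OF inv[OF Pol_mult.hyps(1)] h(2)]])
  qed
  moreover have "f (pr x) = 0" for x using van[OF prl] .
  ultimately show ?thesis by simp
qed

lemma Pol_prod_linear_nonzero:
  assumes "flat W" "finite T" "\<And>g. g \<in> T \<Longrightarrow> \<exists>x\<in>W. pt x (l g) \<noteq> 0" "W \<noteq> {}"
  shows "\<exists>x\<in>W. (\<Prod>g\<in>T. pt x (l g)) \<noteq> 0"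
  using assms(2,3)
proof (induction T rule: finite_induct)
  case empty
  then show ?case using assms(4) by auto
next
  case (insert g T)
  then obtain x where x: "x \<in> W" "pt x (l g) \<noteq> 0" by blast
  obtain y where y: "y \<in> W" "(\<Prod>g\<in>T. pt y (l g)) \<noteq> 0" using insert by blast
  show ?case
  proof (rule ccontr)
    assume "\<not> ?case"
    then have "pt z (l g) * (\<Prod>g\<in>T. pt z (l g)) = 0" if "z \<in> W" for z
      using that insert by auto
    from Pol_domain[where f = "\<lambda>x. pt x (l g)" and h = "\<lambda>x. \<Prod>g\<in>T. pt x (l g)",
        OF assms(1) Pol.Pol_pt Pol_prod[OF Pol.Pol_pt] x this y(1)] y(2) show False
      by simp
  qed
qed

text \<open>The forms l' h are split off one at a time. On the hyperplane where l' h vanishes, the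
  left side is zero, while the product of the l g is not identically zero because none of them is a
  multiple of l' h; hence f' vanishes there and is divisible by l' h. Applied to the two coprime
  denominators.\<close>

lemma Pol_div_prod_linear:
  assumes "finite T" "finite T'" "f \<in> Pol" "f' \<in> Pol"
    and "\<And>h. h \<in> T' \<Longrightarrow> l' h \<noteq> 0"
    and "\<And>g h a. g \<in> T \<Longrightarrow> h \<in> T' \<Longrightarrow> l g \<noteq> sV a (l' h)"
    and "\<And>x. (\<Prod>h\<in>T'. pt x (l' h)) * f x = (\<Prod>g\<in>T. pt x (l g)) * f' x"
  shows "\<exists>q\<in>Pol. \<forall>x. f' x = (\<Prod>h\<in>T'. pt x (l' h)) * q x"
  using assms(2,4,5,6,7)
proof (induction T' arbitrary: f' rule: finite_induct)
  case empty
  then show ?case by (intro bexI[of _ f']) auto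
next
  case (insert h T')
  have lh: "l' h \<noteq> 0" using insert.prems by auto
  let ?W = "{x. pt x (l' h) = 0}"
  have d: "\<exists>x\<in>?W. (\<Prod>g\<in>T. pt x (l g)) \<noteq> 0"
  proof (rule Pol_prod_linear_nonzero[OF flat_hyperplane assms(1)])
    show "\<exists>x\<in>?W. pt x (l g) \<noteq> 0" if "g \<in> T" for g
      using pt_separates2[OF lh, of "l g"] insert.prems(3)[OF that] by auto
    show "?W \<noteq> {}" using pt_origin by blast
  qed
  then obtain x0 where x0: "x0 \<in> ?W" "(\<Prod>g\<in>T. pt x0 (l g)) \<noteq> 0" by blast
  have Pd: "(\<lambda>x. \<Prod>g\<in>T. pt x (l g)) \<in> Pol" by (intro Pol_prod Pol.intros)
  have "f' x = 0" if "x \<in> ?W" for x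
  proof (rule Pol_domain[OF flat_hyperplane Pd insert.prems(1) x0 _ that])
    fix x assume "x \<in> ?W"
    then show "(\<Prod>g\<in>T. pt x (l g)) * f' x = 0"
      using insert.prems(4)[of x] insert.hyps by simp
  qed
  then obtain f2 where f2: "f2 \<in> Pol" "\<And>x. f' x = pt x (l' h) * f2 x"
    using Pol_div_linear[OF lh insert.prems(1)] by auto
  obtain y where y: "pt y (l' h) \<noteq> 0" using pt_separates[OF lh] by fastforce
  have "(\<Prod>h\<in>T'. pt x (l' h)) * f x = (\<Prod>g\<in>T. pt x (l g)) * f2 x" for x
  proof (rule Pol_cancel[where f = "\<lambda>x. pt x (l' h)"
        and h = "\<lambda>x. (\<Prod>h\<in>T'. pt x (l' h)) * f x"
        and h' = "\<lambda>x. (\<Prod>g\<in>T. pt x (l g)) * f2 x", OF _ _ _ y])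
    fix x
    have "(pt x (l' h) * (\<Prod>h\<in>T'. pt x (l' h))) * f x = (\<Prod>g\<in>T. pt x (l g)) * f' x"
      using insert.prems(4)[of x] insert.hyps by simp
    then show "pt x (l' h) * ((\<Prod>h\<in>T'. pt x (l' h)) * f x)
        = pt x (l' h) * ((\<Prod>g\<in>T. pt x (l g)) * f2 x)"
      by (simp add: f2(2) algebra_simps)
  qed (rule Pol.Pol_pt Pol.Pol_mult[OF Pol_prod[OF Pol.Pol_pt]] assms(3) f2(1))+
  then obtain q where q: "q \<in> Pol" "\<And>x. f2 x = (\<Prod>h\<in>T'. pt x (l' h)) * q x"
    using insert.IH[OF f2(1)] insert.prems(2,3) by auto
  then show ?case using f2(2) insert.hyps
    by (intro bexI[of _ q]) (auto simp: mult.assoc)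
qed

end

section \<open>Linear groups without pseudo-reflections\<close>

locale linear_group = dual_points sV basis
  for sV :: "'k::field \<Rightarrow> 'v::ab_group_add \<Rightarrow> 'v" and basis :: "'v set" +
  fixes G :: "('v \<Rightarrow> 'v) set"
  assumes subgroup_G: "subgroup G (GL sV)" and finite_G: "finite G"
begin

lemma G_linear:
  assumes "g \<in> G"
  shows "g (u + v) = g u + g v" "g (sV a v) = sV a (g v)" "g (u - v) = g u - g v" "bij g"
proof -
  have "g \<in> carrier (GL sV)" using assms subgroup.subset[OF subgroup_G] by blast
  then have l: "Vector_Spaces.linear sV sV g" and b: "bij g" by (auto simp: GL_def)
  show "g (u + v) = g u + g v" using Vector_Spaces.linear.axioms(3)[OF l] module_hom.add by blast
  show "g (sV a v) = sV a (g v)" using Vector_Spaces.linear.axioms(3)[OF l] module_hom.scale by blast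
  show "g (u - v) = g u - g v" using Vector_Spaces.linear.axioms(3)[OF l] module_hom.diff by blast
  show "bij g" by (rule b)
qed

lemma G_closed: "id \<in> G" "g \<in> G \<Longrightarrow> h \<in> G \<Longrightarrow> g \<circ> h \<in> G"
  using subgroup.one_closed[OF subgroup_G] subgroup.m_closed[OF subgroup_G]
  by (auto simp: GL_def)

text \<open>A subgroup is closed under the formal inverse of the record \<open>GL sV\<close>; the
  group laws make this the inverse map.\<close>

lemma group_GL: "group (GL sV)"
proof (rule groupI)
  show "\<exists>h\<in>carrier (GL sV). h \<otimes>\<^bsub>GL sV\<^esub> g = \<one>\<^bsub>GL sV\<^esub>" if "g \<in> carrier (GL sV)" for g
  proof (rule bexI[of _ "inv_into UNIV g"])
    have g: "Vector_Spaces.linear sV sV g" "bij g" using that by (auto simp: GL_def)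
    have hom: "g (u + v) = g u + g v" "g (sV a v) = sV a (g v)" for a u v
      using Vector_Spaces.linear.axioms(3)[OF g(1)] module_hom.add module_hom.scale by blast+
    have inv: "inv_into UNIV g (g v) = v" "g (inv_into UNIV g v) = v" for v
      using g(2) by (auto simp: bij_is_inj bij_is_surj surj_f_inv_f)
    have "Vector_Spaces.linear sV sV (inv_into UNIV g)"
      by unfold_locales (metis hom inv)+
    then show "inv_into UNIV g \<in> carrier (GL sV)" using g by (auto simp: GL_def bij_imp_bij_inv)
    show "inv_into UNIV g \<otimes>\<^bsub>GL sV\<^esub> g = \<one>\<^bsub>GL sV\<^esub>" using g by (auto simp: GL_def bij_is_inj)
  qed
qed (auto simp: GL_def o_assoc bij_comp linear_id Vector_Spaces.linear_compose)

lemma G_inverse: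
  assumes "g \<in> G"
  obtains h where "h \<in> G" "g \<circ> h = id" "h \<circ> g = id"
proof -
  have gG: "g \<in> carrier (GL sV)" using assms subgroup.subset[OF subgroup_G] by blast
  have "inv\<^bsub>GL sV\<^esub> g \<in> G" using subgroup.m_inv_closed[OF subgroup_G assms] .
  moreover have "inv\<^bsub>GL sV\<^esub> g \<otimes>\<^bsub>GL sV\<^esub> g = \<one>\<^bsub>GL sV\<^esub>" "g \<otimes>\<^bsub>GL sV\<^esub> inv\<^bsub>GL sV\<^esub> g = \<one>\<^bsub>GL sV\<^esub>"
    using group.l_inv[OF group_GL gG] group.r_inv[OF group_GL gG] by auto
  ultimately show ?thesis using that by (auto simp: GL_def)
qed

lemma bij_betw_comp_G: "h \<in> G \<Longrightarrow> bij_betw (\<lambda>g. h \<circ> g) G G"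
proof -
  assume h: "h \<in> G"
  then obtain k where k: "k \<in> G" "h \<circ> k = id" "k \<circ> h = id" by (rule G_inverse)
  show ?thesis
    by (rule bij_betw_byWitness[of _ "\<lambda>g. k \<circ> g"]) (auto simp: o_assoc k h G_closed)
qed

lemma G_finite_order:
  assumes "g \<in> G" shows "\<exists>m>0. g ^^ m = id"
proof -
  have mem: "g ^^ n \<in> G" for n
    by (induction n) (simp_all only: funpow.simps assms G_closed)
  have "\<not> inj (\<lambda>n. g ^^ n)"
    using finite_subset[of "range (\<lambda>n. g ^^ n)" G] mem finite_G finite_imageD by fastforce
  then obtain a b where ab: "a < b" "g ^^ a = g ^^ b"
    unfolding inj_def by (metis linorder_neqE_nat)
  have "g ^^ (a + (b - a)) = g ^^ a \<circ> g ^^ (b - a)" by (rule funpow_add)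
  then have "g ^^ a \<circ> g ^^ (b - a) = g ^^ a \<circ> id" using ab by simp
  moreover have "inj (g ^^ a)" using G_linear(4)[OF mem] bij_is_inj by blast
  ultimately have "g ^^ (b - a) = id" by (metis fun.inj_map_strong inj_eq o_apply ext)
  then show ?thesis using ab by (intro exI[of _ "b - a"]) auto
qed

text \<open>The right action on the dual space by precomposition. Applying \<open>pt\<close> first
  makes the result linear for any x, and g then acts on functions by sending f to
  \<open>\<lambda>x. f (act x g)\<close>.\<close>

definition act :: "('v \<Rightarrow> 'k) \<Rightarrow> ('v \<Rightarrow> 'v) \<Rightarrow> ('v \<Rightarrow> 'k)" where
  "act x g = (\<lambda>v. pt x (g v))"

lemma pt_act: "g \<in> G \<Longrightarrow> pt (act x g) = act x g"
  by (rule pt_eq_linear) (auto simp: act_def G_linear pt_add pt_scale)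

lemma act_act: "g \<in> G \<Longrightarrow> act (act x g) h = act x (g \<circ> h)"
  using pt_act[of g x] by (auto simp: act_def)

lemma act_id: "act x id = pt x"
  by (auto simp: act_def)

lemma act_origin [simp]: "act (\<lambda>v. 0) g = (\<lambda>v. 0)"
  by (auto simp: act_def)

lemma Pol_act: "f \<in> Pol \<Longrightarrow> g \<in> G \<Longrightarrow> (\<lambda>x. f (act x g)) \<in> Pol"
proof (induction rule: Pol.induct)
  case (Pol_pt v)
  then show ?case by (simp add: pt_act) (simp add: act_def Pol.Pol_pt)
qed (auto intro: Pol.intros)

text \<open>If 1 - g maps into the line of l, the coefficient c of l is a nonzero linear functional.
  Its kernel is the space of fixed vectors of g, and it has codimension one because v0 completes any
  basis of it.\<close>

lemma displacement_in_line_imp_reflection: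
  assumes g: "g \<in> G" "g \<noteq> id" and line: "\<And>v. \<exists>a. v - g v = sV a l"
  shows "pseudo_reflection sV g"
proof -
  obtain v0 where "g v0 \<noteq> v0" using g(2) by fastforce
  moreover obtain c where c: "\<And>v. v - g v = sV (c v) l" using line by metis
  ultimately have l: "l \<noteq> 0" by (metis eq_iff_diff_eq_0 scale_zero_right)
  have c0: "c v = 0 \<longleftrightarrow> g v = v" for v
    using c[of v] l by (metis eq_iff_diff_eq_0 scale_eq_0_iff)
  have c_add: "c (u + v) = c u + c v" for u v
  proof -
    have "(u + v) - g (u + v) = (u - g u) + (v - g v)" by (simp add: G_linear g)
    then have "sV (c (u + v)) l = sV (c u + c v) l"
      unfolding c scale_left_distrib .
    then show ?thesis using l scale_right_imp_eq by blast
  qed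
  have c_scale: "c (sV a v) = a * c v" for a v
  proof -
    have "sV (c (sV a v)) l = sV (a * c v) l"
      using c[of v] c[of "sV a v"]
      by (metis G_linear(2) g(1) scale_right_diff_distrib scale_scale)
    then show ?thesis using l scale_right_imp_eq by blast
  qed
  let ?H = "{v. c v = 0}"
  have H: "subspace ?H"
    using c_add c_scale[of 0 0] c_scale by (auto simp: subspace_def)
  obtain B where B: "B \<subseteq> ?H" "independent B" "?H \<subseteq> span B" "card B = dim ?H"
    using basis_exists by blast
  have spB: "span B = ?H" using B H by (meson span_minimal subset_antisym)
  have v0: "c v0 \<noteq> 0" using \<open>g v0 \<noteq> v0\<close> c0 by blast
  have v0B: "v0 \<notin> span B" using v0 spB by auto
  have ind: "independent (insert v0 B)" using B(2) v0B by (simp add: independent_insert)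
  have "v \<in> span (insert v0 B)" for v
  proof -
    define w where "w = v + sV (- (c v / c v0)) v0"
    have "c w = 0" unfolding w_def c_add c_scale using v0 by simp
    then have "w \<in> span (insert v0 B)" using spB span_mono[of B "insert v0 B"] by blast
    moreover have "v = w + sV (c v / c v0) v0" unfolding w_def by simp
    ultimately show ?thesis
      by (metis insertI1 span_add span_base span_scale)
  qed
  then have "span (insert v0 B) = UNIV" by blast
  then have "dim UNIV = card (insert v0 B)"
    using ind dim_eq_card dim_UNIV span_UNIV by metis
  moreover have "finite B" using B(2) finiteI_independent by blast
  moreover have "v0 \<notin> B" using v0B span_base by blast
  ultimately have "dim ?H + 1 = dim UNIV" using B(4) by simp
  moreover have "g \<in> carrier (GL sV)" using g subgroup.subset[OF subgroup_G] by blast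
  ultimately show ?thesis
    unfolding pseudo_reflection_def using g G_finite_order[OF g(1)] H c0 by blast
qed

end

section \<open>Displacement vectors v - g v in the absence of pseudo-reflections\<close>

locale reflection_free_group = linear_group sV basis G
  for sV :: "'k::field \<Rightarrow> 'v::ab_group_add \<Rightarrow> 'v" and basis :: "'v set" and G +
  assumes reflection_free: "g \<in> G \<Longrightarrow> \<not> pseudo_reflection sV g"
begin

text \<open>The image of 1 - g contains two independent vectors a1 and a2. The affine line a2 + t a1
  misses the origin and meets each line through the origin in at most one point, so finitely many
  lines exclude finitely many t.\<close>

lemma displacement_avoiding_lines:
  assumes g: "g \<in> G" "g \<noteq> id" and K: "finite K"
  shows "\<exists>v. v - g v \<noteq> 0 \<and> (\<forall>l\<in>K. \<forall>a. v - g v \<noteq> sV a l)"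
proof -
  obtain v1 where v1: "g v1 \<noteq> v1" using g(2) by fastforce
  define a1 where "a1 = v1 - g v1"
  have a1: "a1 \<noteq> 0" using v1 by (simp add: a1_def)
  obtain v2 where v2: "\<And>a. v2 - g v2 \<noteq> sV a a1"
    using displacement_in_line_imp_reflection[OF g, of a1] reflection_free[OF g(1)] by blast
  define a2 where "a2 = v2 - g v2"
  let ?u = "\<lambda>t. a2 + sV t a1"
  have one: "t = s" if "?u t = sV a l" "?u s = sV b l" for l a b t s
  proof (rule ccontr)
    assume ts: "t \<noteq> s"
    have "sV (t - s) a1 = sV (a - b) l"
      using that by (metis add_diff_cancel_left scale_left_diff_distrib)
    then have "a1 = sV ((a - b) / (t - s)) l"
      using ts by (metis divide_inverse_commute eq_iff_diff_eq_0 left_inverse scale_one scale_scale)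
    then obtain k where k: "a1 = sV k l" "k \<noteq> 0" using a1 by (metis scale_zero_left)
    then have "l = sV (inverse k) a1" by simp
    then have "a2 = sV (a * inverse k - t) a1"
      using that(1) by (metis add_diff_cancel_right' scale_left_diff_distrib scale_scale)
    then show False using v2[of "a * inverse k - t"] unfolding a2_def by metis
  qed
  have "finite {t. \<exists>a. ?u t = sV a l}" for l
  proof (cases "\<exists>t a. ?u t = sV a l")
    case True
    then obtain s b where "?u s = sV b l" by blast
    then have "{t. \<exists>a. ?u t = sV a l} \<subseteq> {s}" using one by blast
    then show ?thesis by (rule finite_subset) simp
  qed auto
  then have "finite (\<Union>l\<in>K. {t. \<exists>a. ?u t = sV a l})" using K by blast
  then obtain t where t: "t \<notin> (\<Union>l\<in>K. {t. \<exists>a. ?u t = sV a l})"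
    using infinite_field ex_new_if_finite by blast
  have u: "(v2 + sV t v1) - g (v2 + sV t v1) = ?u t"
    by (simp add: a1_def a2_def G_linear g scale_right_diff_distrib)
  have "?u t \<noteq> 0"
  proof
    assume "?u t = 0"
    then have "a2 = sV (- t) a1" by (simp add: eq_neg_iff_add_eq_0)
    then show False using v2[of "- t"] unfolding a2_def by metis
  qed
  then show ?thesis using t u by (intro exI[of _ "v2 + sV t v1"]) auto
qed

text \<open>The family s' is chosen first; its displacements span finitely many lines, which s then
  avoids. This makes \<open>discr s\<close> and \<open>discr s'\<close> products of pairwise
  non-proportional linear forms.\<close>

lemma independent_displacements:
  obtains s s' where
    "\<And>g. g \<in> G - {id} \<Longrightarrow> s g - g (s g) \<noteq> 0"
    "\<And>g. g \<in> G - {id} \<Longrightarrow> s' g - g (s' g) \<noteq> 0"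
    "\<And>g h a. g \<in> G - {id} \<Longrightarrow> h \<in> G - {id} \<Longrightarrow> s g - g (s g) \<noteq> sV a (s' h - h (s' h))"
proof -
  have "\<forall>g\<in>G - {id}. \<exists>v. v - g v \<noteq> 0"
    using displacement_avoiding_lines[of _ "{}"] by auto
  then obtain s' where s': "\<forall>g\<in>G - {id}. s' g - g (s' g) \<noteq> 0" by metis
  let ?K = "(\<lambda>h. s' h - h (s' h)) ` (G - {id})"
  have "\<forall>g\<in>G - {id}. \<exists>v. v - g v \<noteq> 0 \<and> (\<forall>l\<in>?K. \<forall>a. v - g v \<noteq> sV a l)"
    using displacement_avoiding_lines[of _ ?K] finite_G by auto
  from bchoice[OF this] obtain s where
    s: "\<forall>g\<in>G - {id}. s g - g (s g) \<noteq> 0 \<and> (\<forall>l\<in>?K. \<forall>a. s g - g (s g) \<noteq> sV a l)"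
    by blast
  show ?thesis by (rule that[of s s']) (use s s' in auto)
qed

end

section \<open>Denominators and separating families\<close>

context linear_group
begin

text \<open>The value at h = 1 of the product of h s_g - g s_g over g \<noteq> 1; at any other h in
  G the factor with g = h is zero.\<close>

definition discr :: "(('v \<Rightarrow> 'v) \<Rightarrow> 'v) \<Rightarrow> ('v \<Rightarrow> 'k) \<Rightarrow> 'k" where
  "discr s x = (\<Prod>g\<in>G - {id}. pt x (s g - g (s g)))"

lemma discr_Pol: "discr s \<in> Pol"
  using Pol_prod[of "G - {id}" "\<lambda>g x. pt x (s g - g (s g))"]
  by (simp add: discr_def[abs_def] Pol_pt)

lemma discr_nonzero:
  assumes "\<And>g. g \<in> G - {id} \<Longrightarrow> s g - g (s g) \<noteq> 0"
  shows "\<exists>x. discr s x \<noteq> 0"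
proof -
  have "\<exists>x\<in>UNIV. pt x (s g - g (s g)) \<noteq> 0" if "g \<in> G - {id}" for g
    using pt_separates[OF assms[OF that]] by (metis UNIV_I zero_neq_one)
  then show ?thesis
    using Pol_prod_linear_nonzero[OF flat_UNIV, of "G - {id}" "\<lambda>g. s g - g (s g)"] finite_G
    unfolding discr_def by blast
qed

text \<open>A single factor is a sum of two terms a(x) c(xh): s_g evaluated at
  \<open>act x h\<close>, and the scalar - (g s_g)(x), which does not involve h. Multiplying it in
  doubles the list.\<close>

lemma separating_family_aux:
  assumes "finite T"
  shows "\<exists>ps. set ps \<subseteq> Pol \<times> Pol \<and>
    (\<forall>h\<in>G. \<forall>x. (\<Sum>(a, c)\<leftarrow>ps. a x * c (act x h)) = (\<Prod>g\<in>T. pt x (h (s g)) - pt x (g (s g))))"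
  using assms
proof (induction T rule: finite_induct)
  case empty
  show ?case by (rule exI[of _ "[(\<lambda>x. 1, \<lambda>x. 1)]"]) (auto intro: Pol.intros)
next
  case (insert g T)
  from insert.IH obtain ps where ps: "set ps \<subseteq> Pol \<times> Pol"
    "\<forall>h\<in>G. \<forall>x. (\<Sum>(a, c)\<leftarrow>ps. a x * c (act x h)) = (\<Prod>g\<in>T. pt x (h (s g)) - pt x (g (s g)))"
    by blast
  let ?ps = "map (\<lambda>(a, c). (a, \<lambda>x. pt x (s g) * c x)) ps @
    map (\<lambda>(a, c). (\<lambda>x. - pt x (g (s g)) * a x, c)) ps"
  have "set ?ps \<subseteq> Pol \<times> Pol"
    using ps(1) by (auto intro!: Pol_mult Pol_pt Pol_uminus)
  moreover have "(\<Sum>(a, c)\<leftarrow>?ps. a x * c (act x h)) = (\<Prod>g\<in>insert g T. pt x (h (s g)) - pt x (g (s g)))"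
    if h: "h \<in> G" for h x
  proof -
    have "pt (act x h) (s g) = pt x (h (s g))"
      using pt_act[OF h, of x] by (simp add: act_def)
    then have 1: "(\<Sum>(a, c)\<leftarrow>map (\<lambda>(a, c). (a, \<lambda>x. pt x (s g) * c x)) qs. a x * c (act x h))
        = pt x (h (s g)) * (\<Sum>(a, c)\<leftarrow>qs. a x * c (act x h))" for qs
      by (induction qs) (auto simp: algebra_simps)
    have 2: "(\<Sum>(a, c)\<leftarrow>map (\<lambda>(a, c). (\<lambda>x. - pt x (g (s g)) * a x, c)) qs. a x * c (act x h))
        = - pt x (g (s g)) * (\<Sum>(a, c)\<leftarrow>qs. a x * c (act x h))" for qs
      by (induction qs) (auto simp: algebra_simps)
    show ?thesis
      unfolding map_append sum_list_append 1 2 ps(2)[rule_format, OF h]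
      using insert.hyps by (simp add: algebra_simps)
  qed
  ultimately show ?case by blast
qed

text \<open>The idempotent of \<open>S \<otimes> S\<close> separating the graph of the identity from the graphs of the other
  group elements, up to the factor \<open>discr s\<close>.\<close>

definition separating where
  "separating s N a c \<longleftrightarrow> (\<forall>i<N::nat. a i \<in> Pol \<and> c i \<in> Pol) \<and>
    (\<forall>h\<in>G. \<forall>x. (\<Sum>i<N. a i x * c i (act x h)) = (if h = id then discr s x else 0))"

lemma separating_family: "\<exists>N a c. separating s N a c"
proof -
  obtain ps where ps: "set ps \<subseteq> Pol \<times> Pol"
    "\<forall>h\<in>G. \<forall>x. (\<Sum>(a, c)\<leftarrow>ps. a x * c (act x h))
      = (\<Prod>g\<in>G - {id}. pt x (h (s g)) - pt x (g (s g)))"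
    using separating_family_aux[OF finite_Diff[OF finite_G]] by blast
  have pn: "fst (ps ! i) \<in> Pol" "snd (ps ! i) \<in> Pol" if "i < length ps" for i
    using subsetD[OF ps(1) nth_mem[OF that]] by (auto simp: mem_Times_iff)
  have "separating s (length ps) (\<lambda>i. fst (ps ! i)) (\<lambda>i. snd (ps ! i))"
    unfolding separating_def
  proof (intro conjI allI ballI impI)
    fix h x assume h: "h \<in> G"
    have "(\<Sum>i<length ps. fst (ps ! i) x * snd (ps ! i) (act x h))
        = (\<Sum>(a, c)\<leftarrow>ps. a x * c (act x h))"
      by (simp add: sum_list_sum_nth atLeast0LessThan case_prod_beta)
    also have "\<dots> = (if h = id then discr s x else 0)"
      unfolding ps(2)[rule_format, OF h] discr_def using h finite_G
      by (auto simp: pt_diff intro!: prod_zero)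
    finally show "(\<Sum>i<length ps. fst (ps ! i) x * snd (ps ! i) (act x h))
      = (if h = id then discr s x else 0)" .
  qed (use pn in auto)
  then show ?thesis by blast
qed

end

section \<open>Equivariant polynomial maps\<close>

locale group_covariants = reflection_free_group sV basis G + W: vector_space sW
  for sV :: "'k::field \<Rightarrow> 'v::ab_group_add \<Rightarrow> 'v" and basis :: "'v set" and G
    and sW :: "'k \<Rightarrow> 'w::ab_group_add \<Rightarrow> 'w"
begin

abbreviation coord :: "'w set \<Rightarrow> 'w \<Rightarrow> 'w \<Rightarrow> 'k" where
  "coord \<equiv> W.representation"

text \<open>A basis stands for the subspace, so that polynomial maps and homomorphisms have
  coordinates.\<close>

definition rep_basis :: "'w set \<Rightarrow> (('v \<Rightarrow> 'v) \<Rightarrow> 'w \<Rightarrow> 'w) \<Rightarrow> bool" where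
  "rep_basis B \<rho> \<longleftrightarrow> finite B \<and> W.independent B \<and> representation_on G sW (W.span B) \<rho>"

definition PolW :: "'w set \<Rightarrow> (('v \<Rightarrow> 'k) \<Rightarrow> 'w) set" where
  "PolW B = {F. (\<forall>x. F x \<in> W.span B) \<and> (\<forall>b\<in>B. (\<lambda>x. coord B (F x) b) \<in> Pol)}"

definition Inv :: "(('v \<Rightarrow> 'k) \<Rightarrow> 'k) set" where
  "Inv = {f \<in> Pol. \<forall>g\<in>G. \<forall>x. f (act x g) = f x}"

text \<open>These are the fixed points of the diagonal action, which on polynomial maps sends F to
  \<open>\<lambda>x. \<rho> g (F (act x g))\<close> (\<open>tensor_action\<close>).\<close>

definition Equi :: "'w set \<Rightarrow> (('v \<Rightarrow> 'v) \<Rightarrow> 'w \<Rightarrow> 'w) \<Rightarrow> (('v \<Rightarrow> 'k) \<Rightarrow> 'w) set" where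
  "Equi B \<rho> = {F \<in> PolW B. \<forall>g\<in>G. \<forall>x. \<rho> g (F (act x g)) = F x}"

definition tr0 :: "(('v \<Rightarrow> 'k) \<Rightarrow> 'k) \<Rightarrow> ('v \<Rightarrow> 'k) \<Rightarrow> 'k" where
  "tr0 f x = (\<Sum>g\<in>G. f (act x g))"

definition tr :: "(('v \<Rightarrow> 'v) \<Rightarrow> 'w \<Rightarrow> 'w) \<Rightarrow> (('v \<Rightarrow> 'k) \<Rightarrow> 'w) \<Rightarrow> ('v \<Rightarrow> 'k) \<Rightarrow> 'w" where
  "tr \<rho> F x = (\<Sum>g\<in>G. \<rho> g (F (act x g)))"

lemma tr0_Inv: "f \<in> Pol \<Longrightarrow> tr0 f \<in> Inv"
proof -
  assume f: "f \<in> Pol"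
  have "tr0 f \<in> Pol"
    unfolding tr0_def[abs_def] by (intro Pol_sum Pol_act f)
  moreover have "tr0 f (act x h) = tr0 f x" if h: "h \<in> G" for h x
  proof -
    have "tr0 f (act x h) = (\<Sum>g\<in>G. f (act x (h \<circ> g)))"
      unfolding tr0_def using h by (simp add: act_act)
    also have "\<dots> = tr0 f x"
      unfolding tr0_def using sum.reindex_bij_betw[OF bij_betw_comp_G[OF h], of "\<lambda>g. f (act x g)"] .
    finally show ?thesis .
  qed
  ultimately show ?thesis by (simp add: Inv_def)
qed

lemma PolW_span: "F \<in> PolW B \<Longrightarrow> F x \<in> W.span B"
  by (simp add: PolW_def)

lemma PolW_coord: "F \<in> PolW B \<Longrightarrow> b \<in> B \<Longrightarrow> (\<lambda>x. coord B (F x) b) \<in> Pol"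
  by (simp add: PolW_def)

lemma Equi_PolW: "F \<in> Equi B \<rho> \<Longrightarrow> F \<in> PolW B"
  by (simp add: Equi_def)

context
  fixes B \<rho>
  assumes rb: "rep_basis B \<rho>"
begin

lemma finite_B: "finite B" and indep_B: "W.independent B"
  using rb by (auto simp: rep_basis_def)

lemma rho_span: "g \<in> G \<Longrightarrow> u \<in> W.span B \<Longrightarrow> \<rho> g u \<in> W.span B"
  and rho_add: "g \<in> G \<Longrightarrow> u \<in> W.span B \<Longrightarrow> v \<in> W.span B \<Longrightarrow> \<rho> g (u + v) = \<rho> g u + \<rho> g v"
  and rho_scale: "g \<in> G \<Longrightarrow> u \<in> W.span B \<Longrightarrow> \<rho> g (sW a u) = sW a (\<rho> g u)"
  and rho_id: "u \<in> W.span B \<Longrightarrow> \<rho> id u = u"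
  and rho_comp: "g \<in> G \<Longrightarrow> h \<in> G \<Longrightarrow> u \<in> W.span B \<Longrightarrow> \<rho> (g \<circ> h) u = \<rho> g (\<rho> h u)"
  using rb by (auto simp: rep_basis_def representation_on_def)

lemma rho_zero: "g \<in> G \<Longrightarrow> \<rho> g 0 = 0"
  using rho_scale[of g 0 0] W.span_zero by simp

lemma rho_sum:
  "g \<in> G \<Longrightarrow> (\<And>e. e \<in> E \<Longrightarrow> u e \<in> W.span B) \<Longrightarrow> \<rho> g (\<Sum>e\<in>E. u e) = (\<Sum>e\<in>E. \<rho> g (u e))"
  by (induction E rule: infinite_finite_induct) (auto simp: rho_zero rho_add W.span_sum)

lemma coord_add: "u \<in> W.span B \<Longrightarrow> v \<in> W.span B \<Longrightarrow> coord B (u + v) b = coord B u b + coord B v b"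
  by (simp add: W.representation_add[OF indep_B])

lemma coord_scale: "u \<in> W.span B \<Longrightarrow> coord B (sW a u) b = a * coord B u b"
  by (simp add: W.representation_scale[OF indep_B])

lemma coord_zero: "coord B 0 b = 0"
  by (simp add: W.representation_zero)

lemma coord_sum:
  "(\<And>e. e \<in> E \<Longrightarrow> u e \<in> W.span B) \<Longrightarrow> coord B (\<Sum>e\<in>E. u e) b = (\<Sum>e\<in>E. coord B (u e) b)"
  by (induction E rule: infinite_finite_induct) (auto simp: coord_zero coord_add W.span_sum)

lemma coord_basis: "e \<in> B \<Longrightarrow> coord B e b = (if b = e then 1 else 0)"
  by (auto simp: W.representation_basis[OF indep_B])

lemma coord_expand: "u \<in> W.span B \<Longrightarrow> (\<Sum>b\<in>B. sW (coord B u b) b) = u"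
  using W.sum_representation_eq[OF indep_B _ finite_B subset_refl] by blast

lemma coord_eqI:
  "u \<in> W.span B \<Longrightarrow> v \<in> W.span B \<Longrightarrow> (\<And>b. b \<in> B \<Longrightarrow> coord B u b = coord B v b) \<Longrightarrow> u = v"
  by (metis (no_types, lifting) coord_expand sum.cong)

lemma coord_rho:
  assumes "g \<in> G" "u \<in> W.span B"
  shows "coord B (\<rho> g u) c = (\<Sum>b\<in>B. coord B u b * coord B (\<rho> g b) c)"
proof -
  have "coord B (\<rho> g (\<Sum>b\<in>B. sW (coord B u b) b)) c = (\<Sum>b\<in>B. coord B u b * coord B (\<rho> g b) c)"
    using assms(1)
    by (simp add: rho_sum rho_scale coord_sum coord_scale rho_span W.span_base W.span_scale)
  then show ?thesis using coord_expand[OF assms(2)] by simp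
qed

lemma PolW_at_pt: "F \<in> PolW B \<Longrightarrow> F (pt x) = F x"
  using Pol_at_pt by (intro coord_eqI) (auto simp: PolW_def)

lemma PolW_add: "F \<in> PolW B \<Longrightarrow> H \<in> PolW B \<Longrightarrow> (\<lambda>x. F x + H x) \<in> PolW B"
  by (auto simp: PolW_def coord_add W.span_add intro: Pol_add)

lemma PolW_mult: "f \<in> Pol \<Longrightarrow> F \<in> PolW B \<Longrightarrow> (\<lambda>x. sW (f x) (F x)) \<in> PolW B"
  by (auto simp: PolW_def coord_scale W.span_scale intro: Pol_mult)

lemma PolW_const: "u \<in> W.span B \<Longrightarrow> (\<lambda>x. u) \<in> PolW B"
  by (auto simp: PolW_def intro: Pol_const)

lemma PolW_sum: "(\<And>e. e \<in> E \<Longrightarrow> F e \<in> PolW B) \<Longrightarrow> (\<lambda>x. \<Sum>e\<in>E. F e x) \<in> PolW B"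
  by (induction E rule: infinite_finite_induct) (auto intro: PolW_const PolW_add W.span_zero)

lemma PolW_uminus: "F \<in> PolW B \<Longrightarrow> (\<lambda>x. - F x) \<in> PolW B"
  using PolW_mult[OF Pol_const[of "-1"], of F] by simp

lemma PolW_diff: "F \<in> PolW B \<Longrightarrow> H \<in> PolW B \<Longrightarrow> (\<lambda>x. F x - H x) \<in> PolW B"
  using PolW_add[OF _ PolW_uminus, of F H] by simp

lemma PolW_rho:
  assumes F: "F \<in> PolW B" and g: "g \<in> G" shows "(\<lambda>x. \<rho> g (F (act x g))) \<in> PolW B"
proof -
  have "(\<lambda>x. coord B (F (act x g)) b) \<in> Pol" if "b \<in> B" for b
    using Pol_act[OF PolW_coord[OF F that] g] .
  then have "(\<lambda>x. \<Sum>b\<in>B. coord B (F (act x g)) b * coord B (\<rho> g b) c) \<in> Pol" for c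
    by (intro Pol_sum Pol_mult Pol_const)
  then show ?thesis
    unfolding PolW_def by (simp add: rho_span PolW_span[OF F] g coord_rho)
qed

lemma PolW_zero_off:
  assumes "F \<in> PolW B" "f \<in> Pol" "f x0 \<noteq> 0" "\<And>x. sW (f x) (F x) = 0"
  shows "F x = 0"
proof (rule coord_eqI)
  fix b assume b: "b \<in> B"
  have "f x * coord B (F x) b = 0" for x
    using assms(4)[of x] coord_scale[OF PolW_span[OF assms(1)], of "f x" x b] by (metis coord_zero)
  then have "coord B (F x) b = 0"
    using Pol_domain[OF flat_UNIV assms(2) PolW_coord[OF assms(1) b], of x0 x] assms(3) by simp
  then show "coord B (F x) b = coord B 0 b" by (simp add: coord_zero)
qed (auto simp: PolW_span[OF assms(1)] W.span_zero)

lemma Equi_add: "F \<in> Equi B \<rho> \<Longrightarrow> H \<in> Equi B \<rho> \<Longrightarrow> (\<lambda>x. F x + H x) \<in> Equi B \<rho>"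
  by (simp add: Equi_def PolW_add rho_add PolW_span)

lemma Equi_mult: "f \<in> Inv \<Longrightarrow> F \<in> Equi B \<rho> \<Longrightarrow> (\<lambda>x. sW (f x) (F x)) \<in> Equi B \<rho>"
  by (simp add: Equi_def Inv_def PolW_mult rho_scale PolW_span)

lemma Equi_zero: "(\<lambda>x. 0) \<in> Equi B \<rho>"
  by (simp add: Equi_def rho_zero PolW_const W.span_zero)

lemma Equi_sum: "(\<And>e. e \<in> E \<Longrightarrow> F e \<in> Equi B \<rho>) \<Longrightarrow> (\<lambda>x. \<Sum>e\<in>E. F e x) \<in> Equi B \<rho>"
  by (induction E rule: infinite_finite_induct) (auto intro: Equi_zero Equi_add)

lemma tr_Equi:
  assumes F: "F \<in> PolW B" shows "tr \<rho> F \<in> Equi B \<rho>"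
proof -
  have "tr \<rho> F \<in> PolW B"
    unfolding tr_def[abs_def] by (intro PolW_sum PolW_rho F)
  moreover have "\<rho> h (tr \<rho> F (act x h)) = tr \<rho> F x" if h: "h \<in> G" for h x
  proof -
    have "\<rho> h (tr \<rho> F (act x h)) = (\<Sum>g\<in>G. \<rho> (h \<circ> g) (F (act x (h \<circ> g))))"
      unfolding tr_def using h by (simp add: act_act rho_sum rho_span PolW_span[OF F] rho_comp)
    also have "\<dots> = tr \<rho> F x"
      unfolding tr_def
      using sum.reindex_bij_betw[OF bij_betw_comp_G[OF h], of "\<lambda>g. \<rho> g (F (act x g))"] .
    finally show ?thesis .
  qed
  ultimately show ?thesis by (simp add: Equi_def)
qed

text \<open>Projection formula: an equivariant F comes out of the trace. The remaining scalar
  \<open>tr0 f\<close> is invariant and so commutes with R-linear maps.\<close>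

lemma tr_mult_Equi:
  assumes "F \<in> Equi B \<rho>"
  shows "tr \<rho> (\<lambda>y. sW (f y) (F y)) x = sW (tr0 f x) (F x)"
proof -
  have "\<rho> g (sW (f (act x g)) (F (act x g))) = sW (f (act x g)) (F x)" if "g \<in> G" for g
    using that assms by (simp add: Equi_def rho_scale PolW_span)
  then show ?thesis unfolding tr_def tr0_def by (simp add: W.scale_sum_left)
qed

lemma tr_sum:
  assumes "\<And>e. e \<in> E \<Longrightarrow> F e \<in> PolW B"
  shows "tr \<rho> (\<lambda>y. \<Sum>e\<in>E. F e y) x = (\<Sum>e\<in>E. tr \<rho> (F e) x)"
proof -
  have "\<rho> g (\<Sum>e\<in>E. F e (act x g)) = (\<Sum>e\<in>E. \<rho> g (F e (act x g)))" if "g \<in> G" for g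
    using that assms by (simp add: rho_sum PolW_span)
  then show ?thesis
    unfolding tr_def by (simp add: sum.swap[of _ G])
qed

context
  fixes N :: nat and a c :: "nat \<Rightarrow> ('v \<Rightarrow> 'k) \<Rightarrow> 'k" and s
  assumes sep: "separating s N a c"
    and disp: "\<And>g. g \<in> G - {id} \<Longrightarrow> s g - g (s g) \<noteq> 0"
begin

text \<open>After exchanging the sums, the separating family kills every summand of the trace except
  g = id. Thus \<open>discr s\<close> times any polynomial map is an S-combination of equivariant
  maps.\<close>

lemma tr_reproduce:
  assumes F: "F \<in> PolW B"
  shows "(\<Sum>i<N. sW (a i x) (tr \<rho> (\<lambda>y. sW (c i y) (F y)) x)) = sW (discr s x) (F x)"
proof -
  have "(\<Sum>i<N. sW (a i x) (tr \<rho> (\<lambda>y. sW (c i y) (F y)) x))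
      = (\<Sum>i<N. \<Sum>g\<in>G. sW (a i x * c i (act x g)) (\<rho> g (F (act x g))))"
    unfolding tr_def by (simp add: W.scale_sum_right rho_scale PolW_span[OF F])
  also have "\<dots> = (\<Sum>g\<in>G. sW (\<Sum>i<N. a i x * c i (act x g)) (\<rho> g (F (act x g))))"
    by (subst sum.swap) (simp add: W.scale_sum_left)
  also have "\<dots> = (\<Sum>g\<in>G. if g = id then sW (discr s x) (F x) else 0)"
  proof (rule sum.cong)
    fix g assume g: "g \<in> G"
    have "\<rho> id (F (pt x)) = F x" using F by (simp add: rho_id PolW_span PolW_at_pt)
    then show "sW (\<Sum>i<N. a i x * c i (act x g)) (\<rho> g (F (act x g)))
        = (if g = id then sW (discr s x) (F x) else 0)"
      using g sep unfolding separating_def by (auto simp: act_id)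
  qed simp
  also have "\<dots> = sW (discr s x) (F x)"
    using finite_G G_closed(1) by (simp add: sum.delta')
  finally show ?thesis .
qed

text \<open>Nondegeneracy of the trace: the multipliers c i alone already recover
  \<open>discr s\<close> times F. Identities between polynomial maps may therefore be checked on
  traces of all their multiples.\<close>

lemma tr_faithful:
  assumes F: "F \<in> PolW B" and "\<And>q x. q \<in> Pol \<Longrightarrow> tr \<rho> (\<lambda>y. sW (q y) (F y)) x = 0"
  shows "F x = 0"
proof -
  obtain x0 where "discr s x0 \<noteq> 0" using discr_nonzero[of s] disp by blast
  moreover have "sW (discr s x) (F x) = 0" for x
    unfolding tr_reproduce[OF F, symmetric] using assms(2) sep by (simp add: separating_def)
  ultimately show ?thesis using PolW_zero_off[OF F discr_Pol] by blast
qed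

end

text \<open>The values of the equivariant maps span \<open>W.span B\<close> at a generic point.\<close>

lemma Equi_generic:
  assumes r: "\<And>e. e \<in> B \<Longrightarrow> r e \<in> Pol"
    and van: "\<And>F x. F \<in> Equi B \<rho> \<Longrightarrow> (\<Sum>e\<in>B. coord B (F x) e * r e x) = 0"
    and e: "e \<in> B"
  shows "r e x = 0"
proof -
  obtain s where s: "\<And>g. g \<in> G - {id} \<Longrightarrow> s g - g (s g) \<noteq> 0"
    using independent_displacements by metis
  obtain N a c where sf: "separating s N a c"
    using separating_family by blast
  have eW: "(\<lambda>x. e) \<in> PolW B" using e by (simp add: PolW_const W.span_base)
  \<comment> \<open>Traces of multiples of the constant map e. Their combination with coefficients a
    i is \<open>discr s\<close> times e, which isolates \<open>r e\<close>.\<close>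
  let ?F = "\<lambda>i. tr \<rho> (\<lambda>y. sW (c i y) e)"
  have FM: "?F i \<in> Equi B \<rho>" if "i < N" for i
    using tr_Equi[OF PolW_mult[OF _ eW], of "c i"] sf that by (simp add: separating_def)
  have "discr s x * r e x = 0" for x
  proof -
    have *: "(\<Sum>i<N. a i x * coord B (?F i x) b) = discr s x * (if b = e then 1 else 0)" for b
    proof -
      have "(\<Sum>i<N. a i x * coord B (?F i x) b) = coord B (\<Sum>i<N. sW (a i x) (?F i x)) b"
        by (subst coord_sum) (auto simp: coord_scale PolW_span[OF Equi_PolW[OF FM]] W.span_scale)
      also have "\<dots> = coord B (sW (discr s x) e) b"
        using tr_reproduce[OF sf s eW] by simp
      also have "\<dots> = discr s x * (if b = e then 1 else 0)"
        using e by (simp add: coord_scale W.span_base coord_basis)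
      finally show ?thesis .
    qed
    have "0 = (\<Sum>i<N. a i x * (\<Sum>b\<in>B. coord B (?F i x) b * r b x))"
      using van[OF FM] by simp
    also have "\<dots> = (\<Sum>b\<in>B. (\<Sum>i<N. a i x * coord B (?F i x) b) * r b x)"
      unfolding sum_distrib_left sum_distrib_right by (subst sum.swap) (simp add: mult.assoc)
    also have "\<dots> = (\<Sum>b\<in>B. if b = e then discr s x * r e x else 0)"
      unfolding * by (rule sum.cong) auto
    also have "\<dots> = discr s x * r e x" using e finite_B by simp
    finally show ?thesis by simp
  qed
  moreover obtain x0 where "discr s x0 \<noteq> 0" using discr_nonzero[of s] s by blast
  ultimately show ?thesis
    using Pol_domain[OF flat_UNIV discr_Pol r[OF e], of x0 s x] by simp
qed

lemma Equi_nonzero: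
  assumes "B \<noteq> {}" shows "\<exists>F\<in>Equi B \<rho>. \<exists>x. F x \<noteq> 0"
proof (rule ccontr)
  assume "\<not> ?thesis"
  then have "F x = 0" if "F \<in> Equi B \<rho>" for F x
    using that by blast
  then have "coord B (F x) e = 0" if "F \<in> Equi B \<rho>" for F x e
    using that coord_zero by metis
  then have "(\<Sum>e\<in>B. coord B (F x) e * 1) = 0" if "F \<in> Equi B \<rho>" for F x
    using that by (intro sum.neutral) simp
  moreover obtain e where "e \<in> B" using assms by blast
  ultimately show False using Equi_generic[of "\<lambda>e x. 1"] by (auto intro: Pol_const)
qed

end

end

section \<open>Linear maps between modules of equivariant maps\<close>

context group_covariants
begin

definition equi_hom where
  "equi_hom B \<rho> B' \<rho>' \<phi> \<longleftrightarrow>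
     (\<forall>F\<in>Equi B \<rho>. \<phi> F \<in> Equi B' \<rho>') \<and>
     (\<forall>F\<in>Equi B \<rho>. \<forall>H\<in>Equi B \<rho>. \<phi> (\<lambda>x. F x + H x) = (\<lambda>x. \<phi> F x + \<phi> H x)) \<and>
     (\<forall>f\<in>Inv. \<forall>F\<in>Equi B \<rho>. \<phi> (\<lambda>x. sW (f x) (F x)) = (\<lambda>x. sW (f x) (\<phi> F x)))"

text \<open>Rows belong to the source and columns to the target, so that a composite has the matrix
  \<open>\<Sum>d. Q e d x * Q' d c x\<close>. That \<open>\<phi>\<close> is given pointwise at all
  is the content of \<open>hom_matrix_exists\<close>.\<close>

definition hom_matrix where
  "hom_matrix B \<rho> B' \<phi> Q \<longleftrightarrow>
     (\<forall>e\<in>B. \<forall>c\<in>B'. Q e c \<in> Pol) \<and>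
     (\<forall>F\<in>Equi B \<rho>. \<forall>x. \<forall>c\<in>B'. coord B' (\<phi> F x) c = (\<Sum>e\<in>B. coord B (F x) e * Q e c x))"

lemma tr_diff:
  assumes rb: "rep_basis B \<rho>" and "F \<in> PolW B" "H \<in> PolW B"
  shows "tr \<rho> (\<lambda>y. F y - H y) x = tr \<rho> F x - tr \<rho> H x"
proof -
  have "\<rho> g (u - v) = \<rho> g u - \<rho> g v" if "g \<in> G" "u \<in> W.span B" "v \<in> W.span B" for g u v
    using rho_add[OF rb that(1) W.span_diff[OF that(2,3)] that(3)] by (simp add: algebra_simps)
  then show ?thesis
    using assms(2,3) by (simp add: tr_def sum_subtractf PolW_span)
qed

context
  fixes B \<rho> B' \<rho>' \<phi>
  assumes rb: "rep_basis B \<rho>" and rb': "rep_basis B' \<rho>'"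
    and hom: "equi_hom B \<rho> B' \<rho>' \<phi>"
begin

lemma hom_closed: "F \<in> Equi B \<rho> \<Longrightarrow> \<phi> F \<in> Equi B' \<rho>'"
  and hom_add: "F \<in> Equi B \<rho> \<Longrightarrow> H \<in> Equi B \<rho> \<Longrightarrow> \<phi> (\<lambda>x. F x + H x) = (\<lambda>x. \<phi> F x + \<phi> H x)"
  and hom_mult: "f \<in> Inv \<Longrightarrow> F \<in> Equi B \<rho> \<Longrightarrow> \<phi> (\<lambda>x. sW (f x) (F x)) = (\<lambda>x. sW (f x) (\<phi> F x))"
  using hom by (simp_all add: equi_hom_def)

lemma hom_zero: "\<phi> (\<lambda>x. 0) = (\<lambda>x. 0)"
proof -
  have "(\<lambda>x. 0) \<in> Inv" by (simp add: Inv_def Pol_const)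
  from hom_mult[OF this Equi_zero[OF rb]] show ?thesis by simp
qed

lemma hom_sum:
  "(\<And>e. e \<in> E \<Longrightarrow> F e \<in> Equi B \<rho>) \<Longrightarrow>
    \<phi> (\<lambda>x. \<Sum>e\<in>E. F e x) = (\<lambda>x. \<Sum>e\<in>E. \<phi> (F e) x)"
proof (induction E rule: infinite_finite_induct)
  case (insert e E)
  then have "\<phi> (\<lambda>x. F e x + (\<Sum>e\<in>E. F e x)) = (\<lambda>x. \<phi> (F e) x + \<phi> (\<lambda>x. \<Sum>e\<in>E. F e x) x)"
    by (intro hom_add Equi_sum[OF rb]) auto
  then show ?case using insert by simp
qed (auto simp: hom_zero)

text \<open>An \<open>R\<close>-linear map is evaluated on the \<open>S\<close>-linear combinations \<open>\<Sum>i. a i * tr (c i * b)\<close>, which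
  equal \<open>discr s * b\<close>; the identity is checked after taking traces against all of \<open>S\<close>.\<close>

lemma discr_hom:
  assumes sep: "separating s N a c"
    and disp: "\<And>g. g \<in> G - {id} \<Longrightarrow> s g - g (s g) \<noteq> 0"
    and F: "F \<in> Equi B \<rho>"
  shows "(\<Sum>b\<in>B. sW (coord B (F x) b) (\<Sum>i<N. sW (a i x) (\<phi> (tr \<rho> (\<lambda>y. sW (c i y) b)) x)))
    = sW (discr s x) (\<phi> F x)"
proof -
  have ac: "a i \<in> Pol" "c i \<in> Pol" if "i < N" for i
    using sep that by (auto simp: separating_def)
  have bW: "(\<lambda>x. b) \<in> PolW B" if "b \<in> B" for b using that rb by (simp add: PolW_const W.span_base)
  define m where "m b i = tr \<rho> (\<lambda>y. sW (c i y) b)" for b i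
  have m: "m b i \<in> Equi B \<rho>" if "b \<in> B" "i < N" for b i
    unfolding m_def by (intro tr_Equi[OF rb] PolW_mult[OF rb] ac bW that)
  note n = hom_closed[OF m]
  define w where "w x = (\<Sum>b\<in>B. sW (coord B (F x) b) (\<Sum>i<N. sW (a i x) (\<phi> (m b i) x)))" for x
  let ?d = "\<lambda>x. sW (discr s x) (\<phi> F x)"
  have dW: "?d \<in> PolW B'" by (intro PolW_mult[OF rb'] discr_Pol Equi_PolW[OF hom_closed[OF F]])
  have FW: "F \<in> PolW B" using F by (rule Equi_PolW)
  have wW: "w \<in> PolW B'"
    unfolding w_def[abs_def]
    by (intro PolW_sum[OF rb'] PolW_mult[OF rb'] PolW_coord[OF FW] ac Equi_PolW[OF n]) auto
  have "tr \<rho>' (\<lambda>y. sW (q y) (w y - ?d y)) x = 0" if q: "q \<in> Pol" for q x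
  proof -
    let ?I = "B \<times> {..<N}"
    \<comment> \<open>The same coefficients h express \<open>q * discr s * F\<close> through the
      maps \<open>m b i\<close>, and \<open>q * w\<close> through their images under
      \<open>\<phi>\<close>. Under the trace they turn into the invariants \<open>tr0 (h p)\<close>,
      which \<open>\<phi>\<close> respects.\<close>
    define h where "h = (\<lambda>(b, i) y. q y * coord B (F y) b * a i y)"
    have h: "h p \<in> Pol" if "p \<in> ?I" for p
      using that unfolding h_def by (auto intro!: Pol_mult q PolW_coord[OF FW] ac)
    let ?m = "\<lambda>p. m (fst p) (snd p)"
    have mp: "?m p \<in> Equi B \<rho>" if "p \<in> ?I" for p using that m by auto
    have npW: "\<phi> (?m p) \<in> Equi B' \<rho>'" if "p \<in> ?I" for p using hom_closed[OF mp[OF that]] .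
    have 1: "sW (q y) (w y) = (\<Sum>p\<in>?I. sW (h p y) (\<phi> (?m p) y))" for y
      by (simp add: w_def h_def W.scale_sum_right sum.cartesian_product case_prod_beta mult.assoc)
    have 2: "(\<Sum>p\<in>?I. sW (h p y) (?m p y)) = sW (q y * discr s y) (F y)" for y
    proof -
      have "(\<Sum>p\<in>?I. sW (h p y) (?m p y))
          = (\<Sum>b\<in>B. sW (q y * coord B (F y) b) (\<Sum>i<N. sW (a i y) (m b i y)))"
        by (simp add: h_def W.scale_sum_right sum.cartesian_product case_prod_beta mult.assoc)
      also have "\<dots> = (\<Sum>b\<in>B. sW (q y * coord B (F y) b) (sW (discr s y) b))"
      proof (rule sum.cong[OF refl])
        fix b assume "b \<in> B"
        from tr_reproduce[OF rb sep disp bW[OF this]]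
        show "sW (q y * coord B (F y) b) (\<Sum>i<N. sW (a i y) (m b i y))
            = sW (q y * coord B (F y) b) (sW (discr s y) b)" by (simp add: m_def)
      qed
      also have "\<dots> = sW (q y * discr s y) (\<Sum>b\<in>B. sW (coord B (F y) b) b)"
        by (simp add: W.scale_sum_right mult.commute mult.left_commute)
      finally show ?thesis by (simp add: coord_expand[OF rb PolW_span[OF FW]])
    qed
    have "tr \<rho>' (\<lambda>y. sW (q y) (w y)) x = (\<Sum>p\<in>?I. tr \<rho>' (\<lambda>y. sW (h p y) (\<phi> (?m p) y)) x)"
      unfolding 1 by (intro tr_sum[OF rb'] PolW_mult[OF rb'] h Equi_PolW[OF npW])
    also have "\<dots> = (\<Sum>p\<in>?I. sW (tr0 (h p) x) (\<phi> (?m p) x))"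
      by (intro sum.cong refl tr_mult_Equi[OF rb'] npW)
    also have "\<dots> = \<phi> (\<lambda>y. \<Sum>p\<in>?I. sW (tr0 (h p) y) (?m p y)) x"
    proof -
      have "\<phi> (\<lambda>y. \<Sum>p\<in>?I. sW (tr0 (h p) y) (?m p y))
          = (\<lambda>y. \<Sum>p\<in>?I. \<phi> (\<lambda>y. sW (tr0 (h p) y) (?m p y)) y)"
        by (intro hom_sum Equi_mult[OF rb] tr0_Inv h mp)
      also have "\<dots> = (\<lambda>y. \<Sum>p\<in>?I. sW (tr0 (h p) y) (\<phi> (?m p) y))"
        by (intro ext sum.cong refl) (simp add: hom_mult[OF tr0_Inv[OF h] mp])
      finally show ?thesis by simp
    qed
    also have "(\<lambda>y. \<Sum>p\<in>?I. sW (tr0 (h p) y) (?m p y)) = (\<lambda>y. sW (tr0 (\<lambda>z. q z * discr s z) y) (F y))"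
    proof
      fix y
      have "(\<Sum>p\<in>?I. sW (tr0 (h p) y) (?m p y)) = (\<Sum>p\<in>?I. tr \<rho> (\<lambda>z. sW (h p z) (?m p z)) y)"
        by (intro sum.cong refl tr_mult_Equi[OF rb, symmetric] mp)
      also have "\<dots> = tr \<rho> (\<lambda>z. \<Sum>p\<in>?I. sW (h p z) (?m p z)) y"
        by (intro tr_sum[OF rb, symmetric] PolW_mult[OF rb] h Equi_PolW[OF mp])
      also have "\<dots> = sW (tr0 (\<lambda>z. q z * discr s z) y) (F y)"
        unfolding 2 by (rule tr_mult_Equi[OF rb F])
      finally show "(\<Sum>p\<in>?I. sW (tr0 (h p) y) (?m p y)) = sW (tr0 (\<lambda>z. q z * discr s z) y) (F y)" .
    qed
    also have "\<phi> \<dots> x = sW (tr0 (\<lambda>z. q z * discr s z) x) (\<phi> F x)"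
      using hom_mult[OF tr0_Inv[OF Pol_mult[OF q discr_Pol]] F] by simp
    also have "\<dots> = tr \<rho>' (\<lambda>y. sW (q y) (?d y)) x"
      using tr_mult_Equi[OF rb' hom_closed[OF F], of "\<lambda>z. q z * discr s z" x] by simp
    finally show ?thesis
      using tr_diff[OF rb' PolW_mult[OF rb' q wW] PolW_mult[OF rb' q dW], of x]
      by (simp add: W.scale_right_diff_distrib)
  qed
  then have "w x - ?d x = 0"
    using tr_faithful[OF rb' sep disp PolW_diff[OF rb' wW dW]] by blast
  then show ?thesis by (simp add: w_def m_def)
qed

text \<open>By \<open>discr_hom\<close> the matrix exists as a fraction in two ways, \<Phi> /
  \<open>discr s\<close> and \<Phi>' / \<open>discr s'\<close>. Since values of equivariant maps
  span generically, \<open>discr s' * \<Phi> = discr s * \<Phi>'\<close>; as the linear factors are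
  not proportional, \<open>discr s'\<close> divides \<Phi>', and the quotient is Q.\<close>

lemma hom_matrix_exists: "\<exists>Q. hom_matrix B \<rho> B' \<phi> Q"
proof -
  obtain s s' where disp:
    "\<And>g. g \<in> G - {id} \<Longrightarrow> s g - g (s g) \<noteq> 0"
    "\<And>g. g \<in> G - {id} \<Longrightarrow> s' g - g (s' g) \<noteq> 0"
    "\<And>g h a. g \<in> G - {id} \<Longrightarrow> h \<in> G - {id} \<Longrightarrow> s g - g (s g) \<noteq> sV a (s' h - h (s' h))"
    by (rule independent_displacements) blast
  obtain N a c where sep: "separating s N a c" using separating_family by blast
  obtain N' a' c' where sep': "separating s' N' a' c'" using separating_family by blast
  define \<Phi> where "\<Phi> b x = (\<Sum>i<N. sW (a i x) (\<phi> (tr \<rho> (\<lambda>y. sW (c i y) b)) x))" for b x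
  define \<Phi>' where "\<Phi>' b x = (\<Sum>i<N'. sW (a' i x) (\<phi> (tr \<rho> (\<lambda>y. sW (c' i y) b)) x))" for b x
  have bW: "(\<lambda>x. b) \<in> PolW B" if "b \<in> B" for b using that rb by (simp add: PolW_const W.span_base)
  have PW: "\<Phi> b \<in> PolW B'" "\<Phi>' b \<in> PolW B'" if "b \<in> B" for b
    unfolding \<Phi>_def[abs_def] \<Phi>'_def[abs_def] using sep sep' that
    by (auto simp: separating_def intro!: PolW_sum[OF rb'] PolW_mult[OF rb'] Equi_PolW[OF hom_closed]
        tr_Equi[OF rb] PolW_mult[OF rb] bW)
  have id: "(\<Sum>b\<in>B. coord B (F x) b * coord B' (\<Phi> b x) d) = discr s x * coord B' (\<phi> F x) d"
    "(\<Sum>b\<in>B. coord B (F x) b * coord B' (\<Phi>' b x) d) = discr s' x * coord B' (\<phi> F x) d"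
    if F: "F \<in> Equi B \<rho>" for F x d
  proof -
    have \<phi>s: "\<phi> F x \<in> W.span B'" using hom_closed[OF F] by (simp add: Equi_PolW PolW_span)
    have 1: "(\<Sum>b\<in>B. sW (coord B (F x) b) (\<Phi> b x)) = sW (discr s x) (\<phi> F x)"
      using discr_hom[OF sep disp(1) F] by (simp add: \<Phi>_def)
    have 2: "(\<Sum>b\<in>B. sW (coord B (F x) b) (\<Phi>' b x)) = sW (discr s' x) (\<phi> F x)"
      using discr_hom[OF sep' disp(2) F] by (simp add: \<Phi>'_def)
    have cs: "coord B' (\<Sum>b\<in>B. sW (k b) (P b x)) d = (\<Sum>b\<in>B. k b * coord B' (P b x) d)"
      if "\<And>b. b \<in> B \<Longrightarrow> P b \<in> PolW B'" for k P
      using that by (subst coord_sum[OF rb']) (auto simp: coord_scale[OF rb'] PolW_span W.span_scale)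
    show "(\<Sum>b\<in>B. coord B (F x) b * coord B' (\<Phi> b x) d) = discr s x * coord B' (\<phi> F x) d"
      using arg_cong[OF 1, of "\<lambda>u. coord B' u d"] by (simp add: cs PW coord_scale[OF rb' \<phi>s])
    show "(\<Sum>b\<in>B. coord B (F x) b * coord B' (\<Phi>' b x) d) = discr s' x * coord B' (\<phi> F x) d"
      using arg_cong[OF 2, of "\<lambda>u. coord B' u d"] by (simp add: cs PW coord_scale[OF rb' \<phi>s])
  qed
  have "\<exists>q\<in>Pol. \<forall>x. coord B' (\<Phi>' e x) d = discr s' x * q x" if e: "e \<in> B" and d: "d \<in> B'" for e d
  proof -
    let ?r = "\<lambda>e x. discr s' x * coord B' (\<Phi> e x) d - discr s x * coord B' (\<Phi>' e x) d"
    have "?r e x = 0" for x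
    proof (rule Equi_generic[OF rb _ _ e, of ?r])
      fix F x assume F: "F \<in> Equi B \<rho>"
      have "(\<Sum>e\<in>B. coord B (F x) e * ?r e x)
          = discr s' x * (\<Sum>e\<in>B. coord B (F x) e * coord B' (\<Phi> e x) d)
            - discr s x * (\<Sum>e\<in>B. coord B (F x) e * coord B' (\<Phi>' e x) d)"
        unfolding sum_distrib_left sum_subtractf[symmetric]
        by (rule sum.cong) (simp_all add: algebra_simps)
      then show "(\<Sum>e\<in>B. coord B (F x) e * ?r e x) = 0"
        unfolding id[OF F] by (simp add: algebra_simps)
    qed (intro Pol_diff Pol_mult discr_Pol PolW_coord[OF PW(1) d] PolW_coord[OF PW(2) d])
    then show ?thesis
      unfolding discr_def
      by (intro Pol_div_prod_linear[of "G - {id}" "G - {id}" "\<lambda>x. coord B' (\<Phi> e x) d" _ _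
            "\<lambda>g. s g - g (s g)"])
        (use finite_G PolW_coord[OF PW(1) d] PolW_coord[OF PW(2) d] e disp in auto)
  qed
  then obtain Q where Q: "\<And>e d. e \<in> B \<Longrightarrow> d \<in> B' \<Longrightarrow> Q e d \<in> Pol"
    "\<And>e d x. e \<in> B \<Longrightarrow> d \<in> B' \<Longrightarrow> coord B' (\<Phi>' e x) d = discr s' x * Q e d x"
    by metis
  obtain x0 where x0: "discr s' x0 \<noteq> 0" using discr_nonzero[of s'] disp(2) by blast
  have "coord B' (\<phi> F x) d = (\<Sum>e\<in>B. coord B (F x) e * Q e d x)"
    if F: "F \<in> Equi B \<rho>" and d: "d \<in> B'" for F x d
  proof (rule Pol_cancel[where f = "discr s'" and h = "\<lambda>x. coord B' (\<phi> F x) d"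
        and h' = "\<lambda>x. \<Sum>e\<in>B. coord B (F x) e * Q e d x", OF discr_Pol _ _ x0])
    show "(\<lambda>x. coord B' (\<phi> F x) d) \<in> Pol"
      using PolW_coord[OF Equi_PolW[OF hom_closed[OF F]] d] .
    show "(\<lambda>x. \<Sum>e\<in>B. coord B (F x) e * Q e d x) \<in> Pol"
      by (intro Pol_sum Pol_mult PolW_coord[OF Equi_PolW[OF F]] Q d)
    fix x
    show "discr s' x * coord B' (\<phi> F x) d = discr s' x * (\<Sum>e\<in>B. coord B (F x) e * Q e d x)"
      unfolding id(2)[OF F, symmetric] sum_distrib_left
      by (rule sum.cong) (simp_all add: Q(2) d algebra_simps)
  qed
  then show ?thesis unfolding hom_matrix_def using Q(1) by blast
qed

text \<open>With k the inverse of g, the value of \<open>\<phi> F\<close> at \<open>act y k\<close>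
  is computed from y through \<rho>' and again through \<rho>. Comparing coefficients generically
  relates Q at y to Q at \<open>act y k\<close>; both points are the origin when y is, so Q there
  commutes with G.\<close>

lemma hom_matrix_equivariant:
  assumes Q: "hom_matrix B \<rho> B' \<phi> Q" and g: "g \<in> G" and e: "e \<in> B" and c: "c \<in> B'"
  shows "(\<Sum>d\<in>B'. Q e d (\<lambda>v. 0) * coord B' (\<rho>' g d) c)
    = (\<Sum>d\<in>B. coord B (\<rho> g e) d * Q d c (\<lambda>v. 0))"
proof -
  obtain k where k: "k \<in> G" "g \<circ> k = id" "k \<circ> g = id" using G_inverse[OF g] .
  have QP: "Q e d \<in> Pol" if "e \<in> B" "d \<in> B'" for e d using Q that by (simp add: hom_matrix_def)
  let ?r = "\<lambda>e y. (\<Sum>d\<in>B'. Q e d y * coord B' (\<rho>' g d) c)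
    - (\<Sum>d\<in>B. coord B (\<rho> g e) d * Q d c (act y k))"
  have "?r e (\<lambda>v. 0) = 0"
  proof (rule Equi_generic[OF rb _ _ e, of ?r])
    show "?r e \<in> Pol" if "e \<in> B" for e
      by (intro Pol_diff Pol_sum Pol_mult Pol_const QP Pol_act[OF QP k(1)] that c)
    fix F y assume F: "F \<in> Equi B \<rho>"
    define x where "x = act y k"
    have xg: "act x g = pt y" unfolding x_def using act_act[OF k(1)] k(3) act_id by simp
    have F': "\<phi> F \<in> Equi B' \<rho>'" using hom_closed[OF F] .
    have Fs: "F y \<in> W.span B" "\<phi> F y \<in> W.span B'"
      using PolW_span[OF Equi_PolW[OF F]] PolW_span[OF Equi_PolW[OF F']] by auto
    have 1: "\<rho> g (F y) = F x" "\<rho>' g (\<phi> F y) = \<phi> F x"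
      using F F' g xg PolW_at_pt[OF rb Equi_PolW[OF F], of y] PolW_at_pt[OF rb' Equi_PolW[OF F'], of y]
      unfolding Equi_def by (smt (verit) mem_Collect_eq)+
    have "coord B' (\<phi> F x) c = (\<Sum>d\<in>B'. (\<Sum>e\<in>B. coord B (F y) e * Q e d y) * coord B' (\<rho>' g d) c)"
      unfolding 1[symmetric] coord_rho[OF rb' g Fs(2)]
      using Q F by (intro sum.cong) (auto simp: hom_matrix_def)
    also have "\<dots> = (\<Sum>e\<in>B. coord B (F y) e * (\<Sum>d\<in>B'. Q e d y * coord B' (\<rho>' g d) c))"
      unfolding sum_distrib_left sum_distrib_right by (subst sum.swap) (simp add: mult.assoc)
    finally have 2: "coord B' (\<phi> F x) c = \<dots>" .
    have "coord B' (\<phi> F x) c = (\<Sum>d\<in>B. coord B (F x) d * Q d c x)"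
      using Q F c by (simp add: hom_matrix_def)
    also have "\<dots> = (\<Sum>d\<in>B. (\<Sum>e\<in>B. coord B (F y) e * coord B (\<rho> g e) d) * Q d c x)"
      unfolding 1[symmetric] coord_rho[OF rb g Fs(1)] ..
    also have "\<dots> = (\<Sum>e\<in>B. coord B (F y) e * (\<Sum>d\<in>B. coord B (\<rho> g e) d * Q d c x))"
      unfolding sum_distrib_left sum_distrib_right by (subst sum.swap) (simp add: mult.assoc)
    finally show "(\<Sum>e\<in>B. coord B (F y) e * ?r e y) = 0"
      using 2 unfolding x_def by (simp add: right_diff_distrib sum_subtractf)
  qed
  then show ?thesis by simp
qed

end

end

section \<open>Schur's lemma and multiplicities\<close>

text \<open>The unit vectors indexed by I are independent, and M writes them as combinations of the
  at most |J| rows of N. A one-sided inverse suffices for this inequality.\<close>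

lemma card_le_of_matrix_inverse:
  fixes M :: "'i \<Rightarrow> 'j \<Rightarrow> 'k::field" and N :: "'j \<Rightarrow> 'i \<Rightarrow> 'k"
  assumes fin: "finite I" "finite J"
    and inv: "\<And>a b. a \<in> I \<Longrightarrow> b \<in> I \<Longrightarrow> (\<Sum>j\<in>J. M a j * N j b) = (if a = b then 1 else 0)"
  shows "card I \<le> card J"
proof -
  interpret F: vector_space "\<lambda>(k::'k) (f :: 'i \<Rightarrow> 'k) x. k * f x"
    by unfold_locales (auto simp: algebra_simps)
  define \<delta> where "\<delta> a = (\<lambda>b. if b = a then 1 else 0 :: 'k)" for a :: 'i
  \<comment> \<open>The rows of N, set to zero outside I because \<open>inv\<close> says nothing
    there.\<close>
  define R where "R j = (\<lambda>b. if b \<in> I then N j b else 0)" for j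
  have sum_app: "(\<Sum>v\<in>S. f v) b = (\<Sum>v\<in>S. f v b)" for S :: "'c set" and f :: "'c \<Rightarrow> 'i \<Rightarrow> 'k" and b
    by (induction S rule: infinite_finite_induct) auto
  have inj: "inj_on \<delta> I" by (auto simp: inj_on_def \<delta>_def fun_eq_iff)
  have "\<delta> a = (\<Sum>j\<in>J. (\<lambda>x. M a j * R j x))" if "a \<in> I" for a
  proof
    fix b
    show "\<delta> a b = (\<Sum>j\<in>J. (\<lambda>x. M a j * R j x)) b"
      using inv[OF that, of b] that by (cases "b \<in> I") (auto simp: sum_app \<delta>_def R_def)
  qed
  then have sub: "\<delta> ` I \<subseteq> F.span (R ` J)"
    by (auto intro!: F.span_sum F.span_scale[of "R _", simplified] intro: F.span_base)
  have "F.independent (\<delta> ` I)"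
    unfolding F.dependent_finite[OF finite_imageI[OF fin(1)]]
  proof
    assume "\<exists>u. (\<exists>v\<in>\<delta> ` I. u v \<noteq> 0) \<and> (\<Sum>v\<in>\<delta> ` I. (\<lambda>x. u v * v x)) = 0"
    then obtain u a where z: "(\<Sum>v\<in>\<delta> ` I. (\<lambda>x. u v * v x)) = 0"
      and a: "a \<in> I" "u (\<delta> a) \<noteq> 0" by blast
    have "0 = (\<Sum>v\<in>\<delta> ` I. (\<lambda>x. u v * v x)) a" using z by simp
    also have "\<dots> = (\<Sum>b\<in>I. u (\<delta> b) * \<delta> b a)"
      unfolding sum_app by (simp add: sum.reindex[OF inj])
    also have "\<dots> = (\<Sum>b\<in>I. if b = a then u (\<delta> a) else 0)"
      by (rule sum.cong) (auto simp: \<delta>_def)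
    also have "\<dots> = u (\<delta> a)" using a fin by simp
    finally show False using a(2) by simp
  qed
  then have "card (\<delta> ` I) \<le> card (R ` J)"
    using F.independent_span_bound[OF finite_imageI[OF fin(2)] _ sub] by blast
  also have "\<dots> \<le> card J" using fin(2) by (rule card_image_le)
  finally show ?thesis using card_image[OF inj] by simp
qed

section \<open>Idempotent matrices of polynomial functions\<close>

context dual_points
begin

lemma poly_eq_of_values: "(\<And>t. poly p t = poly q t) \<Longrightarrow> p = (q :: 'k poly)"
  using poly_roots_finite[of "p - q"] infinite_field by auto

text \<open>On a line through the origin all entries are divisible by \<open>t ^ m\<close>, hence by \<open>t ^ (2 * m)\<close>.\<close>

lemma idempotent_matrix_vanishing:
  assumes P: "\<And>e c. e \<in> B \<Longrightarrow> c \<in> B \<Longrightarrow> P e c \<in> Pol"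
    and idem: "\<And>e c x. e \<in> B \<Longrightarrow> c \<in> B \<Longrightarrow> (\<Sum>d\<in>B. P e d x * P d c x) = P e c x"
    and origin: "\<And>e c. e \<in> B \<Longrightarrow> c \<in> B \<Longrightarrow> P e c (\<lambda>v. 0) = 0"
    and ec: "e \<in> B" "c \<in> B"
  shows "P e c y = 0"
proof -
  have "\<exists>p. \<forall>t. P e c (\<lambda>v. t * y v) = poly p t" if "e \<in> B" "c \<in> B" for e c
    using Pol_line[OF P[OF that], of "\<lambda>v. 0" y] by simp
  then obtain p where p: "\<And>e c t. e \<in> B \<Longrightarrow> c \<in> B \<Longrightarrow> P e c (\<lambda>v. t * y v) = poly (p e c) t"
    by metis
  have pp: "p e c = (\<Sum>d\<in>B. p e d * p d c)" if "e \<in> B" "c \<in> B" for e c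
  proof (rule poly_eq_of_values)
    fix t
    show "poly (p e c) t = poly (\<Sum>d\<in>B. p e d * p d c) t"
      using that idem[OF that, of "\<lambda>v. t * y v"] by (simp add: poly_sum p)
  qed
  have dvd: "\<forall>e\<in>B. \<forall>c\<in>B. [:0, 1:] ^ Suc m dvd p e c" for m
  proof (induction m)
    case 0
    have "poly (p e c) 0 = 0" if "e \<in> B" "c \<in> B" for e c
      using p[OF that, of 0] origin[OF that] by simp
    then show ?case by (simp add: poly_eq_0_iff_dvd)
  next
    case (Suc m)
    have "[:0, 1:] ^ Suc (Suc m) dvd p e d * p d c" if "e \<in> B" "c \<in> B" "d \<in> B" for e c d
    proof -
      have "[:0, 1::'k:] ^ Suc (Suc m) dvd [:0, 1:] ^ (Suc m + Suc m)" by (rule le_imp_power_dvd) simp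
      also have "\<dots> dvd p e d * p d c"
        unfolding power_add using Suc that by (intro mult_dvd_mono) auto
      finally show ?thesis .
    qed
    then show ?case using pp by (metis (no_types, lifting) dvd_sum)
  qed
  have "p e c = 0"
  proof (rule ccontr)
    assume "p e c \<noteq> 0"
    then have "degree ([:0, 1::'k:] ^ Suc (degree (p e c))) \<le> degree (p e c)"
      using dvd ec by (intro dvd_imp_degree_le) auto
    moreover have "degree ([:0, 1::'k:] ^ Suc (degree (p e c))) = Suc (degree (p e c))"
      by (subst degree_power_eq) auto
    ultimately show False by simp
  qed
  then show ?thesis using p[OF ec, of 1] by simp
qed

end

section \<open>Irreducible representations and intertwiners at the origin\<close>

context group_covariants
begin

lemma irreducible_representationD:
  assumes "irreducible_representation G sW U \<rho>"
    and "W.subspace U'" "U' \<subseteq> U" "\<And>g. g \<in> G \<Longrightarrow> \<rho> g ` U' \<subseteq> U'"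
  shows "U' = {0} \<or> U' = U"
  using assms(1)[unfolded irreducible_representation_def, THEN conjunct2, THEN conjunct2,
      rule_format, of U'] assms(2-4) by blast

text \<open>The orbit of a nonzero vector is finite and spans a nonzero invariant subspace, which
  must be all of U. A basis is picked from the orbit.\<close>

lemma irreducible_rep_basis:
  assumes irr: "irreducible_representation G sW U \<rho>"
  obtains B where "rep_basis B \<rho>" "W.span B = U" "B \<noteq> {}"
proof -
  have rep: "representation_on G sW U \<rho>" and U0: "U \<noteq> {0}"
    using irr by (auto simp: irreducible_representation_def)
  have U: "W.subspace U" using rep by (simp add: representation_on_def)
  then obtain u where u: "u \<in> U" "u \<noteq> 0" using U0 W.subspace_0 by blast
  let ?O = "(\<lambda>g. \<rho> g u) ` G"
  have OU: "?O \<subseteq> U" using rep u by (auto simp: representation_on_def)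
  then have spU: "W.span ?O \<subseteq> U" using U W.span_minimal by blast
  have inv: "\<rho> h w \<in> W.span ?O" if h: "h \<in> G" and w: "w \<in> W.span ?O" for h w
  proof -
    let ?K = "{w \<in> U. \<rho> h w \<in> W.span ?O}"
    have h0: "\<rho> h 0 = 0"
      using rep h W.subspace_0[OF U] W.scale_zero_left unfolding representation_on_def by metis
    have "W.subspace ?K"
      using rep h U h0
      by (auto simp: representation_on_def W.subspace_def W.span_zero W.span_add W.span_scale)
    moreover have "?O \<subseteq> ?K"
    proof
      fix w assume "w \<in> ?O"
      then obtain g where g: "g \<in> G" "w = \<rho> g u" by blast
      then have "\<rho> h w = \<rho> (h \<circ> g) u" using rep h u by (auto simp: representation_on_def)
      then have "\<rho> h w \<in> ?O" using g h G_closed by auto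
      then show "w \<in> ?K" using OU g by (auto intro: W.span_base)
    qed
    ultimately show ?thesis using W.span_minimal w by blast
  qed
  have uO: "u \<in> W.span ?O"
  proof -
    have "u = \<rho> id u" using rep u by (simp add: representation_on_def)
    then have "u \<in> ?O" using G_closed(1) by (rule image_eqI)
    then show ?thesis by (rule W.span_base)
  qed
  have "W.span ?O = {0} \<or> W.span ?O = U"
    by (rule irreducible_representationD[OF irr W.subspace_span spU]) (rule image_subsetI, rule inv)
  then have "W.span ?O = U"
  proof
    assume "W.span ?O = {0}"
    then show ?thesis using uO u(2) by simp
  qed
  moreover obtain B where B: "B \<subseteq> ?O" "W.independent B" "?O \<subseteq> W.span B"
    by (rule W.basis_exists[of ?O])
  ultimately have "W.span B = U"
    using W.span_mono[OF B(1)] W.span_minimal[OF B(3) W.subspace_span] by simp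
  moreover have "finite B" using B(1) finite_G finite_subset by blast
  ultimately have "rep_basis B \<rho>" using B(2) rep by (simp add: rep_basis_def)
  moreover have "B \<noteq> {}" using \<open>W.span B = U\<close> U0 by auto
  ultimately show ?thesis using that \<open>W.span B = U\<close> by blast
qed

lemma schur:
  assumes irr: "irreducible_representation G sW U \<rho>" "irreducible_representation G sW U' \<rho>'"
    and T: "\<And>u. u \<in> U \<Longrightarrow> T u \<in> U'"
      "\<And>u v. u \<in> U \<Longrightarrow> v \<in> U \<Longrightarrow> T (u + v) = T u + T v"
      "\<And>a u. u \<in> U \<Longrightarrow> T (sW a u) = sW a (T u)"
      "\<And>g u. g \<in> G \<Longrightarrow> u \<in> U \<Longrightarrow> T (\<rho> g u) = \<rho>' g (T u)"
    and nz: "w \<in> U" "T w \<noteq> 0"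
  shows "bij_betw T U U'"
proof -
  have rep: "representation_on G sW U \<rho>" "representation_on G sW U' \<rho>'"
    using irr by (auto simp: irreducible_representation_def)
  have sub: "W.subspace U" "W.subspace U'" using rep by (auto simp: representation_on_def)
  have inv: "\<rho> g u \<in> U" if "g \<in> G" "u \<in> U" for g u using rep that by (auto simp: representation_on_def)
  have T0: "T 0 = 0" using T(3)[OF nz(1), of 0] by simp
  let ?K = "{u \<in> U. T u = 0}"
  have \<rho>'0: "\<rho>' g 0 = 0" if "g \<in> G" for g
    using rep(2) sub(2) that W.subspace_0 unfolding representation_on_def by (metis W.scale_zero_left)
  have "W.subspace ?K" using sub(1) by (auto simp: W.subspace_def T T0)
  moreover have "\<rho> g ` ?K \<subseteq> ?K" if "g \<in> G" for g using that inv T(4) \<rho>'0 by auto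
  ultimately have "?K = {0} \<or> ?K = U"
    by (intro irreducible_representationD[OF irr(1)]) auto
  then have K: "?K = {0}" using nz by blast
  have "inj_on T U"
  proof (rule inj_onI)
    fix u v assume uv: "u \<in> U" "v \<in> U" "T u = T v"
    have v: "sW (-1) v \<in> U" using sub(1) uv(2) by (rule W.subspace_scale)
    have "T (u + sW (-1) v) = T u + sW (-1) (T v)"
      unfolding T(2)[OF uv(1) v] T(3)[OF uv(2)] ..
    also have "\<dots> = 0" using uv(3) by simp
    finally have "u + sW (-1) v = 0" using K W.subspace_add[OF sub(1) uv(1) v] by blast
    then show "u = v" by simp
  qed
  moreover have "T ` U = U'"
  proof -
    have "W.subspace (T ` U)"
      unfolding W.subspace_def
    proof (intro conjI ballI allI)
      show "0 \<in> T ` U" using imageI[OF W.subspace_0[OF sub(1)], of T] T0 by simp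
      show "x + y \<in> T ` U" if xy: "x \<in> T ` U" "y \<in> T ` U" for x y
      proof -
        obtain u v where uv: "u \<in> U" "v \<in> U" "x = T u" "y = T v" using xy by blast
        then have "x + y = T (u + v)" using T(2) by simp
        then show ?thesis using W.subspace_add[OF sub(1) uv(1,2)] by blast
      qed
      show "sW c x \<in> T ` U" if x: "x \<in> T ` U" for c x
      proof -
        obtain u where u: "u \<in> U" "x = T u" using x by blast
        then have "sW c x = T (sW c u)" using T(3) by simp
        then show ?thesis using W.subspace_scale[OF sub(1) u(1)] by blast
      qed
    qed
    moreover have "T ` U \<subseteq> U'" using T(1) by blast
    moreover have "\<rho>' g ` (T ` U) \<subseteq> T ` U" if g: "g \<in> G" for g
    proof
      fix y assume "y \<in> \<rho>' g ` (T ` U)"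
      then obtain u where "u \<in> U" "y = \<rho>' g (T u)" by blast
      then have "y = T (\<rho> g u)" "\<rho> g u \<in> U" using T(4) g inv by auto
      then show "y \<in> T ` U" by blast
    qed
    ultimately have "T ` U = {0} \<or> T ` U = U'" by (rule irreducible_representationD[OF irr(2)])
    then show ?thesis using nz by blast
  qed
  ultimately show ?thesis by (simp add: bij_betw_def)
qed

text \<open>The linear map between the spans whose matrix is Q at the origin.\<close>

definition lin_of where
  "lin_of B B' Q u = (\<Sum>c\<in>B'. sW (\<Sum>e\<in>B. coord B u e * Q e c (\<lambda>v. 0)) c)"

context
  fixes B \<rho> B' \<rho>' \<phi> Q
  assumes rb: "rep_basis B \<rho>" and rb': "rep_basis B' \<rho>'"
    and hom: "equi_hom B \<rho> B' \<rho>' \<phi>" and Q: "hom_matrix B \<rho> B' \<phi> Q"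
begin

lemma lin_of_span: "lin_of B B' Q u \<in> W.span B'"
  unfolding lin_of_def by (intro W.span_sum W.span_scale W.span_base)

lemma coord_lin_of:
  assumes "c \<in> B'" shows "coord B' (lin_of B B' Q u) c = (\<Sum>e\<in>B. coord B u e * Q e c (\<lambda>v. 0))"
proof -
  have "coord B' (lin_of B B' Q u) c
      = (\<Sum>d\<in>B'. (\<Sum>e\<in>B. coord B u e * Q e d (\<lambda>v. 0)) * coord B' d c)"
    unfolding lin_of_def
    by (subst coord_sum[OF rb']) (auto simp: coord_scale[OF rb'] W.span_base W.span_scale)
  also have "\<dots> = (\<Sum>d\<in>B'. if d = c then \<Sum>e\<in>B. coord B u e * Q e c (\<lambda>v. 0) else 0)"
    by (rule sum.cong) (auto simp: coord_basis[OF rb'])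
  finally show ?thesis using assms finite_B[OF rb'] by simp
qed

lemma coord_lin_of_basis:
  assumes "e \<in> B" "c \<in> B'" shows "coord B' (lin_of B B' Q e) c = Q e c (\<lambda>v. 0)"
proof -
  have "coord B' (lin_of B B' Q e) c = (\<Sum>b\<in>B. if b = e then Q e c (\<lambda>v. 0) else 0)"
    unfolding coord_lin_of[OF assms(2)]
    by (rule sum.cong) (auto simp: coord_basis[OF rb assms(1)])
  then show ?thesis using assms finite_B[OF rb] by simp
qed

lemma lin_of_add:
  "u \<in> W.span B \<Longrightarrow> v \<in> W.span B \<Longrightarrow> lin_of B B' Q (u + v) = lin_of B B' Q u + lin_of B B' Q v"
  by (simp add: lin_of_def coord_add[OF rb] distrib_right sum.distrib W.scale_left_distrib)

lemma lin_of_scale: "u \<in> W.span B \<Longrightarrow> lin_of B B' Q (sW a u) = sW a (lin_of B B' Q u)"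
  by (simp add: lin_of_def coord_scale[OF rb] W.scale_sum_right sum_distrib_left mult.assoc)

lemma lin_of_equivariant:
  assumes g: "g \<in> G" and u: "u \<in> W.span B"
  shows "lin_of B B' Q (\<rho> g u) = \<rho>' g (lin_of B B' Q u)"
proof (rule coord_eqI[OF rb'])
  show "lin_of B B' Q (\<rho> g u) \<in> W.span B'" by (rule lin_of_span)
  show "\<rho>' g (lin_of B B' Q u) \<in> W.span B'" by (rule rho_span[OF rb' g lin_of_span])
  fix c assume c: "c \<in> B'"
  have "coord B' (\<rho>' g (lin_of B B' Q u)) c
      = (\<Sum>d\<in>B'. (\<Sum>e\<in>B. coord B u e * Q e d (\<lambda>v. 0)) * coord B' (\<rho>' g d) c)"
    by (simp add: coord_rho[OF rb' g lin_of_span] coord_lin_of)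
  also have "\<dots> = (\<Sum>e\<in>B. coord B u e * (\<Sum>d\<in>B'. Q e d (\<lambda>v. 0) * coord B' (\<rho>' g d) c))"
    unfolding sum_distrib_left sum_distrib_right by (subst sum.swap) (simp add: mult.assoc)
  also have "\<dots> = (\<Sum>e\<in>B. coord B u e * (\<Sum>d\<in>B. coord B (\<rho> g e) d * Q d c (\<lambda>v. 0)))"
    using hom_matrix_equivariant[OF rb rb' hom Q g _ c] by simp
  also have "\<dots> = (\<Sum>d\<in>B. (\<Sum>e\<in>B. coord B u e * coord B (\<rho> g e) d) * Q d c (\<lambda>v. 0))"
    unfolding sum_distrib_left sum_distrib_right by (subst sum.swap) (simp add: mult.assoc)
  also have "\<dots> = coord B' (lin_of B B' Q (\<rho> g u)) c"
    unfolding coord_lin_of[OF c] coord_rho[OF rb g u] ..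
  finally show "coord B' (lin_of B B' Q (\<rho> g u)) c = coord B' (\<rho>' g (lin_of B B' Q u)) c" ..
qed

lemma lin_of_bij_betw:
  assumes "irreducible_representation G sW (W.span B) \<rho>"
    and "irreducible_representation G sW (W.span B') \<rho>'"
    and "e \<in> B" "c \<in> B'" "Q e c (\<lambda>v. 0) \<noteq> 0"
  shows "bij_betw (lin_of B B' Q) (W.span B) (W.span B')"
proof (rule schur[where T = "lin_of B B' Q" and w = e, OF assms(1,2)])
  show "e \<in> W.span B" using assms(3) by (rule W.span_base)
  show "lin_of B B' Q e \<noteq> 0"
    using coord_lin_of_basis[OF assms(3,4)] assms(5) coord_zero[OF rb'] by force
qed (simp_all add: lin_of_span lin_of_add lin_of_scale lin_of_equivariant)

lemma hom_matrix_origin_zero: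
  assumes "irreducible_representation G sW (W.span B) \<rho>"
    and "irreducible_representation G sW (W.span B') \<rho>'"
    and "\<not> representation_iso G sW (W.span B) \<rho> sW (W.span B') \<rho>'"
    and "e \<in> B" "c \<in> B'"
  shows "Q e c (\<lambda>v. 0) = 0"
proof (rule ccontr)
  assume "Q e c (\<lambda>v. 0) \<noteq> 0"
  then have "bij_betw (lin_of B B' Q) (W.span B) (W.span B')"
    by (rule lin_of_bij_betw[OF assms(1,2,4,5)])
  then have "representation_iso G sW (W.span B) \<rho> sW (W.span B') \<rho>'"
    unfolding representation_iso_def
    by (intro exI[of _ "lin_of B B' Q"]) (simp add: lin_of_add lin_of_scale lin_of_equivariant)
  then show False using assms(3) by blast
qed

end

text \<open>The matrix Q is idempotent because \<open>\<phi>\<close> is. At the origin it is an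
  idempotent intertwiner, by Schur zero or bijective, and a bijective idempotent is the identity. So
  either Q or the complementary idempotent 1 - Q vanishes at the origin, hence everywhere.\<close>

lemma idempotent_equi_hom:
  assumes rb: "rep_basis B \<rho>" and irr: "irreducible_representation G sW (W.span B) \<rho>"
    and hom: "equi_hom B \<rho> B \<rho> \<phi>" and idem: "\<And>F. F \<in> Equi B \<rho> \<Longrightarrow> \<phi> (\<phi> F) = \<phi> F"
  shows "(\<forall>F\<in>Equi B \<rho>. \<phi> F = (\<lambda>x. 0)) \<or> (\<forall>F\<in>Equi B \<rho>. \<phi> F = F)"
proof -
  obtain Q where Q: "hom_matrix B \<rho> B \<phi> Q" using hom_matrix_exists[OF rb rb hom] by blast
  have QP: "Q e c \<in> Pol" if "e \<in> B" "c \<in> B" for e c using Q that by (simp add: hom_matrix_def)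
  have Qc: "coord B (\<phi> F x) c = (\<Sum>e\<in>B. coord B (F x) e * Q e c x)" if "F \<in> Equi B \<rho>" "c \<in> B" for F x c
    using Q that by (simp add: hom_matrix_def)
  note fin = finite_B[OF rb]
  have QQ: "(\<Sum>d\<in>B. Q e d x * Q d c x) = Q e c x" if e: "e \<in> B" and c: "c \<in> B" for e c x
  proof -
    let ?r = "\<lambda>e x. (\<Sum>d\<in>B. Q e d x * Q d c x) - Q e c x"
    have "?r e x = 0"
    proof (rule Equi_generic[OF rb _ _ e, of ?r])
      fix F x assume F: "F \<in> Equi B \<rho>"
      have "(\<Sum>e\<in>B. coord B (F x) e * Q e c x) = coord B (\<phi> (\<phi> F) x) c"
        using Qc[OF F c] idem[OF F] by simp
      also have "\<dots> = (\<Sum>d\<in>B. (\<Sum>e\<in>B. coord B (F x) e * Q e d x) * Q d c x)"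
        using Qc[OF hom_closed[OF rb rb hom F] c] Qc[OF F] by simp
      also have "\<dots> = (\<Sum>e\<in>B. coord B (F x) e * (\<Sum>d\<in>B. Q e d x * Q d c x))"
        unfolding sum_distrib_left sum_distrib_right by (subst sum.swap) (simp add: mult.assoc)
      finally show "(\<Sum>e\<in>B. coord B (F x) e * ?r e x) = 0"
        by (simp add: right_diff_distrib sum_subtractf)
    qed (intro Pol_diff Pol_sum Pol_mult QP c)
    then show ?thesis by simp
  qed
  show ?thesis
  proof (cases "\<forall>e\<in>B. \<forall>c\<in>B. Q e c (\<lambda>v. 0) = 0")
    case True
    have Q0: "Q e c x = 0" if "e \<in> B" "c \<in> B" for e c x
      by (rule idempotent_matrix_vanishing[of B Q, OF QP QQ _ that]) (use True in auto)
    have "\<phi> F x = 0" if F: "F \<in> Equi B \<rho>" for F x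
      by (rule coord_eqI[OF rb])
        (auto simp: Qc[OF F] Q0 coord_zero[OF rb] W.span_zero PolW_span[OF Equi_PolW[OF hom_closed[OF rb rb hom F]]])
    then show ?thesis by auto
  next
    case False
    then have bij: "bij_betw (lin_of B B Q) (W.span B) (W.span B)"
      using lin_of_bij_betw[OF rb rb hom Q irr irr] by blast
    let ?T = "lin_of B B Q"
    have "?T (?T u) = ?T u" for u
    proof (rule coord_eqI[OF rb])
      fix c assume c: "c \<in> B"
      have "coord B (?T (?T u)) c
          = (\<Sum>d\<in>B. (\<Sum>e\<in>B. coord B u e * Q e d (\<lambda>v. 0)) * Q d c (\<lambda>v. 0))"
        by (simp add: coord_lin_of[OF rb rb hom Q] c)
      also have "\<dots> = (\<Sum>e\<in>B. coord B u e * (\<Sum>d\<in>B. Q e d (\<lambda>v. 0) * Q d c (\<lambda>v. 0)))"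
        unfolding sum_distrib_left sum_distrib_right by (subst sum.swap) (simp add: mult.assoc)
      also have "\<dots> = coord B (?T u) c" by (simp add: coord_lin_of[OF rb rb hom Q] c QQ)
      finally show "coord B (?T (?T u)) c = coord B (?T u) c" .
    qed (rule lin_of_span[OF rb rb hom Q])+
    \<comment> \<open>Injectivity cancels one application of the idempotent.\<close>
    then have Tid: "?T u = u" if "u \<in> W.span B" for u
      using bij that lin_of_span[OF rb rb hom Q] unfolding bij_betw_def inj_on_def by blast
    define P where "P e c x = (if e = c then 1 else 0) - Q e c x" for e c x
    have PP: "(\<Sum>d\<in>B. P e d x * P d c x) = P e c x" if ec: "e \<in> B" "c \<in> B" for e c x
    proof -
      have "P e d x * P d c x = (if d = e then P e c x else 0) - (if d = c then Q e c x else 0)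
          + Q e d x * Q d c x" for d
        unfolding P_def by (auto simp: algebra_simps)
      then show ?thesis using ec fin QQ[OF ec] by (simp add: sum.distrib sum_subtractf)
    qed
    have P0: "P e c x = 0" if ec: "e \<in> B" "c \<in> B" for e c x
    proof (rule idempotent_matrix_vanishing[of B P, OF _ PP _ ec])
      show "P e c \<in> Pol" if "e \<in> B" "c \<in> B" for e c
        unfolding P_def[abs_def] by (intro Pol_diff Pol_const QP that)
      show "P e c (\<lambda>v. 0) = 0" if "e \<in> B" "c \<in> B" for e c
        using coord_lin_of_basis[OF rb rb hom Q that] Tid[OF W.span_base[OF that(1)]]
          coord_basis[OF rb that(1)] by (auto simp: P_def)
    qed
    have "\<phi> F x = F x" if F: "F \<in> Equi B \<rho>" for F x
    proof (rule coord_eqI[OF rb])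
      fix c assume c: "c \<in> B"
      have "coord B (F x) e * Q e c x = (if e = c then coord B (F x) c else 0)" if "e \<in> B" for e
        using P0[OF that c, of x] by (auto simp: P_def split: if_splits)
      then show "coord B (\<phi> F x) c = coord B (F x) c"
        using Qc[OF F c] c fin by simp
    qed (use PolW_span[OF Equi_PolW] F hom_closed[OF rb rb hom F] in auto)
    then show ?thesis by auto
  qed
qed

text \<open>The matrices of \<psi> and \<psi>' have product 1, in particular at the origin. There
  the blocks between non-isomorphic representations vanish, so the block of V_i alone has a
  one-sided inverse; comparing its sizes gives
  \<open>m i * card (B i) \<le> m' i * card (B i)\<close>.\<close>

lemma multiplicity_le:
  fixes n :: nat and m m' :: "nat \<Rightarrow> nat"
  defines "I \<equiv> SIGMA i:{..n}. {..<m i}" and "J \<equiv> SIGMA i:{..n}. {..<m' i}"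
  assumes rb: "\<And>i. i \<le> n \<Longrightarrow> rep_basis (B i) (\<rho> i)"
    and irr: "\<And>i. i \<le> n \<Longrightarrow> irreducible_representation G sW (W.span (B i)) (\<rho> i)"
    and noniso: "\<And>i j. i \<le> n \<Longrightarrow> j \<le> n \<Longrightarrow> i \<noteq> j \<Longrightarrow>
      \<not> representation_iso G sW (W.span (B i)) (\<rho> i) sW (W.span (B j)) (\<rho> j)"
    and hom: "\<And>q p. q \<in> I \<Longrightarrow> p \<in> J \<Longrightarrow>
      equi_hom (B (fst q)) (\<rho> (fst q)) (B (fst p)) (\<rho> (fst p)) (\<psi> q p)"
    and hom': "\<And>q p. q \<in> I \<Longrightarrow> p \<in> J \<Longrightarrow>
      equi_hom (B (fst p)) (\<rho> (fst p)) (B (fst q)) (\<rho> (fst q)) (\<psi>' p q)"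
    and inverse: "\<And>q r F x. q \<in> I \<Longrightarrow> r \<in> I \<Longrightarrow> F \<in> Equi (B (fst q)) (\<rho> (fst q)) \<Longrightarrow>
      (\<Sum>p\<in>J. \<psi>' p r (\<psi> q p F) x) = (if r = q then F x else 0)"
    and i: "i \<le> n" and ne: "B i \<noteq> {}"
  shows "m i \<le> m' i"
proof -
  define Q where "Q q p = (SOME Q. hom_matrix (B (fst q)) (\<rho> (fst q)) (B (fst p)) (\<psi> q p) Q)" for q p
  have Q: "hom_matrix (B (fst q)) (\<rho> (fst q)) (B (fst p)) (\<psi> q p) (Q q p)" if "q \<in> I" "p \<in> J" for q p
    unfolding Q_def
    using someI_ex[OF hom_matrix_exists[OF rb rb hom[OF that]]] that by (auto simp: I_def J_def)
  define Q' where "Q' p q = (SOME Q. hom_matrix (B (fst p)) (\<rho> (fst p)) (B (fst q)) (\<psi>' p q) Q)" for p q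
  have Q': "hom_matrix (B (fst p)) (\<rho> (fst p)) (B (fst q)) (\<psi>' p q) (Q' p q)" if "q \<in> I" "p \<in> J" for q p
    unfolding Q'_def
    using someI_ex[OF hom_matrix_exists[OF rb rb hom'[OF that]]] that by (auto simp: I_def J_def)
  have le: "fst p \<le> n" if "p \<in> I \<or> p \<in> J" for p using that by (auto simp: I_def J_def)
  have finJ: "finite J" unfolding J_def by (intro finite_SigmaI) auto
  \<comment> \<open>\<open>Equi_generic\<close> turns the identity of maps \<open>inverse\<close>
    into an identity of matrices, valid at every point x.\<close>
  have prod: "(\<Sum>p\<in>J. \<Sum>d\<in>B (fst p). Q q p e d x * Q' p r d c x) = (if r = q \<and> e = c then 1 else 0)"
    if q: "q \<in> I" and r: "r \<in> I" and e: "e \<in> B (fst q)" and c: "c \<in> B (fst r)" for q r e c x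
  proof -
    let ?B = "B (fst q)"
    note rbq = rb[OF le[OF disjI1[OF q]]] and rbr = rb[OF le[OF disjI1[OF r]]]
    let ?r = "\<lambda>e x. (\<Sum>p\<in>J. \<Sum>d\<in>B (fst p). Q q p e d x * Q' p r d c x) - (if r = q \<and> e = c then 1 else 0)"
    have "?r e x = 0"
    proof (rule Equi_generic[OF rbq _ _ e, of ?r])
      show "?r e \<in> Pol" if "e \<in> ?B" for e
        using Q[OF q] Q'[OF r] that c
        by (intro Pol_diff Pol_sum Pol_mult Pol_const) (auto simp: hom_matrix_def)
      fix F x assume F: "F \<in> Equi ?B (\<rho> (fst q))"
      have cl: "\<psi> q p F \<in> Equi (B (fst p)) (\<rho> (fst p))" if "p \<in> J" for p
        using hom_closed[OF rbq rb hom[OF q that] F] le that by blast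
      have cl': "\<psi>' p r (\<psi> q p F) x \<in> W.span (B (fst r))" if "p \<in> J" for p
        using hom_closed[OF rb rbr hom'[OF r that] cl[OF that]] le that
        by (blast intro: PolW_span[OF Equi_PolW])
      have "coord (B (fst r)) (if r = q then F x else 0) c
          = (\<Sum>p\<in>J. coord (B (fst r)) (\<psi>' p r (\<psi> q p F) x) c)"
        unfolding inverse[OF q r F, symmetric] by (rule coord_sum[OF rbr cl'])
      also have "\<dots> = (\<Sum>p\<in>J. \<Sum>d\<in>B (fst p). (\<Sum>e\<in>?B. coord ?B (F x) e * Q q p e d x) * Q' p r d c x)"
        using Q[OF q] Q'[OF r] F cl c by (intro sum.cong) (auto simp: hom_matrix_def)
      also have "\<dots> = (\<Sum>p\<in>J. \<Sum>e\<in>?B. \<Sum>d\<in>B (fst p). coord ?B (F x) e * (Q q p e d x * Q' p r d c x))"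
        unfolding sum_distrib_right by (rule sum.cong[OF refl], subst sum.swap) (simp add: mult.assoc)
      also have "\<dots> = (\<Sum>e\<in>?B. coord ?B (F x) e * (\<Sum>p\<in>J. \<Sum>d\<in>B (fst p). Q q p e d x * Q' p r d c x))"
        unfolding sum_distrib_left by (rule sum.swap)
      finally have 1: "\<dots> = coord (B (fst r)) (if r = q then F x else 0) c" ..
      have 2: "(\<Sum>e\<in>?B. coord ?B (F x) e * (if r = q \<and> e = c then 1 else 0))
          = coord (B (fst r)) (if r = q then F x else 0) c"
        using c finite_B[OF rbq]
        by (cases "r = q") (auto simp: coord_zero[OF rbr] if_distrib cong: if_cong)
      show "(\<Sum>e\<in>?B. coord ?B (F x) e * ?r e x) = 0"
        unfolding right_diff_distrib sum_subtractf 1 2 by simp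
    qed
    then show ?thesis by simp
  qed
  let ?o = "\<lambda>v. 0"
  \<comment> \<open>The block of V_i: an index is a copy of V_i together with a basis
    vector.\<close>
  have "card ({..<m i} \<times> B i) \<le> card ({..<m' i} \<times> B i)"
  proof (rule card_le_of_matrix_inverse[where
        M = "\<lambda>a j. Q (i, fst a) (i, fst j) (snd a) (snd j) ?o" and
        N = "\<lambda>j b. Q' (i, fst j) (i, fst b) (snd j) (snd b) ?o"])
    fix a b assume a: "a \<in> {..<m i} \<times> B i" and b: "b \<in> {..<m i} \<times> B i"
    let ?q = "(i, fst a)" and ?r = "(i, fst b)"
    have qr: "?q \<in> I" "?r \<in> I" using a b i by (auto simp: I_def)
    have eb: "snd a \<in> B i" "snd b \<in> B i" using a b by auto
    let ?s = "\<lambda>p. \<Sum>d\<in>B (fst p). Q ?q p (snd a) d ?o * Q' p ?r d (snd b) ?o"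
    have off: "?s p = 0" if p: "p \<in> J" "fst p \<noteq> i" for p
    proof -
      have pn: "fst p \<le> n" using p le by blast
      have "Q ?q p (snd a) d ?o = 0" if d: "d \<in> B (fst p)" for d
        using hom_matrix_origin_zero[OF rb[OF i] rb[OF pn] _ _ irr[OF i] irr[OF pn]
            noniso[OF i pn p(2)[symmetric]] eb(1) d] hom[OF qr(1) p(1)] Q[OF qr(1) p(1)] by simp
      then show ?thesis by simp
    qed
    have "(\<Sum>j\<in>{..<m' i} \<times> B i. Q ?q (i, fst j) (snd a) (snd j) ?o * Q' (i, fst j) ?r (snd j) (snd b) ?o)
        = (\<Sum>l<m' i. ?s (i, l))"
      by (simp add: sum.cartesian_product case_prod_beta)
    also have "\<dots> = (\<Sum>p\<in>Pair i ` {..<m' i}. ?s p)"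
      by (subst sum.reindex) (auto simp: inj_on_def)
    \<comment> \<open>The summands at other representations are zero by \<open>off\<close>, so the
      sum over one block is the full matrix product, which \<open>prod\<close> evaluates.\<close>
    also have "\<dots> = (\<Sum>p\<in>J. ?s p)"
    proof (rule sum.mono_neutral_left[OF finJ])
      show "Pair i ` {..<m' i} \<subseteq> J" using i by (auto simp: J_def)
      show "\<forall>p\<in>J - Pair i ` {..<m' i}. ?s p = 0"
      proof
        fix p assume p: "p \<in> J - Pair i ` {..<m' i}"
        then have "fst p \<noteq> i" by (cases p) (auto simp: J_def)
        then show "?s p = 0" using off p by blast
      qed
    qed
    also have "\<dots> = (if a = b then 1 else 0)"
      using prod[OF qr, of "snd a" "snd b" ?o] eb by (auto simp: prod_eq_iff)
    finally show "(\<Sum>j\<in>{..<m' i} \<times> B i. Q ?q (i, fst j) (snd a) (snd j) ?o * Q' (i, fst j) ?r (snd j) (snd b) ?o)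
        = (if a = b then 1 else 0)" .
  qed (use finite_B[OF rb[OF i]] in auto)
  then have "m i * card (B i) \<le> m' i * card (B i)" by (simp add: card_cartesian_product)
  moreover have "card (B i) > 0" using ne finite_B[OF rb[OF i]] by (simp add: card_gt_0_iff)
  ultimately show ?thesis by simp
qed

end

section \<open>The symmetric algebra as a ring of polynomial functions\<close>

definition mon :: "('v \<Rightarrow> 'k::comm_ring_1) \<Rightarrow> ('v \<Rightarrow>\<^sub>0 nat) \<Rightarrow> 'k" where
  "mon z m = (\<Prod>v\<in>Poly_Mapping.keys m. z v ^ Poly_Mapping.lookup m v)"

definition ev :: "('v \<Rightarrow> 'k::comm_ring_1) \<Rightarrow> ('v, 'k) free_alg \<Rightarrow> 'k" where
  "ev z q = (\<Sum>m\<in>Poly_Mapping.keys q. Poly_Mapping.lookup q m * mon z m)"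

lemma mon_superset:
  assumes "finite S" "Poly_Mapping.keys m \<subseteq> S"
  shows "mon z m = (\<Prod>v\<in>S. z v ^ Poly_Mapping.lookup m v)"
  unfolding mon_def using assms
  by (intro prod.mono_neutral_left) (auto simp: in_keys_iff)

lemma mon_add: "mon z (m + m') = mon z m * mon z m'"
proof -
  let ?S = "Poly_Mapping.keys m \<union> Poly_Mapping.keys m'"
  have "Poly_Mapping.keys (m + m') \<subseteq> ?S" by (rule Poly_Mapping.keys_add)
  then show ?thesis
    by (simp add: mon_superset[of ?S] lookup_add power_add prod.distrib)
qed

lemma ev_superset:
  assumes "finite S" "Poly_Mapping.keys q \<subseteq> S"
  shows "ev z q = (\<Sum>m\<in>S. Poly_Mapping.lookup q m * mon z m)"
  unfolding ev_def using assms
  by (intro sum.mono_neutral_left) (auto simp: in_keys_iff)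

lemma ev_add: "ev z (p + q) = ev z p + ev z q"
proof -
  let ?S = "Poly_Mapping.keys p \<union> Poly_Mapping.keys q"
  have "Poly_Mapping.keys (p + q) \<subseteq> ?S" by (rule Poly_Mapping.keys_add)
  then show ?thesis
    by (simp add: ev_superset[of ?S] lookup_add distrib_right sum.distrib)
qed

lemma ev_zero: "ev z 0 = 0"
  by (simp add: ev_def)

lemma ev_sum: "ev z (\<Sum>i\<in>I. q i) = (\<Sum>i\<in>I. ev z (q i))"
  by (induction I rule: infinite_finite_induct) (auto simp: ev_add ev_zero)

lemma ev_single: "ev z (Poly_Mapping.single m a) = a * mon z m"
  by (simp add: ev_def)

lemma sum_singles: "(\<Sum>m\<in>Poly_Mapping.keys q. Poly_Mapping.single m (Poly_Mapping.lookup q m)) = q"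
  by (rule poly_mapping_eqI)
    (auto simp: lookup_sum lookup_single when_def in_keys_iff)

lemma ev_mult: "ev z (p * q) = ev z p * ev z q"
proof -
  have "p * q = (\<Sum>m\<in>Poly_Mapping.keys p. \<Sum>m'\<in>Poly_Mapping.keys q.
      Poly_Mapping.single (m + m') (Poly_Mapping.lookup p m * Poly_Mapping.lookup q m'))"
    by (subst sum_singles[of p, symmetric], subst sum_singles[of q, symmetric])
      (simp add: sum_product mult_single)
  then have "ev z (p * q) = (\<Sum>m\<in>Poly_Mapping.keys p. \<Sum>m'\<in>Poly_Mapping.keys q.
      Poly_Mapping.lookup p m * Poly_Mapping.lookup q m' * mon z (m + m'))"
    by (simp only: ev_sum ev_single)
  then show ?thesis
    by (simp add: mon_add ev_def sum_product algebra_simps)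
qed

lemma ev_Const: "ev z (Const a) = a"
  by (simp add: Const_def ev_single mon_def)

lemma ev_Var: "ev z (Var v) = z v"
  by (simp add: Var_def ev_single mon_def)

lemma ev_one: "ev z 1 = 1"
  using ev_Const[of z 1] by (simp add: Const_def)

lemma ev_uminus: "ev z (- q) = - ev z q"
  using ev_add[of z q "- q"] by (simp add: ev_zero eq_neg_iff_add_eq_0 add.commute)

lemma ev_diff: "ev z (p - q) = ev z p - ev z q"
  using ev_add[of z p "- q"] by (simp add: ev_uminus)

lemma ev_power: "ev z (q ^ n) = ev z q ^ n"
  by (induction n) (auto simp: ev_one ev_mult)

lemma ev_prod: "ev z (\<Prod>i\<in>I. q i) = (\<Prod>i\<in>I. ev z (q i))"
  by (induction I rule: infinite_finite_induct) (auto simp: ev_one ev_mult)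

lemma ev_substitute: "ev z (substitute f q) = ev (\<lambda>v. ev z (f v)) q"
  by (simp add: substitute_def ev_sum ev_mult ev_Const ev_prod ev_power ev_def[of _ q] mon_def)

text \<open>The polynomial subalgebra on the variables in T. For T = UNIV it is an induction
  principle for the whole free algebra; for a basis it supplies normal forms modulo
  \<open>sym_ideal\<close>.\<close>

inductive_set subalg :: "'v set \<Rightarrow> ('v, 'k::comm_ring_1) free_alg set" for T where
  subalg_Const: "Const a \<in> subalg T"
| subalg_Var: "v \<in> T \<Longrightarrow> Var v \<in> subalg T"
| subalg_add: "p \<in> subalg T \<Longrightarrow> q \<in> subalg T \<Longrightarrow> p + q \<in> subalg T"
| subalg_mult: "p \<in> subalg T \<Longrightarrow> q \<in> subalg T \<Longrightarrow> p * q \<in> subalg T"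

lemma Const_zero: "Const 0 = 0" and Const_one: "Const 1 = 1"
  by (auto simp: Const_def)

lemma subalg_sum: "(\<And>i. i \<in> I \<Longrightarrow> q i \<in> subalg T) \<Longrightarrow> (\<Sum>i\<in>I. q i) \<in> subalg T"
  by (induction I rule: infinite_finite_induct)
    (auto intro: subalg_add simp: subalg_Const[of 0, unfolded Const_zero])

lemma subalg_prod: "(\<And>i. i \<in> I \<Longrightarrow> q i \<in> subalg T) \<Longrightarrow> (\<Prod>i\<in>I. q i) \<in> subalg T"
  by (induction I rule: infinite_finite_induct)
    (auto intro: subalg_mult simp: subalg_Const[of 1, unfolded Const_one])

lemma subalg_power: "q \<in> subalg T \<Longrightarrow> q ^ n \<in> subalg T"
  by (induction n) (auto intro: subalg_mult simp: subalg_Const[of 1, unfolded Const_one])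

lemma subalg_UNIV: "q \<in> subalg UNIV"
proof -
  have pow: "Var v ^ n = Poly_Mapping.single (Poly_Mapping.single v n) (1 :: 'b)" for v :: 'a and n
    by (induction n) (auto simp: Var_def mult_single simp flip: single_add)
  have prod: "(\<Prod>v\<in>S. Poly_Mapping.single (f v) (1 :: 'b)) = Poly_Mapping.single (\<Sum>v\<in>S. f v) 1"
    for S and f :: "'a \<Rightarrow> 'a \<Rightarrow>\<^sub>0 nat"
    by (induction S rule: infinite_finite_induct) (auto simp: mult_single)
  have single: "Poly_Mapping.single m a = Const a * (\<Prod>v\<in>Poly_Mapping.keys m. Var v ^ Poly_Mapping.lookup m v)"
    for m :: "'a \<Rightarrow>\<^sub>0 nat" and a :: 'b
    by (simp add: pow prod sum_singles Const_def mult_single)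
  have "Poly_Mapping.single m a \<in> subalg UNIV" for m :: "'a \<Rightarrow>\<^sub>0 nat" and a :: 'b
    unfolding single by (intro subalg_mult subalg_Const subalg_prod subalg_power subalg_Var UNIV_I)
  then show ?thesis
    by (subst sum_singles[of q, symmetric]) (intro subalg_sum)
qed

text \<open>Views k[T, b] as polynomials in \<open>Var b\<close> over k[T], for induction on the set
  of variables.\<close>

lemma subalg_insert_poly:
  assumes "q \<in> subalg (insert b T)"
  shows "\<exists>F. (\<forall>i. coeff F i \<in> subalg T) \<and> q = poly F (Var b)"
  using assms
proof (induction rule: subalg.induct)
  have z: "0 \<in> subalg T" using subalg_Const[of 0 T] by (simp add: Const_zero)
  {
    case (subalg_Const a)
    show ?case
      by (rule exI[of _ "[:Const a:]"]) (auto simp: coeff_pCons z intro: subalg.intros split: nat.split)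
  next
    case (subalg_Var v)
    show ?case
    proof (cases "v = b")
      case True
      then show ?thesis using subalg_Const[of 1 T] z
        by (intro exI[of _ "[:0, 1:]"]) (auto simp: coeff_pCons Const_one split: nat.split)
    next
      case False
      then show ?thesis using subalg_Var z
        by (intro exI[of _ "[:Var v:]"]) (auto simp: coeff_pCons intro: subalg.intros split: nat.split)
    qed
  next
    case (subalg_add p q)
    then obtain F F' where F: "\<forall>i. coeff F i \<in> subalg T" "p = poly F (Var b)"
      "\<forall>i. coeff F' i \<in> subalg T" "q = poly F' (Var b)" by blast
    then show ?case by (intro exI[of _ "F + F'"]) (auto intro: subalg.intros)
  next
    case (subalg_mult p q)
    then obtain F F' where F: "\<forall>i. coeff F i \<in> subalg T" "p = poly F (Var b)"
      "\<forall>i. coeff F' i \<in> subalg T" "q = poly F' (Var b)" by blast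
    then show ?case
      by (intro exI[of _ "F * F'"]) (auto simp: coeff_mult intro: subalg_sum subalg.intros)
  }
qed

lemma cring_free_alg_ring: "cring (free_alg_ring :: ('v, 'k::comm_ring_1) free_alg ring)"
proof (rule cringI)
  show "abelian_group (free_alg_ring :: ('v, 'k) free_alg ring)"
    by (rule abelian_groupI) (auto simp: free_alg_ring_def add.assoc add.commute
        intro: exI[of _ "- _"] ab_left_minus)
  show "Group.comm_monoid (free_alg_ring :: ('v, 'k) free_alg ring)"
    by (rule comm_monoidI) (auto simp: free_alg_ring_def mult.assoc mult.commute)
qed (auto simp: free_alg_ring_def distrib_right)

section \<open>Evaluation identifies Sym(V) with the polynomial functions\<close>

context dual_points
begin

abbreviation "evl x \<equiv> ev (pt x)"

text \<open>Write q as a polynomial in \<open>Var b\<close> with coefficients free of b. When only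
  the coordinate \<open>x b\<close> varies, the evaluated coefficients stay fixed, so over an
  infinite field they are all zero, and the induction hypothesis applies to each
  coefficient.\<close>

lemma subalg_independent:
  assumes "finite T" "T \<subseteq> basis" "q \<in> subalg T" "\<And>x. evl x q = 0"
  shows "q = 0"
  using assms
proof (induction T arbitrary: q rule: finite_induct)
  case empty
  have "\<exists>a. q = Const a" using empty(2)
  proof (induction rule: subalg.induct)
    case (subalg_add p q)
    then show ?case by (auto simp: Const_def simp flip: single_add)
  next
    case (subalg_mult p q)
    then show ?case by (auto simp: Const_def mult_single)
  qed auto
  then show ?case using empty(3) by (auto simp: ev_Const Const_zero)
next
  case (insert b T)
  obtain F where F: "\<And>i. coeff F i \<in> subalg T" "q = poly F (Var b)"
    using subalg_insert_poly[OF insert.prems(2)] by blast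
  have indep: "evl (x(b := t)) p = evl x p" if "p \<in> subalg T" for p x t
    using that
  proof (induction rule: subalg.induct)
    case (subalg_Var v)
    then have "v \<in> basis" "v \<noteq> b" using insert by auto
    then show ?case by (simp add: ev_Var pt_basis)
  qed (auto simp: ev_Const ev_add ev_mult)
  have "coeff F i = 0" for i
  proof (rule insert.IH)
    fix x
    define P where "P = (\<Sum>i\<le>degree F. monom (evl x (coeff F i)) i)"
    have "poly P t = 0" for t
    proof -
      have "poly P t = (\<Sum>i\<le>degree F. evl (x(b := t)) (coeff F i) * t ^ i)"
        by (simp add: P_def poly_sum poly_monom indep F)
      also have "\<dots> = evl (x(b := t)) q"
        using insert.prems(1) by (simp add: F(2) poly_altdef ev_sum ev_mult ev_power ev_Var pt_basis)
      finally show ?thesis using insert.prems(3) by simp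
    qed
    then have "P = 0" using poly_eq_of_values[of P 0] by simp
    then have "coeff P i = 0" by simp
    moreover have "coeff P i = (if i \<le> degree F then evl x (coeff F i) else 0)"
      by (simp add: P_def coeff_sum)
    moreover have "coeff F i = 0" if "\<not> i \<le> degree F"
      using that by (simp add: coeff_eq_0)
    ultimately show "evl x (coeff F i) = 0" by (cases "i \<le> degree F") (auto simp: ev_zero)
  qed (use insert.prems F in auto)
  then have "F = 0" by (simp add: poly_eq_iff)
  then show ?case using F(2) by simp
qed

lemma ideal_kernel: "ideal {q. \<forall>x. evl x q = 0} free_alg_ring"
proof -
  interpret cring "free_alg_ring :: ('v, 'k) free_alg ring" by (rule cring_free_alg_ring)
  have inv: "\<ominus>\<^bsub>free_alg_ring\<^esub> q = - q" for q :: "('v, 'k) free_alg"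
    by (rule minus_equality) (auto simp: free_alg_ring_def)
  show ?thesis
  proof (rule idealI)
    show "subgroup {q. \<forall>x. evl x q = 0} (add_monoid free_alg_ring)"
    proof (rule add.subgroupI)
      show "\<ominus>\<^bsub>free_alg_ring\<^esub> q \<in> {q. \<forall>x. evl x q = 0}" if "q \<in> {q. \<forall>x. evl x q = 0}" for q
        using that by (simp add: inv ev_uminus)
      show "{q. \<forall>x. evl x q = 0} \<noteq> {}" using ev_zero by blast
    qed (auto simp: free_alg_ring_def ev_add)
  qed (use ring_axioms in \<open>auto simp: free_alg_ring_def ev_mult\<close>)
qed

lemma sym_ideal_ideal: "ideal (sym_ideal sV) free_alg_ring"
  unfolding sym_ideal_def
  by (rule ring.genideal_ideal[OF cring.axioms(1)[OF cring_free_alg_ring]])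
    (auto simp: free_alg_ring_def)

lemma sym_ideal_closed:
  "p \<in> sym_ideal sV \<Longrightarrow> q \<in> sym_ideal sV \<Longrightarrow> p + q \<in> sym_ideal sV"
  "q \<in> sym_ideal sV \<Longrightarrow> p * q \<in> sym_ideal sV"
  "0 \<in> sym_ideal sV"
  using additive_subgroup.a_closed[OF ideal.axioms(1)[OF sym_ideal_ideal]]
    ideal.I_l_closed[OF sym_ideal_ideal]
    additive_subgroup.zero_closed[OF ideal.axioms(1)[OF sym_ideal_ideal]]
  by (auto simp: free_alg_ring_def)

lemma sym_ideal_generators:
  "Var (u + v) - Var u - Var v \<in> sym_ideal sV" "Var (sV a v) - Const a * Var v \<in> sym_ideal sV"
  unfolding sym_ideal_def
  by (rule subsetD[OF ring.genideal_self[OF cring.axioms(1)[OF cring_free_alg_ring]]];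
      auto simp: free_alg_ring_def)+

lemma Var_zero_sym_ideal: "Var 0 \<in> sym_ideal sV"
  using sym_ideal_generators(2)[of 0 0] by (simp add: Const_zero)

lemma Var_expand_sym_ideal:
  "Var (\<Sum>b\<in>C. sV (r b) b) - (\<Sum>b\<in>C. Const (r b) * Var b) \<in> sym_ideal sV"
proof (induction C rule: infinite_finite_induct)
  case (insert b C)
  let ?s = "\<Sum>b\<in>C. sV (r b) b"
  have "Var (sV (r b) b + ?s) - (Const (r b) * Var b + (\<Sum>b\<in>C. Const (r b) * Var b))
    = (Var (sV (r b) b + ?s) - Var (sV (r b) b) - Var ?s) + (Var (sV (r b) b) - Const (r b) * Var b)
      + (Var ?s - (\<Sum>b\<in>C. Const (r b) * Var b))" by simp
  also have "\<dots> \<in> sym_ideal sV"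
    by (intro sym_ideal_closed(1) sym_ideal_generators insert)
  finally show ?case using insert by simp
qed (auto simp: Var_zero_sym_ideal)

text \<open>Modulo the ideal a variable is the combination of basis variables given by its
  coordinates; sums and products follow since the ideal absorbs them.\<close>

lemma normal_form_sym_ideal: "\<exists>q'\<in>subalg basis. q - q' \<in> sym_ideal sV"
  using subalg_UNIV[of q]
proof (induction rule: subalg.induct)
  case (subalg_Const a)
  then show ?case by (intro bexI[of _ "Const a"]) (auto simp: sym_ideal_closed intro: subalg.intros)
next
  case (subalg_Var v)
  have "v = (\<Sum>b\<in>basis. sV (representation basis v b) b)"
    by (simp add: sum_representation_eq[OF independent_Basis] span_Basis finite_Basis)
  then have "Var v - (\<Sum>b\<in>basis. Const (representation basis v b) * Var b) \<in> sym_ideal sV"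
    using Var_expand_sym_ideal[where r = "representation basis v" and C = basis] by metis
  then show ?case by (intro bexI) (auto intro: subalg_sum subalg.intros)
next
  case (subalg_add p q)
  then obtain p' q' where "p' \<in> subalg basis" "q' \<in> subalg basis" "p - p' \<in> sym_ideal sV"
    "q - q' \<in> sym_ideal sV" by blast
  moreover have "p + q - (p' + q') = (p - p') + (q - q')" by simp
  ultimately show ?case by (metis sym_ideal_closed(1) subalg.subalg_add)
next
  case (subalg_mult p q)
  then obtain p' q' where *: "p' \<in> subalg basis" "q' \<in> subalg basis" "p - p' \<in> sym_ideal sV"
    "q - q' \<in> sym_ideal sV" by blast
  moreover have "p * q - p' * q' = q * (p - p') + p' * (q - q')" by (simp add: algebra_simps)
  ultimately show ?case by (metis sym_ideal_closed(1,2) subalg.subalg_mult)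
qed

text \<open>The generators vanish at every linear functional. Conversely, reduce q modulo the ideal
  to a polynomial in basis variables; if it vanishes everywhere it is zero by
  \<open>subalg_independent\<close>.\<close>

lemma sym_ideal_eq_kernel: "sym_ideal sV = {q. \<forall>x. evl x q = 0}"
proof
  show "sym_ideal sV \<subseteq> {q. \<forall>x. evl x q = 0}"
    unfolding sym_ideal_def
    by (rule ring.genideal_minimal[OF cring.axioms(1)[OF cring_free_alg_ring] ideal_kernel])
      (auto simp: ev_diff ev_mult ev_Var ev_Const pt_add pt_scale)
  show "{q. \<forall>x. evl x q = 0} \<subseteq> sym_ideal sV"
  proof clarify
    fix q assume q: "\<forall>x. evl x q = 0"
    obtain q' where q': "q' \<in> subalg basis" "q - q' \<in> sym_ideal sV"
      using normal_form_sym_ideal by blast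
    then have "evl x (q - q') = 0" for x
      using \<open>sym_ideal sV \<subseteq> {q. \<forall>x. evl x q = 0}\<close> by blast
    then have "evl x q' = 0" for x using q by (simp add: ev_diff)
    then have "q' = 0" using subalg_independent[OF finite_Basis subset_refl q'(1)] by blast
    then show "q \<in> sym_ideal sV" using q' by simp
  qed
qed

lemma evl_Pol: "(\<lambda>x. evl x q) \<in> Pol"
  using subalg_UNIV[of q]
  by (induction rule: subalg.induct) (auto simp: ev_Const ev_Var ev_add ev_mult intro: Pol.intros)

lemma Pol_evl: "f \<in> Pol \<Longrightarrow> \<exists>q. \<forall>x. evl x q = f x"
proof (induction rule: Pol.induct)
  case (Pol_const a)
  show ?case by (intro exI[of _ "Const a"]) (simp add: ev_Const)
next
  case (Pol_pt v)
  show ?case by (intro exI[of _ "Var v"]) (simp add: ev_Var)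
next
  case (Pol_add f h)
  then show ?case by (metis ev_add)
next
  case (Pol_mult f h)
  then show ?case by (metis ev_mult)
qed

text \<open>The element of \<open>Sym(V)\<close> corresponding to a polynomial function.\<close>

definition fib :: "(('v \<Rightarrow> 'k) \<Rightarrow> 'k) \<Rightarrow> ('v, 'k) free_alg set" where
  "fib f = {q. \<forall>x. evl x q = f x}"

lemma fib_inj: "f \<in> Pol \<Longrightarrow> fib f = fib h \<Longrightarrow> f = h"
proof -
  assume "f \<in> Pol" and eq: "fib f = fib h"
  then obtain q where q: "\<And>x. evl x q = f x" using Pol_evl by blast
  then have "q \<in> fib h" unfolding eq[symmetric] by (simp add: fib_def)
  then show "f = h" using q by (auto simp: fib_def)
qed

lemma coset_eq_fib: "sym_ideal sV +>\<^bsub>free_alg_ring\<^esub> q = fib (\<lambda>x. evl x q)"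
proof -
  have "p \<in> sym_ideal sV +>\<^bsub>free_alg_ring\<^esub> q \<longleftrightarrow> p - q \<in> sym_ideal sV" for p
  proof
    assume "p \<in> sym_ideal sV +>\<^bsub>free_alg_ring\<^esub> q"
    then show "p - q \<in> sym_ideal sV" by (auto simp: a_r_coset_def' free_alg_ring_def)
  next
    assume "p - q \<in> sym_ideal sV"
    then show "p \<in> sym_ideal sV +>\<^bsub>free_alg_ring\<^esub> q"
      unfolding a_r_coset_def' free_alg_ring_def by (auto intro!: bexI[of _ "p - q"])
  qed
  then show ?thesis by (auto simp: sym_ideal_eq_kernel fib_def ev_diff)
qed

lemma sym_alg_simps:
  "carrier (sym_alg sV) = fib ` Pol"
  "\<zero>\<^bsub>sym_alg sV\<^esub> = fib (\<lambda>x. 0)" "\<one>\<^bsub>sym_alg sV\<^esub> = fib (\<lambda>x. 1)"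
proof -
  show "carrier (sym_alg sV) = fib ` Pol"
  proof
    show "carrier (sym_alg sV) \<subseteq> fib ` Pol"
      by (auto simp: sym_alg_def Let_def FactRing_def A_RCOSETS_def' coset_eq_fib evl_Pol)
    show "fib ` Pol \<subseteq> carrier (sym_alg sV)"
    proof clarify
      fix f assume "f \<in> Pol"
      then obtain q where "f = (\<lambda>x. evl x q)" using Pol_evl by (metis ext)
      then show "fib f \<in> carrier (sym_alg sV)"
        unfolding sym_alg_def Let_def FactRing_def A_RCOSETS_def'
        by (auto simp: coset_eq_fib) (auto simp: free_alg_ring_def)
    qed
  qed
  show "\<zero>\<^bsub>sym_alg sV\<^esub> = fib (\<lambda>x. 0)"
    by (simp add: sym_alg_def Let_def FactRing_def fib_def sym_ideal_eq_kernel)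
  show "\<one>\<^bsub>sym_alg sV\<^esub> = fib (\<lambda>x. 1)"
    unfolding sym_alg_def Let_def FactRing_def
    by (simp add: coset_eq_fib) (simp add: free_alg_ring_def ev_one)
qed

lemma sym_alg_ops:
  assumes "f \<in> Pol" "h \<in> Pol"
  shows "fib f \<oplus>\<^bsub>sym_alg sV\<^esub> fib h = fib (\<lambda>x. f x + h x)"
    and "fib f \<otimes>\<^bsub>sym_alg sV\<^esub> fib h = fib (\<lambda>x. f x * h x)"
    and "a \<odot>\<^bsub>sym_alg sV\<^esub> fib f = fib (\<lambda>x. a * f x)"
proof -
  \<comment> \<open>\<open>rcoset_mult\<close> is a union over all pairs of representatives; there
    is at least one pair, and all give the same coset.\<close>
  have mult: "rcoset_mult free_alg_ring (sym_ideal sV) (fib f) (fib h) = fib (\<lambda>x. f x * h x)"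
    if fh: "f \<in> Pol" "h \<in> Pol" for f h
  proof -
    obtain p q where "p \<in> fib f" "q \<in> fib h"
      using Pol_evl[OF fh(1)] Pol_evl[OF fh(2)] by (auto simp: fib_def)
    moreover have "sym_ideal sV +>\<^bsub>free_alg_ring\<^esub> (p \<otimes>\<^bsub>free_alg_ring\<^esub> q) = fib (\<lambda>x. f x * h x)"
      if "p \<in> fib f" "q \<in> fib h" for p q
      using that unfolding coset_eq_fib by (simp add: free_alg_ring_def ev_mult fib_def)
    ultimately show ?thesis unfolding rcoset_mult_def by blast
  qed
  show "fib f \<otimes>\<^bsub>sym_alg sV\<^esub> fib h = fib (\<lambda>x. f x * h x)"
    by (simp add: sym_alg_def Let_def FactRing_def mult assms)
  show "a \<odot>\<^bsub>sym_alg sV\<^esub> fib f = fib (\<lambda>x. a * f x)"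
    by (simp add: sym_alg_def Let_def FactRing_def coset_eq_fib ev_Const mult assms Pol_const)
  obtain p where p: "p \<in> fib f" using Pol_evl[OF assms(1)] by (auto simp: fib_def)
  have "set_add free_alg_ring (fib f) (fib h) = fib (\<lambda>x. f x + h x)"
  proof
    show "set_add free_alg_ring (fib f) (fib h) \<subseteq> fib (\<lambda>x. f x + h x)"
      by (auto simp: set_add_def' free_alg_ring_def fib_def ev_add)
    show "fib (\<lambda>x. f x + h x) \<subseteq> set_add free_alg_ring (fib f) (fib h)"
    proof
      fix q assume "q \<in> fib (\<lambda>x. f x + h x)"
      then have "q - p \<in> fib h" using p by (simp add: fib_def ev_diff)
      moreover have "q = p + (q - p)" by simp
      ultimately show "q \<in> set_add free_alg_ring (fib f) (fib h)"
        using p unfolding set_add_def' free_alg_ring_def by fastforce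
    qed
  qed
  then show "fib f \<oplus>\<^bsub>sym_alg sV\<^esub> fib h = fib (\<lambda>x. f x + h x)"
    by (simp add: sym_alg_def Let_def FactRing_def)
qed

end

section \<open>The group action on Sym(V)\<close>

context linear_group
begin

text \<open>Replacing each variable v by g v and evaluating at x is evaluation at
  \<open>act x g\<close>. The ideal added in \<open>sym_act\<close> fills the image up to the whole
  fibre.\<close>

lemma sym_act_fib:
  assumes f: "f \<in> Pol" and g: "g \<in> G"
  shows "sym_act sV g (fib f) = fib (\<lambda>x. f (act x g))"
proof -
  have *: "evl x (substitute (\<lambda>v. Var (g v)) q) = evl (act x g) q" for x q
    unfolding pt_act[OF g] by (simp add: ev_substitute ev_Var act_def)
  obtain p where p: "p \<in> fib f" using Pol_evl[OF f] by (auto simp: fib_def)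
  show ?thesis
  proof
    show "sym_act sV g (fib f) \<subseteq> fib (\<lambda>x. f (act x g))"
      by (auto simp: sym_act_def set_add_def' free_alg_ring_def sym_ideal_eq_kernel fib_def ev_add *)
    show "fib (\<lambda>x. f (act x g)) \<subseteq> sym_act sV g (fib f)"
    proof
      fix q assume q: "q \<in> fib (\<lambda>x. f (act x g))"
      let ?p = "substitute (\<lambda>v. Var (g v)) p"
      have "q - ?p \<in> sym_ideal sV"
        using p q by (simp add: fib_def sym_ideal_eq_kernel ev_diff *)
      moreover have "q = (q - ?p) + ?p" by simp
      ultimately show "q \<in> sym_act sV g (fib f)"
        using p unfolding sym_act_def set_add_def' free_alg_ring_def by fastforce
    qed
  qed
qed

end

section \<open>Tensor products as polynomial maps\<close>

context group_covariants
begin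

text \<open>The choice is harmless: all representatives in \<open>fib f\<close> have the same
  values, and for polynomial f there is one (\<open>val_fib\<close>).\<close>

definition val :: "('v, 'k) free_alg set \<Rightarrow> ('v \<Rightarrow> 'k) \<Rightarrow> 'k" where
  "val A x = evl x (SOME q. q \<in> A)"

lemma val_fib: "f \<in> Pol \<Longrightarrow> val (fib f) x = f x"
proof -
  assume "f \<in> Pol"
  then have "\<exists>q. q \<in> fib f" using Pol_evl by (auto simp: fib_def)
  then have "(SOME q. q \<in> fib f) \<in> fib f" by (rule someI_ex)
  then show ?thesis by (simp add: val_def fib_def)
qed

text \<open>The value at a point of \<open>V\<^sup>*\<close> of a representative of a tensor.\<close>

definition theta :: "(('v, 'k) free_alg set \<times> 'w \<Rightarrow>\<^sub>0 int) \<Rightarrow> ('v \<Rightarrow> 'k) \<Rightarrow> 'w" where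
  "theta c x = (\<Sum>p\<in>Poly_Mapping.keys c. sW (of_int (Poly_Mapping.lookup c p) * val (fst p) x) (snd p))"

lemma theta_superset:
  assumes "finite S" "Poly_Mapping.keys c \<subseteq> S"
  shows "theta c x = (\<Sum>p\<in>S. sW (of_int (Poly_Mapping.lookup c p) * val (fst p) x) (snd p))"
  unfolding theta_def using assms
  by (intro sum.mono_neutral_left) (auto simp: in_keys_iff)

lemma theta_diff: "theta (c - d) x = theta c x - theta d x"
proof -
  let ?S = "Poly_Mapping.keys c \<union> Poly_Mapping.keys d"
  have "Poly_Mapping.keys (c - d) \<subseteq> ?S" by (rule Poly_Mapping.keys_diff)
  then show ?thesis
    by (simp add: theta_superset[of ?S] lookup_minus left_diff_distrib
        W.scale_left_diff_distrib sum_subtractf)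
qed

lemma theta_zero: "theta 0 x = 0"
  by (simp add: theta_def)

lemma theta_add: "theta (c + d) x = theta c x + theta d x"
  using theta_diff[of "c + d" d x] by simp

lemma theta_sum: "theta (\<Sum>i\<in>I. c i) x = (\<Sum>i\<in>I. theta (c i) x)"
  by (induction I rule: infinite_finite_induct) (auto simp: theta_zero theta_add)

lemma theta_frag_of: "theta (frag_of (s, u)) x = sW (val s x) u"
  by (simp add: theta_def keys_frag_of)

section \<open>The relations of the tensor product\<close>

abbreviation "tdom B \<equiv> carrier (sym_alg sV) \<times> W.span B"
abbreviation "tnull B \<equiv> tensor_null (sym_alg sV) sW (W.span B)"

lemma tensor_relations_subset:
  "tensor_relations (sym_alg sV) sW (W.span B) \<subseteq> carrier (free_Abelian_group (tdom B))"
proof -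
  have d: "Poly_Mapping.keys (frag_of p - frag_of q) \<subseteq> T" if "p \<in> T" "q \<in> T" for p q T
    using that keys_diff[of "frag_of p" "frag_of q"] by (auto simp: keys_frag_of)
  have d3: "Poly_Mapping.keys (frag_of p - frag_of q - frag_of r) \<subseteq> T"
    if "p \<in> T" "q \<in> T" "r \<in> T" for p q r T
    using that keys_diff[of "frag_of p - frag_of q" "frag_of r"] d[OF that(1,2)]
    by (auto simp: keys_frag_of)
  have add: "s \<oplus>\<^bsub>sym_alg sV\<^esub> s' \<in> carrier (sym_alg sV)"
    if "s \<in> carrier (sym_alg sV)" "s' \<in> carrier (sym_alg sV)" for s s'
    using that by (auto simp: sym_alg_simps sym_alg_ops intro: Pol_add)
  have scale: "a \<odot>\<^bsub>sym_alg sV\<^esub> s \<in> carrier (sym_alg sV)" if "s \<in> carrier (sym_alg sV)" for a s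
    using that by (auto simp: sym_alg_simps sym_alg_ops intro!: imageI Pol_mult Pol_const)
  show ?thesis
  proof
    fix c assume "c \<in> tensor_relations (sym_alg sV) sW (W.span B)"
    then consider
        s s' u where "c = frag_of (s \<oplus>\<^bsub>sym_alg sV\<^esub> s', u) - frag_of (s, u) - frag_of (s', u)"
          "s \<in> carrier (sym_alg sV)" "s' \<in> carrier (sym_alg sV)" "u \<in> W.span B"
      | s u u' where "c = frag_of (s, u + u') - frag_of (s, u) - frag_of (s, u')"
          "s \<in> carrier (sym_alg sV)" "u \<in> W.span B" "u' \<in> W.span B"
      | a s u where "c = frag_of (a \<odot>\<^bsub>sym_alg sV\<^esub> s, u) - frag_of (s, sW a u)"
          "s \<in> carrier (sym_alg sV)" "u \<in> W.span B"
      unfolding tensor_relations_def by blast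
    then have "Poly_Mapping.keys c \<subseteq> tdom B"
    proof cases
      case 1
      show ?thesis unfolding 1(1) by (rule d3) (use 1 in \<open>auto intro: add\<close>)
    next
      case 2
      show ?thesis unfolding 2(1) by (rule d3) (use 2 in \<open>auto intro: W.span_add\<close>)
    next
      case 3
      show ?thesis unfolding 3(1) by (rule d) (use 3 in \<open>auto intro: scale W.span_scale\<close>)
    qed
    then show "c \<in> carrier (free_Abelian_group (tdom B))" by simp
  qed
qed

lemma tnull_subgroup: "subgroup (tnull B) (free_Abelian_group (tdom B))"
  unfolding tensor_null_def
  by (rule group.generate_is_subgroup[OF group_free_Abelian_group tensor_relations_subset])

lemma tnull_closed:
  "0 \<in> tnull B" "c \<in> tnull B \<Longrightarrow> d \<in> tnull B \<Longrightarrow> c + d \<in> tnull B"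
  "c \<in> tnull B \<Longrightarrow> - c \<in> tnull B" "c \<in> tnull B \<Longrightarrow> d \<in> tnull B \<Longrightarrow> c - d \<in> tnull B"
proof -
  show "0 \<in> tnull B" using subgroup.one_closed[OF tnull_subgroup] by simp
  show add: "c + d \<in> tnull B" if "c \<in> tnull B" "d \<in> tnull B" for c d
    using subgroup.m_closed[OF tnull_subgroup that] by simp
  show inv: "- c \<in> tnull B" if "c \<in> tnull B" for c
    using subgroup.m_inv_closed[OF tnull_subgroup that] subgroup.mem_carrier[OF tnull_subgroup that]
    by simp
  show "c - d \<in> tnull B" if "c \<in> tnull B" "d \<in> tnull B"
    using add[OF that(1) inv[OF that(2)]] by simp
qed

lemma tnull_sum: "(\<And>i. i \<in> I \<Longrightarrow> c i \<in> tnull B) \<Longrightarrow> (\<Sum>i\<in>I. c i) \<in> tnull B"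
  by (induction I rule: infinite_finite_induct) (auto intro: tnull_closed)

lemma tnull_relations:
  assumes "f \<in> Pol" "u \<in> W.span B"
  shows "h \<in> Pol \<Longrightarrow> frag_of (fib (\<lambda>x. f x + h x), u) - frag_of (fib f, u) - frag_of (fib h, u) \<in> tnull B"
    and "v \<in> W.span B \<Longrightarrow> frag_of (fib f, u + v) - frag_of (fib f, u) - frag_of (fib f, v) \<in> tnull B"
    and "frag_of (fib (\<lambda>x. a * f x), u) - frag_of (fib f, sW a u) \<in> tnull B"
proof -
  have mem: "fib f \<in> carrier (sym_alg sV)" using assms by (simp add: sym_alg_simps)
  show "frag_of (fib (\<lambda>x. f x + h x), u) - frag_of (fib f, u) - frag_of (fib h, u) \<in> tnull B"
    if "h \<in> Pol"
  proof -
    have "fib h \<in> carrier (sym_alg sV)" using that by (simp add: sym_alg_simps)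
    then show ?thesis
      unfolding tensor_null_def tensor_relations_def sym_alg_ops(1)[OF assms(1) that, symmetric]
      using mem assms(2) by (intro generate.incl) blast
  qed
  show "frag_of (fib f, u + v) - frag_of (fib f, u) - frag_of (fib f, v) \<in> tnull B"
    if "v \<in> W.span B"
    unfolding tensor_null_def tensor_relations_def
    using mem assms(2) that by (intro generate.incl) blast
  show "frag_of (fib (\<lambda>x. a * f x), u) - frag_of (fib f, sW a u) \<in> tnull B"
    unfolding tensor_null_def tensor_relations_def sym_alg_ops(3)[OF assms(1) assms(1), symmetric]
    using mem assms(2) by (intro generate.incl) blast
qed

lemma tnull_zero_left: "u \<in> W.span B \<Longrightarrow> frag_of (fib (\<lambda>x. 0), u) \<in> tnull B"
  using tnull_closed(3)[OF tnull_relations(1)[of "\<lambda>x. 0" u B "\<lambda>x. 0"]] by (simp add: Pol_const)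

lemma tnull_zero_right: "f \<in> Pol \<Longrightarrow> frag_of (fib f, 0) \<in> tnull B"
  using tnull_closed(3)[OF tnull_relations(2)[of f 0 B 0]] by (simp add: W.span_zero)

lemma tensor_expand:
  assumes f: "f \<in> Pol" and "C \<subseteq> B"
  shows "frag_of (fib f, \<Sum>b\<in>C. sW (r b) b) - (\<Sum>b\<in>C. frag_of (fib (\<lambda>x. r b * f x), b)) \<in> tnull B"
  using assms(2)
proof (induction C rule: infinite_finite_induct)
  case (insert b C)
  let ?s = "\<Sum>b\<in>C. sW (r b) b" and ?t = "\<Sum>b\<in>C. frag_of (fib (\<lambda>x. r b * f x), b)"
  have b: "b \<in> W.span B" using insert by (auto intro: W.span_base)
  have s: "?s \<in> W.span B" using insert.prems by (intro W.span_sum W.span_scale W.span_base) auto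
  have "frag_of (fib f, sW (r b) b + ?s) - (frag_of (fib (\<lambda>x. r b * f x), b) + ?t)
    = (frag_of (fib f, sW (r b) b + ?s) - frag_of (fib f, sW (r b) b) - frag_of (fib f, ?s))
      - (frag_of (fib (\<lambda>x. r b * f x), b) - frag_of (fib f, sW (r b) b))
      + (frag_of (fib f, ?s) - ?t)" by simp
  also have "\<dots> \<in> tnull B"
    using insert.IH insert.prems
    by (intro tnull_closed(2)[OF tnull_closed(4)[OF tnull_relations(2)[OF f W.span_scale[OF b] s]
            tnull_relations(3)[OF f b]]]) auto
  finally show ?case using insert by simp
qed (auto simp: tnull_zero_right f)

text \<open>The counterpart of \<open>fib\<close> for tensors: the coset of all representatives of
  the polynomial map F. The condition on keys is membership in the free abelian group.\<close>

definition tfib :: "'w set \<Rightarrow> (('v \<Rightarrow> 'k) \<Rightarrow> 'w) \<Rightarrow> (('v, 'k) free_alg set \<times> 'w \<Rightarrow>\<^sub>0 int) set" where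
  "tfib B F = {c. Poly_Mapping.keys c \<subseteq> tdom B \<and> (\<forall>x. theta c x = F x)}"

context
  fixes B \<rho>
  assumes rb: "rep_basis B \<rho>"
begin

text \<open>Expanding the second factor in the basis and moving the scalars to the left brings every
  generator to the form \<Sum>b. f_b \<otimes> b, and such forms can be subtracted.\<close>

lemma tensor_normal_form:
  assumes "Poly_Mapping.keys c \<subseteq> tdom B"
  shows "\<exists>f. (\<forall>b\<in>B. f b \<in> Pol) \<and> c - (\<Sum>b\<in>B. frag_of (fib (f b), b)) \<in> tnull B"
  using assms
proof (induction rule: frag_induction)
  case zero
  show ?case
    using tnull_sum[of B "\<lambda>b. frag_of (fib (\<lambda>x. 0), b)" B]
    by (intro exI[of _ "\<lambda>b x. 0"]) (auto intro: Pol_const tnull_closed tnull_zero_left W.span_base)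
next
  case (diff c d)
  then obtain f h where f: "\<And>b. b \<in> B \<Longrightarrow> f b \<in> Pol" "c - (\<Sum>b\<in>B. frag_of (fib (f b), b)) \<in> tnull B"
    and h: "\<And>b. b \<in> B \<Longrightarrow> h b \<in> Pol" "d - (\<Sum>b\<in>B. frag_of (fib (h b), b)) \<in> tnull B" by blast
  let ?k = "\<lambda>b x. f b x - h b x"
  have "frag_of (fib (f b), b) - frag_of (fib (?k b), b) - frag_of (fib (h b), b) \<in> tnull B"
    if b: "b \<in> B" for b
    using tnull_relations(1)[OF Pol_diff[OF f(1)[OF b] h(1)[OF b]] W.span_base[OF b] h(1)[OF b]] by simp
  then have "(\<Sum>b\<in>B. frag_of (fib (f b), b) - frag_of (fib (?k b), b) - frag_of (fib (h b), b)) \<in> tnull B"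
    by (rule tnull_sum)
  from tnull_closed(2)[OF tnull_closed(4)[OF f(2) h(2)] this]
  have "c - d - (\<Sum>b\<in>B. frag_of (fib (?k b), b)) \<in> tnull B"
    unfolding sum_subtractf by (simp add: algebra_simps)
  then show ?case using f(1) h(1) by (intro exI[of _ ?k]) (auto intro: Pol_diff)
next
  case (one p)
  then obtain f u where f: "p = (fib f, u)" "f \<in> Pol" "u \<in> W.span B" by (auto simp: sym_alg_simps)
  then have "frag_of p - (\<Sum>b\<in>B. frag_of (fib (\<lambda>x. coord B u b * f x), b)) \<in> tnull B"
    using tensor_expand[OF f(2) subset_refl, of "coord B u" B] coord_expand[OF rb f(3)] by simp
  then show ?case using f(2) by (intro exI[of _ "\<lambda>b x. coord B u b * f x"]) (auto intro: Pol_mult Pol_const)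
qed

lemma theta_PolW: "Poly_Mapping.keys c \<subseteq> tdom B \<Longrightarrow> theta c \<in> PolW B"
proof (induction rule: frag_induction)
  case zero
  show ?case using PolW_const[OF rb W.span_zero] by (simp add: theta_zero[abs_def])
next
  case (diff c d)
  have "theta (c - d) = (\<lambda>x. theta c x - theta d x)" by (simp add: theta_diff fun_eq_iff)
  then show ?case using PolW_diff[OF rb diff] by simp
next
  case (one p)
  then obtain f u where f: "p = (fib f, u)" "f \<in> Pol" "u \<in> W.span B" by (auto simp: sym_alg_simps)
  then have "theta (frag_of p) = (\<lambda>x. sW (f x) u)" by (simp add: theta_frag_of val_fib fun_eq_iff)
  then show ?case using PolW_mult[OF rb f(2) PolW_const[OF rb f(3)]] by simp
qed

text \<open>Each defining relation has value zero at every point. Conversely, an element with zero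
  values has a normal form \<Sum>b. f_b \<otimes> b with zero values; independence of B gives f_b =
  0, so it is a combination of relations. Tensors are thereby the same as polynomial maps.\<close>

lemma tnull_eq_tfib: "tnull B = tfib B (\<lambda>x. 0)"
proof
  have "subgroup (tfib B (\<lambda>x. 0)) (free_Abelian_group (tdom B))"
  proof (rule group.subgroupI[OF group_free_Abelian_group])
    show "tfib B (\<lambda>x. 0) \<noteq> {}" using theta_zero by (force simp: tfib_def)
    show "inv\<^bsub>free_Abelian_group (tdom B)\<^esub> c \<in> tfib B (\<lambda>x. 0)" if "c \<in> tfib B (\<lambda>x. 0)" for c
      using that theta_diff[of 0 c] by (simp add: tfib_def theta_zero)
    show "c \<otimes>\<^bsub>free_Abelian_group (tdom B)\<^esub> d \<in> tfib B (\<lambda>x. 0)"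
      if "c \<in> tfib B (\<lambda>x. 0)" "d \<in> tfib B (\<lambda>x. 0)" for c d
      using that Poly_Mapping.keys_add[of c d] by (auto simp: tfib_def theta_add)
  qed (auto simp: tfib_def)
  moreover have "tensor_relations (sym_alg sV) sW (W.span B) \<subseteq> tfib B (\<lambda>x. 0)"
  proof
    fix c assume c: "c \<in> tensor_relations (sym_alg sV) sW (W.span B)"
    then have "Poly_Mapping.keys c \<subseteq> tdom B" using tensor_relations_subset by force
    moreover have "theta c x = 0" for x
      using c by (auto simp: tensor_relations_def theta_diff theta_frag_of sym_alg_simps sym_alg_ops
          val_fib Pol_add Pol_mult Pol_const W.scale_left_distrib W.scale_right_distrib mult.commute)
    ultimately show "c \<in> tfib B (\<lambda>x. 0)" by (simp add: tfib_def)
  qed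
  ultimately show "tnull B \<subseteq> tfib B (\<lambda>x. 0)"
    unfolding tensor_null_def by (intro group.generate_subgroup_incl[OF group_free_Abelian_group])
  show "tfib B (\<lambda>x. 0) \<subseteq> tnull B"
  proof
    fix c assume c: "c \<in> tfib B (\<lambda>x. 0)"
    then obtain f where f: "\<And>b. b \<in> B \<Longrightarrow> f b \<in> Pol" "c - (\<Sum>b\<in>B. frag_of (fib (f b), b)) \<in> tnull B"
      using tensor_normal_form[of c] by (auto simp: tfib_def)
    have z: "(\<Sum>b\<in>B. sW (f b x) b) = 0" for x
    proof -
      have "theta (c - (\<Sum>b\<in>B. frag_of (fib (f b), b))) x = 0"
        using f(2) \<open>tnull B \<subseteq> tfib B (\<lambda>x. 0)\<close> by (auto simp: tfib_def)
      then show ?thesis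
        using c f(1) by (simp add: theta_diff theta_sum theta_frag_of val_fib tfib_def)
    qed
    have "f b = (\<lambda>x. 0)" if b: "b \<in> B" for b
    proof
      fix x
      have "0 = coord B (\<Sum>e\<in>B. sW (f e x) e) b" using z coord_zero[OF rb] by simp
      also have "\<dots> = (\<Sum>e\<in>B. f e x * coord B e b)"
        by (subst coord_sum[OF rb]) (auto simp: coord_scale[OF rb] W.span_base W.span_scale)
      also have "\<dots> = (\<Sum>e\<in>B. if e = b then f b x else 0)"
        by (rule sum.cong) (auto simp: coord_basis[OF rb])
      also have "\<dots> = f b x" using b finite_B[OF rb] by simp
      finally show "f b x = 0" by simp
    qed
    then have "(\<Sum>b\<in>B. frag_of (fib (f b), b)) \<in> tnull B"
      by (intro tnull_sum) (simp add: tnull_zero_left W.span_base)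
    from tnull_closed(2)[OF f(2) this] show "c \<in> tnull B" by simp
  qed
qed

lemma tfib_nonempty:
  assumes F: "F \<in> PolW B" obtains c where "c \<in> tfib B F"
proof
  let ?c = "\<Sum>b\<in>B. frag_of (fib (\<lambda>x. coord B (F x) b), b)"
  have "Poly_Mapping.keys ?c \<subseteq> tdom B"
    by (rule order_trans[OF keys_sum])
      (use PolW_coord[OF F] in \<open>auto simp: keys_frag_of sym_alg_simps W.span_base\<close>)
  moreover have "theta ?c x = F x" for x
    using coord_expand[OF rb PolW_span[OF F, of x]] PolW_coord[OF F]
    by (simp add: theta_sum theta_frag_of val_fib)
  ultimately show "?c \<in> tfib B F" by (simp add: tfib_def)
qed

lemma tfib_inj: "F \<in> PolW B \<Longrightarrow> tfib B F = tfib B H \<Longrightarrow> F = H"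
proof -
  assume F: "F \<in> PolW B" and eq: "tfib B F = tfib B H"
  obtain c where c: "c \<in> tfib B F" using tfib_nonempty[OF F] .
  then have "c \<in> tfib B H" using eq by simp
  then show "F = H" using c by (auto simp: tfib_def fun_eq_iff)
qed

lemma tensor_coset:
  assumes "Poly_Mapping.keys c \<subseteq> tdom B"
  shows "tnull B #>\<^bsub>free_Abelian_group (tdom B)\<^esub> c = tfib B (theta c)"
proof
  show "tnull B #>\<^bsub>free_Abelian_group (tdom B)\<^esub> c \<subseteq> tfib B (theta c)"
    using assms Poly_Mapping.keys_add[of _ c] unfolding tnull_eq_tfib
    by (auto simp: r_coset_def tfib_def theta_add)
  show "tfib B (theta c) \<subseteq> tnull B #>\<^bsub>free_Abelian_group (tdom B)\<^esub> c"
  proof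
    fix d assume d: "d \<in> tfib B (theta c)"
    then have "d - c \<in> tnull B"
      using assms keys_diff[of d c] unfolding tnull_eq_tfib by (auto simp: tfib_def theta_diff)
    then show "d \<in> tnull B #>\<^bsub>free_Abelian_group (tdom B)\<^esub> c"
      by (auto simp: r_coset_def intro!: bexI[of _ "d - c"])
  qed
qed

lemma tensor_module_simps:
  "carrier (tensor_module (sym_alg sV) sW (W.span B)) = tfib B ` PolW B"
  "\<zero>\<^bsub>tensor_module (sym_alg sV) sW (W.span B)\<^esub> = tfib B (\<lambda>x. 0)"
proof -
  show "carrier (tensor_module (sym_alg sV) sW (W.span B)) = tfib B ` PolW B"
  proof
    show "carrier (tensor_module (sym_alg sV) sW (W.span B)) \<subseteq> tfib B ` PolW B"
      by (auto simp: tensor_module_def Let_def FactGroup_def RCOSETS_def tensor_coset theta_PolW)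
    show "tfib B ` PolW B \<subseteq> carrier (tensor_module (sym_alg sV) sW (W.span B))"
    proof clarify
      fix F assume "F \<in> PolW B"
      then obtain c where c: "c \<in> tfib B F" by (rule tfib_nonempty)
      then have "Poly_Mapping.keys c \<subseteq> tdom B" "theta c = F" by (auto simp: tfib_def)
      then show "tfib B F \<in> carrier (tensor_module (sym_alg sV) sW (W.span B))"
        using tensor_coset[of c]
        by (auto simp: tensor_module_def Let_def FactGroup_def RCOSETS_def)
    qed
  qed
  show "\<zero>\<^bsub>tensor_module (sym_alg sV) sW (W.span B)\<^esub> = tfib B (\<lambda>x. 0)"
    by (simp add: tensor_module_def Let_def FactGroup_def tnull_eq_tfib)
qed

lemma tensor_add:
  assumes "F \<in> PolW B" "H \<in> PolW B"
  shows "tfib B F \<oplus>\<^bsub>tensor_module (sym_alg sV) sW (W.span B)\<^esub> tfib B H = tfib B (\<lambda>x. F x + H x)"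
proof -
  obtain c where c: "c \<in> tfib B F" using tfib_nonempty[OF assms(1)] .
  have "set_mult (free_Abelian_group (tdom B)) (tfib B F) (tfib B H) = tfib B (\<lambda>x. F x + H x)"
  proof
    show "set_mult (free_Abelian_group (tdom B)) (tfib B F) (tfib B H) \<subseteq> tfib B (\<lambda>x. F x + H x)"
    proof
      fix e assume "e \<in> set_mult (free_Abelian_group (tdom B)) (tfib B F) (tfib B H)"
      then obtain c d where "e = c + d" "c \<in> tfib B F" "d \<in> tfib B H" by (auto simp: set_mult_def)
      then show "e \<in> tfib B (\<lambda>x. F x + H x)"
        using Poly_Mapping.keys_add[of c d] by (auto simp: tfib_def theta_add)
    qed
    show "tfib B (\<lambda>x. F x + H x) \<subseteq> set_mult (free_Abelian_group (tdom B)) (tfib B F) (tfib B H)"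
    proof
      fix e assume e: "e \<in> tfib B (\<lambda>x. F x + H x)"
      then have "e - c \<in> tfib B H" using c keys_diff[of e c] by (auto simp: tfib_def theta_diff)
      then show "e \<in> set_mult (free_Abelian_group (tdom B)) (tfib B F) (tfib B H)"
        using c unfolding set_mult_def by (intro UN_I[of c] UN_I[of "e - c"]) auto
    qed
  qed
  then show ?thesis by (simp add: tensor_module_def Let_def FactGroup_def)
qed

text \<open>Common source of \<open>tensor_smult\<close> and \<open>tensor_action\<close>. The null
  subgroup added in \<open>tensor_map\<close> fills the image up to a whole fibre, so it is enough
  to know the values on representatives.\<close>

lemma tensor_map_tfib:
  assumes F: "F \<in> PolW B"
    and map: "\<And>s u. s \<in> carrier (sym_alg sV) \<Longrightarrow> u \<in> W.span B \<Longrightarrow>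
      \<alpha> s \<in> carrier (sym_alg sV) \<and> \<beta> u \<in> W.span B"
    and vals: "\<And>c x. Poly_Mapping.keys c \<subseteq> tdom B \<Longrightarrow> (\<And>x. theta c x = F x) \<Longrightarrow>
      theta (frag_extend (\<lambda>(s, u). frag_of (\<alpha> s, \<beta> u)) c) x = F' x"
  shows "tensor_map (sym_alg sV) sW (W.span B) \<alpha> \<beta> (tfib B F) = tfib B F'"
proof -
  let ?h = "frag_extend (\<lambda>(s, u). frag_of (\<alpha> s, \<beta> u))"
  have keys: "Poly_Mapping.keys (?h c) \<subseteq> tdom B" if "Poly_Mapping.keys c \<subseteq> tdom B" for c
    by (rule order_trans[OF keys_frag_extend])
      (use that map in \<open>auto simp: keys_frag_of\<close>)
  obtain c where c: "c \<in> tfib B F" using tfib_nonempty[OF F] .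
  show ?thesis
  proof
    show "tensor_map (sym_alg sV) sW (W.span B) \<alpha> \<beta> (tfib B F) \<subseteq> tfib B F'"
    proof
      fix e assume "e \<in> tensor_map (sym_alg sV) sW (W.span B) \<alpha> \<beta> (tfib B F)"
      then obtain d c where "e = d + ?h c" "d \<in> tfib B (\<lambda>x. 0)" "c \<in> tfib B F"
        by (auto simp: tensor_map_def set_mult_def tnull_eq_tfib)
      then show "e \<in> tfib B F'"
        using Poly_Mapping.keys_add[of d "?h c"] keys[of c] vals[of c] by (auto simp: tfib_def theta_add)
    qed
    show "tfib B F' \<subseteq> tensor_map (sym_alg sV) sW (W.span B) \<alpha> \<beta> (tfib B F)"
    proof
      fix e assume e: "e \<in> tfib B F'"
      then have "e - ?h c \<in> tfib B (\<lambda>x. 0)"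
        using c keys_diff[of e "?h c"] keys[of c] vals[of c] by (auto simp: tfib_def theta_diff)
      then show "e \<in> tensor_map (sym_alg sV) sW (W.span B) \<alpha> \<beta> (tfib B F)"
        using c unfolding tensor_map_def set_mult_def tnull_eq_tfib
        by (intro UN_I[of "e - ?h c"] UN_I[of "?h c"]) auto
    qed
  qed
qed

lemma tensor_smult:
  assumes "F \<in> PolW B" and f: "f \<in> Pol"
  shows "fib f \<odot>\<^bsub>tensor_module (sym_alg sV) sW (W.span B)\<^esub> tfib B F = tfib B (\<lambda>x. sW (f x) (F x))"
proof -
  let ?h = "frag_extend (\<lambda>(s, u). frag_of (fib f \<otimes>\<^bsub>sym_alg sV\<^esub> s, u))"
  have "theta (?h c) x = sW (f x) (theta c x)" if "Poly_Mapping.keys c \<subseteq> tdom B" for c x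
    using that
  proof (induction rule: frag_induction)
    case zero
    then show ?case by (simp add: theta_zero)
  next
    case (diff c d)
    then show ?case by (simp add: frag_extend_diff theta_diff W.scale_right_diff_distrib)
  next
    case (one p)
    then show ?case
      by (auto simp: sym_alg_simps sym_alg_ops f theta_frag_of val_fib Pol_mult)
  qed
  then have "tensor_map (sym_alg sV) sW (W.span B) (\<lambda>t. fib f \<otimes>\<^bsub>sym_alg sV\<^esub> t) (\<lambda>u. u) (tfib B F)
      = tfib B (\<lambda>x. sW (f x) (F x))"
    by (intro tensor_map_tfib[OF assms(1)])
      (auto simp: sym_alg_simps sym_alg_ops f intro!: imageI Pol_mult f)
  then show ?thesis by (simp add: tensor_module_def Let_def)
qed

lemma tensor_action:
  assumes "F \<in> PolW B" and g: "g \<in> G"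
  shows "tensor_map (sym_alg sV) sW (W.span B) (sym_act sV g) (\<rho> g) (tfib B F)
    = tfib B (\<lambda>x. \<rho> g (F (act x g)))"
proof (rule tensor_map_tfib[OF assms(1)])
  show "sym_act sV g s \<in> carrier (sym_alg sV) \<and> \<rho> g u \<in> W.span B"
    if "s \<in> carrier (sym_alg sV)" "u \<in> W.span B" for s u
    using that g by (auto simp: sym_alg_simps sym_act_fib rho_span[OF rb] intro: Pol_act)
  let ?h = "frag_extend (\<lambda>(s, u). frag_of (sym_act sV g s, \<rho> g u))"
  \<comment> \<open>Membership in the span is carried along because \<open>\<rho> g\<close> is known
    to be additive only there.\<close>
  have "(\<forall>y. theta c y \<in> W.span B) \<and> theta (?h c) x = \<rho> g (theta c (act x g))"
    if "Poly_Mapping.keys c \<subseteq> tdom B" for c x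
    using that
  proof (induction rule: frag_induction)
    case zero
    then show ?case by (simp add: theta_zero rho_zero[OF rb g] W.span_zero)
  next
    case (diff c d)
    have "\<rho> g (u - v) = \<rho> g u - \<rho> g v" if "u \<in> W.span B" "v \<in> W.span B" for u v
      using rho_add[OF rb g W.span_diff[OF that] that(2)] by (simp add: algebra_simps)
    then show ?case using diff by (simp add: frag_extend_diff theta_diff W.span_diff)
  next
    case (one p)
    then show ?case
      by (auto simp: sym_alg_simps sym_act_fib g theta_frag_of val_fib Pol_act rho_scale[OF rb g]
          W.span_scale)
  qed
  then show "theta (?h c) x = \<rho> g (F (act x g))"
    if "Poly_Mapping.keys c \<subseteq> tdom B" "\<And>x. theta c x = F x" for c x
    using that by simp
qed

lemma covariants_simps:
  "carrier (covariants sV G sW (W.span B) \<rho>) = tfib B ` Equi B \<rho>"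
  "\<zero>\<^bsub>covariants sV G sW (W.span B) \<rho>\<^esub> = tfib B (\<lambda>x. 0)"
proof -
  have "tfib B F \<in> carrier (covariants sV G sW (W.span B) \<rho>) \<longleftrightarrow> F \<in> Equi B \<rho>" if F: "F \<in> PolW B" for F
  proof -
    have "tfib B (\<lambda>x. \<rho> g (F (act x g))) = tfib B F \<longleftrightarrow> (\<lambda>x. \<rho> g (F (act x g))) = F" if "g \<in> G" for g
      using tfib_inj[OF PolW_rho[OF rb F that]] by auto
    then show ?thesis
      using F by (simp add: covariants_def tensor_module_simps tensor_action Equi_def fun_eq_iff)
  qed
  moreover have "carrier (covariants sV G sW (W.span B) \<rho>) \<subseteq> tfib B ` PolW B"
    by (auto simp: covariants_def tensor_module_simps)
  ultimately show "carrier (covariants sV G sW (W.span B) \<rho>) = tfib B ` Equi B \<rho>"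
    using Equi_PolW by blast
  show "\<zero>\<^bsub>covariants sV G sW (W.span B) \<rho>\<^esub> = tfib B (\<lambda>x. 0)"
    by (simp add: covariants_def tensor_module_simps)
qed

lemma covariants_ops:
  assumes F: "F \<in> Equi B \<rho>"
  shows "H \<in> Equi B \<rho> \<Longrightarrow>
      tfib B F \<oplus>\<^bsub>covariants sV G sW (W.span B) \<rho>\<^esub> tfib B H = tfib B (\<lambda>x. F x + H x)"
    and "f \<in> Pol \<Longrightarrow>
      fib f \<odot>\<^bsub>covariants sV G sW (W.span B) \<rho>\<^esub> tfib B F = tfib B (\<lambda>x. sW (f x) (F x))"
  using Equi_PolW[OF F] by (auto simp: covariants_def tensor_add tensor_smult Equi_PolW)

end

lemma invariant_ring_simps:
  "carrier (invariant_ring sV G) = fib ` Inv"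
  "\<zero>\<^bsub>invariant_ring sV G\<^esub> = fib (\<lambda>x. 0)" "\<one>\<^bsub>invariant_ring sV G\<^esub> = fib (\<lambda>x. 1)"
proof -
  have "fib f \<in> carrier (invariant_ring sV G) \<longleftrightarrow> f \<in> Inv" if f: "f \<in> Pol" for f
  proof -
    have "fib (\<lambda>x. f (act x g)) = fib f \<longleftrightarrow> (\<lambda>x. f (act x g)) = f" if "g \<in> G" for g
      using fib_inj[OF Pol_act[OF f that]] by auto
    then show ?thesis
      using f by (simp add: invariant_ring_def sym_alg_simps sym_act_fib Inv_def fun_eq_iff)
  qed
  moreover have "carrier (invariant_ring sV G) \<subseteq> fib ` Pol"
    by (auto simp: invariant_ring_def sym_alg_simps)
  ultimately show "carrier (invariant_ring sV G) = fib ` Inv"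
    by (auto simp: Inv_def)
qed (auto simp: invariant_ring_def sym_alg_simps)

lemma invariant_ring_ops:
  assumes "f \<in> Inv" "h \<in> Inv"
  shows "fib f \<oplus>\<^bsub>invariant_ring sV G\<^esub> fib h = fib (\<lambda>x. f x + h x)"
    and "fib f \<otimes>\<^bsub>invariant_ring sV G\<^esub> fib h = fib (\<lambda>x. f x * h x)"
  using assms by (auto simp: invariant_ring_def sym_alg_ops Inv_def)

end

section \<open>Modules of covariants\<close>

definition linear_map ::
    "('a, 'm) ring_scheme \<Rightarrow> ('a, 'b) module \<Rightarrow> ('a, 'c) module \<Rightarrow> ('b \<Rightarrow> 'c) \<Rightarrow> bool" where
  "linear_map R M N f \<longleftrightarrow>
     (\<forall>x\<in>carrier M. f x \<in> carrier N) \<and>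
     (\<forall>x\<in>carrier M. \<forall>y\<in>carrier M. f (x \<oplus>\<^bsub>M\<^esub> y) = f x \<oplus>\<^bsub>N\<^esub> f y) \<and>
     (\<forall>r\<in>carrier R. \<forall>x\<in>carrier M. f (r \<odot>\<^bsub>M\<^esub> x) = r \<odot>\<^bsub>N\<^esub> f x)"

text \<open>The maps between M and M' pass through their common source N. Closure of N under its
  operations is what lets the inverse bijections inherit linearity.\<close>

lemma module_isomorphic_compose:
  assumes "module_isomorphic R N M" "module_isomorphic R N M'"
    and add: "\<And>x y. x \<in> carrier N \<Longrightarrow> y \<in> carrier N \<Longrightarrow> x \<oplus>\<^bsub>N\<^esub> y \<in> carrier N"
    and smult: "\<And>r x. r \<in> carrier R \<Longrightarrow> x \<in> carrier N \<Longrightarrow> r \<odot>\<^bsub>N\<^esub> x \<in> carrier N"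
  shows "\<exists>\<psi> \<psi>'. linear_map R M M' \<psi> \<and> linear_map R M' M \<psi>' \<and> (\<forall>x\<in>carrier M. \<psi>' (\<psi> x) = x)"
proof -
  obtain f where f: "bij_betw f (carrier N) (carrier M)"
    "\<And>x y. x \<in> carrier N \<Longrightarrow> y \<in> carrier N \<Longrightarrow> f (x \<oplus>\<^bsub>N\<^esub> y) = f x \<oplus>\<^bsub>M\<^esub> f y"
    "\<And>r x. r \<in> carrier R \<Longrightarrow> x \<in> carrier N \<Longrightarrow> f (r \<odot>\<^bsub>N\<^esub> x) = r \<odot>\<^bsub>M\<^esub> f x"
    using assms(1) unfolding module_isomorphic_def by blast
  obtain f' where f': "bij_betw f' (carrier N) (carrier M')"
    "\<And>x y. x \<in> carrier N \<Longrightarrow> y \<in> carrier N \<Longrightarrow> f' (x \<oplus>\<^bsub>N\<^esub> y) = f' x \<oplus>\<^bsub>M'\<^esub> f' y"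
    "\<And>r x. r \<in> carrier R \<Longrightarrow> x \<in> carrier N \<Longrightarrow> f' (r \<odot>\<^bsub>N\<^esub> x) = r \<odot>\<^bsub>M'\<^esub> f' x"
    using assms(2) unfolding module_isomorphic_def by blast
  define k where "k = the_inv_into (carrier N) f"
  define k' where "k' = the_inv_into (carrier N) f'"
  have k: "k y \<in> carrier N" "f (k y) = y" if "y \<in> carrier M" for y
    using f(1) that by (auto simp: k_def bij_betw_def f_the_inv_into_f the_inv_into_into)
  have kf: "k (f x) = x" if "x \<in> carrier N" for x
    using f(1) that by (auto simp: k_def bij_betw_def the_inv_into_f_f)
  have k': "k' y \<in> carrier N" "f' (k' y) = y" if "y \<in> carrier M'" for y
    using f'(1) that by (auto simp: k'_def bij_betw_def f_the_inv_into_f the_inv_into_into)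
  have k'f: "k' (f' x) = x" if "x \<in> carrier N" for x
    using f'(1) that by (auto simp: k'_def bij_betw_def the_inv_into_f_f)
  have fM: "f x \<in> carrier M" "f' x \<in> carrier M'" if "x \<in> carrier N" for x
    using f(1) f'(1) that by (auto simp: bij_betw_def)
  have ka: "k (x \<oplus>\<^bsub>M\<^esub> y) = k x \<oplus>\<^bsub>N\<^esub> k y" if "x \<in> carrier M" "y \<in> carrier M" for x y
    using kf[OF add[OF k(1)[OF that(1)] k(1)[OF that(2)]]] f(2)[OF k(1)[OF that(1)] k(1)[OF that(2)]]
      k(2)[OF that(1)] k(2)[OF that(2)] by simp
  have ks: "k (r \<odot>\<^bsub>M\<^esub> x) = r \<odot>\<^bsub>N\<^esub> k x" if "r \<in> carrier R" "x \<in> carrier M" for r x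
    using kf[OF smult[OF that(1) k(1)[OF that(2)]]] f(3)[OF that(1) k(1)[OF that(2)]] k(2)[OF that(2)]
    by simp
  have k'a: "k' (x \<oplus>\<^bsub>M'\<^esub> y) = k' x \<oplus>\<^bsub>N\<^esub> k' y" if "x \<in> carrier M'" "y \<in> carrier M'" for x y
    using k'f[OF add[OF k'(1)[OF that(1)] k'(1)[OF that(2)]]] f'(2)[OF k'(1)[OF that(1)] k'(1)[OF that(2)]]
      k'(2)[OF that(1)] k'(2)[OF that(2)] by simp
  have k's: "k' (r \<odot>\<^bsub>M'\<^esub> x) = r \<odot>\<^bsub>N\<^esub> k' x" if "r \<in> carrier R" "x \<in> carrier M'" for r x
    using k'f[OF smult[OF that(1) k'(1)[OF that(2)]]] f'(3)[OF that(1) k'(1)[OF that(2)]] k'(2)[OF that(2)]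
    by simp
  show ?thesis
    by (rule exI[of _ "\<lambda>x. f' (k x)"], rule exI[of _ "\<lambda>x. f (k' x)"])
      (simp add: linear_map_def k k' kf k'f fM ka ks k'a k's f f')
qed

context group_covariants
begin

lemma Inv_closed:
  "f \<in> Inv \<Longrightarrow> f \<in> Pol" "(\<lambda>x. a) \<in> Inv"
  "f \<in> Inv \<Longrightarrow> h \<in> Inv \<Longrightarrow> (\<lambda>x. f x + h x) \<in> Inv"
  "f \<in> Inv \<Longrightarrow> h \<in> Inv \<Longrightarrow> (\<lambda>x. f x * h x) \<in> Inv"
  "f \<in> Inv \<Longrightarrow> (\<lambda>x. - f x) \<in> Inv"
  by (auto simp: Inv_def Pol_const Pol_add Pol_mult Pol_uminus)

lemma cring_invariant_ring: "cring (invariant_ring sV G)"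
proof (rule cringI)
  show "abelian_group (invariant_ring sV G)"
  proof (rule abelian_groupI)
    fix r assume "r \<in> carrier (invariant_ring sV G)"
    then obtain f where f: "r = fib f" "f \<in> Inv" by (auto simp: invariant_ring_simps)
    then show "\<exists>y\<in>carrier (invariant_ring sV G). y \<oplus>\<^bsub>invariant_ring sV G\<^esub> r = \<zero>\<^bsub>invariant_ring sV G\<^esub>"
      by (auto simp: invariant_ring_simps invariant_ring_ops Inv_closed
          intro!: bexI[of _ "\<lambda>x. - f x"])
  qed (auto simp: invariant_ring_simps invariant_ring_ops Inv_closed ac_simps
      intro!: imageI)
  show "Group.comm_monoid (invariant_ring sV G)"
    by (rule comm_monoidI) (auto simp: invariant_ring_simps invariant_ring_ops Inv_closed
        ac_simps intro!: imageI)
qed (auto simp: invariant_ring_simps invariant_ring_ops Inv_closed distrib_right)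

context
  fixes B \<rho>
  assumes rb: "rep_basis B \<rho>"
begin

lemma module_covariants: "module (invariant_ring sV G) (covariants sV G sW (W.span B) \<rho>)"
proof (rule moduleI[OF cring_invariant_ring])
  let ?M = "covariants sV G sW (W.span B) \<rho>"
  note simps = covariants_simps[OF rb] covariants_ops[OF rb] Equi_add[OF rb] Equi_mult[OF rb]
    Equi_zero[OF rb] invariant_ring_simps invariant_ring_ops Inv_closed
  show "abelian_group ?M"
  proof (rule abelian_groupI)
    fix t assume "t \<in> carrier ?M"
    then obtain F where F: "t = tfib B F" "F \<in> Equi B \<rho>" by (auto simp: simps)
    then have "(\<lambda>x. - F x) \<in> Equi B \<rho>" using Equi_mult[OF rb Inv_closed(2)[of "-1"] F(2)] by simp
    then show "\<exists>y\<in>carrier ?M. y \<oplus>\<^bsub>?M\<^esub> t = \<zero>\<^bsub>?M\<^esub>"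
      using F by (auto simp: simps intro!: bexI[of _ "\<lambda>x. - F x"])
  qed (auto simp: simps ac_simps intro!: imageI)
qed (auto simp: covariants_simps[OF rb] covariants_ops[OF rb] Equi_add[OF rb] Equi_mult[OF rb]
    invariant_ring_simps invariant_ring_ops Inv_closed W.scale_left_distrib W.scale_right_distrib
    intro!: imageI)

text \<open>A decomposition into X and Y yields the projection onto X along Y. It is an idempotent
  R-linear map, so by \<open>idempotent_equi_hom\<close> it is zero or the identity, which makes X
  or Y zero.\<close>

lemma indecomposable_covariants:
  assumes irr: "irreducible_representation G sW (W.span B) \<rho>"
  shows "indecomposable_module (invariant_ring sV G) (covariants sV G sW (W.span B) \<rho>)"
  unfolding indecomposable_module_def
proof (intro conjI allI impI module_covariants)
  let ?M = "covariants sV G sW (W.span B) \<rho>"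
  let ?R = "invariant_ring sV G"
  note inj = tfib_inj[OF rb Equi_PolW]
  have "B \<noteq> {}" using irr by (auto simp: irreducible_representation_def)
  then obtain F x where F: "F \<in> Equi B \<rho>" "F x \<noteq> 0" using Equi_nonzero[OF rb] by blast
  then have "tfib B F \<noteq> tfib B (\<lambda>x. 0)" using inj[OF F(1)] by auto
  then show "carrier ?M \<noteq> {\<zero>\<^bsub>?M\<^esub>}" using F(1) by (auto simp: covariants_simps[OF rb])
  fix X Y assume "submodule X ?R ?M \<and> submodule Y ?R ?M \<and> X \<inter> Y = {\<zero>\<^bsub>?M\<^esub>} \<and> X <+>\<^bsub>?M\<^esub> Y = carrier ?M"
  then have X: "submodule X ?R ?M" and Y: "submodule Y ?R ?M"
    and XY: "X \<inter> Y = {\<zero>\<^bsub>?M\<^esub>}" "X <+>\<^bsub>?M\<^esub> Y = carrier ?M" by auto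
  \<comment> \<open>The submodule read as a set of equivariant maps instead of cosets.\<close>
  define el where "el Z = {F \<in> Equi B \<rho>. tfib B F \<in> Z}" for Z
  have el: "(\<lambda>x. 0) \<in> el Z" "Z = tfib B ` el Z"
    "F \<in> el Z \<Longrightarrow> H \<in> el Z \<Longrightarrow> (\<lambda>x. F x + H x) \<in> el Z"
    "f \<in> Inv \<Longrightarrow> F \<in> el Z \<Longrightarrow> (\<lambda>x. sW (f x) (F x)) \<in> el Z"
    if Z: "submodule Z ?R ?M" for Z F H f
  proof -
    have sg: "subgroup Z (add_monoid ?M)" using Z by (simp add: submodule_def)
    show "(\<lambda>x. 0) \<in> el Z"
      using subgroup.one_closed[OF sg] Equi_zero[OF rb] by (simp add: el_def covariants_simps[OF rb])
    show "Z = tfib B ` el Z"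
      using subgroup.subset[OF sg] by (auto simp: el_def covariants_simps[OF rb])
    show "(\<lambda>x. F x + H x) \<in> el Z" if "F \<in> el Z" "H \<in> el Z"
      using subgroup.m_closed[OF sg, of "tfib B F" "tfib B H"] that
      by (simp add: el_def covariants_ops[OF rb] Equi_add[OF rb])
    show "(\<lambda>x. sW (f x) (F x)) \<in> el Z" if "f \<in> Inv" "F \<in> el Z"
      using submodule.smult_closed[OF Z, of "fib f" "tfib B F"] that
      by (simp add: el_def covariants_ops[OF rb] Equi_mult[OF rb] invariant_ring_simps Inv_closed)
  qed
  have el_Equi: "F \<in> Equi B \<rho>" if "F \<in> el Z" for F Z using that by (simp add: el_def)
  have minus: "(\<lambda>x. - F x) \<in> el Z" if "submodule Z ?R ?M" "F \<in> el Z" for F Z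
    using el(4)[OF that(1) Inv_closed(2)[of "-1"] that(2)] by simp
  have int: "F = (\<lambda>x. 0)" if "F \<in> el X" "F \<in> el Y" for F
  proof -
    have "tfib B F \<in> X \<inter> Y" using that by (simp add: el_def)
    then have "tfib B F = tfib B (\<lambda>x. 0)" using XY(1) by (simp add: covariants_simps[OF rb])
    then show ?thesis by (rule inj[OF el_Equi[OF that(1)]])
  qed
  \<comment> \<open>The component in X. The choice is unique because X and Y meet only in
    zero.\<close>
  define \<phi> where "\<phi> F = (SOME H. H \<in> el X \<and> (\<exists>K\<in>el Y. F = (\<lambda>x. H x + K x)))" for F
  have ex: "\<exists>H K. H \<in> el X \<and> K \<in> el Y \<and> F = (\<lambda>x. H x + K x)" if F: "F \<in> Equi B \<rho>" for F
  proof -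
    have "tfib B F \<in> X <+>\<^bsub>?M\<^esub> Y" using F XY(2) by (simp add: covariants_simps[OF rb])
    then obtain u v where uv: "u \<in> X" "v \<in> Y" "tfib B F = u \<oplus>\<^bsub>?M\<^esub> v" by (auto simp: set_add_def')
    then obtain H K where HK: "H \<in> el X" "K \<in> el Y" "u = tfib B H" "v = tfib B K"
      using subsetD[OF equalityD1[OF el(2)[OF X]] uv(1)] subsetD[OF equalityD1[OF el(2)[OF Y]] uv(2)]
      by blast
    then have "tfib B F = tfib B (\<lambda>x. H x + K x)"
      using uv(3) by (simp add: covariants_ops[OF rb] el_Equi)
    then show ?thesis using inj[OF F] HK by blast
  qed
  have unique: "H' = H" if HK: "H \<in> el X" "K \<in> el Y" "H' \<in> el X" "K' \<in> el Y"
    and eq: "\<And>x. H x + K x = H' x + K' x" for H K H' K'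
  proof -
    have X': "(\<lambda>x. H' x + - H x) \<in> el X" by (intro el(3)[OF X] minus[OF X] HK)
    have "(\<lambda>x. K x + - K' x) \<in> el Y" by (intro el(3)[OF Y] minus[OF Y] HK)
    moreover have "(\<lambda>x. K x + - K' x) = (\<lambda>x. H' x + - H x)"
    proof
      fix x
      show "K x + - K' x = H' x + - H x" using eq[of x] by (simp add: algebra_simps)
    qed
    ultimately have "(\<lambda>x. H' x + - H x) = (\<lambda>x. 0)" using int[OF X'] by simp
    then have "H' x + - H x = 0" for x by (rule fun_cong)
    then show ?thesis by (simp add: fun_eq_iff)
  qed
  have \<phi>: "\<phi> (\<lambda>x. H x + K x) = H" if HK: "H \<in> el X" "K \<in> el Y" for H K
    unfolding \<phi>_def
  proof (rule some_equality)
    show "H \<in> el X \<and> (\<exists>K'\<in>el Y. (\<lambda>x. H x + K x) = (\<lambda>x. H x + K' x))" using HK by blast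
    fix H' assume "H' \<in> el X \<and> (\<exists>K'\<in>el Y. (\<lambda>x. H x + K x) = (\<lambda>x. H' x + K' x))"
    then obtain K' where K': "H' \<in> el X" "K' \<in> el Y" "(\<lambda>x. H x + K x) = (\<lambda>x. H' x + K' x)" by blast
    show "H' = H" by (rule unique[OF HK K'(1,2)]) (rule fun_cong[OF K'(3)])
  qed
  have \<phi>X: "\<phi> H = H" if "H \<in> el X" for H using \<phi>[OF that el(1)[OF Y]] by simp
  have \<phi>Y: "\<phi> K = (\<lambda>x. 0)" if "K \<in> el Y" for K using \<phi>[OF el(1)[OF X] that] by simp
  have "equi_hom B \<rho> B \<rho> \<phi>"
    unfolding equi_hom_def
  proof (intro conjI ballI)
    fix F assume F: "F \<in> Equi B \<rho>"
    then obtain H K where HK: "H \<in> el X" "K \<in> el Y" "F = (\<lambda>x. H x + K x)" using ex by blast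
    then show "\<phi> F \<in> Equi B \<rho>" using \<phi> el_Equi by simp
    show "\<phi> (\<lambda>x. F x + F' x) = (\<lambda>x. \<phi> F x + \<phi> F' x)" if F': "F' \<in> Equi B \<rho>" for F'
    proof -
      obtain H' K' where HK': "H' \<in> el X" "K' \<in> el Y" "F' = (\<lambda>x. H' x + K' x)" using ex[OF F'] by blast
      have "(\<lambda>x. F x + F' x) = (\<lambda>x. (H x + H' x) + (K x + K' x))"
        by (simp add: HK HK' algebra_simps)
      then show ?thesis
        using \<phi>[OF el(3)[OF X HK(1) HK'(1)] el(3)[OF Y HK(2) HK'(2)]] \<phi> HK HK' by simp
    qed
    show "\<phi> (\<lambda>x. sW (f x) (F x)) = (\<lambda>x. sW (f x) (\<phi> F x))" if f: "f \<in> Inv" for f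
      using \<phi>[OF el(4)[OF X f HK(1)] el(4)[OF Y f HK(2)]] \<phi> HK by (simp add: W.scale_right_distrib)
  qed
  moreover have "\<phi> (\<phi> F) = \<phi> F" if "F \<in> Equi B \<rho>" for F
    using ex[OF that] \<phi> \<phi>X by auto
  ultimately have "(\<forall>F\<in>Equi B \<rho>. \<phi> F = (\<lambda>x. 0)) \<or> (\<forall>F\<in>Equi B \<rho>. \<phi> F = F)"
    by (rule idempotent_equi_hom[OF rb irr])
  then show "X = {\<zero>\<^bsub>?M\<^esub>} \<or> Y = {\<zero>\<^bsub>?M\<^esub>}"
  proof
    assume *: "\<forall>F\<in>Equi B \<rho>. \<phi> F = (\<lambda>x. 0)"
    have "el X = {\<lambda>x. 0}" using * \<phi>X el(1)[OF X] el_Equi by fastforce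
    with el(2)[OF X] have "X = {tfib B (\<lambda>x. 0)}" by (metis image_empty image_insert)
    then show ?thesis by (simp add: covariants_simps[OF rb])
  next
    assume *: "\<forall>F\<in>Equi B \<rho>. \<phi> F = F"
    have "el Y = {\<lambda>x. 0}" using * \<phi>Y el(1)[OF Y] el_Equi by fastforce
    with el(2)[OF Y] have "Y = {tfib B (\<lambda>x. 0)}" by (metis image_empty image_insert)
    then show ?thesis by (simp add: covariants_simps[OF rb])
  qed
qed

end

section \<open>Direct sums with multiplicities\<close>

context
  fixes n :: nat and U :: "nat \<Rightarrow> 'w set" and \<rho> :: "nat \<Rightarrow> ('v \<Rightarrow> 'v) \<Rightarrow> 'w \<Rightarrow> 'w" and B
  assumes rb: "\<And>i. i \<le> n \<Longrightarrow> rep_basis (B i) (\<rho> i)" and U: "\<And>i. i \<le> n \<Longrightarrow> W.span (B i) = U i"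
begin

abbreviation "idx m \<equiv> SIGMA i:{..n}. {..<m i :: nat}"

abbreviation "msum m \<equiv> multiplicity_sum n m (\<lambda>i. covariants sV G sW (U i) (\<rho> i))"

text \<open>Values outside \<open>idx m\<close> are unconstrained and cut off by \<open>vec\<close>,
  so families are compared only on \<open>idx m\<close>.\<close>

definition fam where
  "fam m = {Y. \<forall>q\<in>idx m. Y q \<in> Equi (B (fst q)) (\<rho> (fst q))}"

definition vec where
  "vec m Y = (\<lambda>q\<in>idx m. tfib (B (fst q)) (Y q))"

lemma idx_le: "q \<in> idx m \<Longrightarrow> fst q \<le> n"
  by auto

lemma famD: "Y \<in> fam m \<Longrightarrow> q \<in> idx m \<Longrightarrow> Y q \<in> Equi (B (fst q)) (\<rho> (fst q))"
  unfolding fam_def by blast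

lemma vec_cong: "(\<And>q. q \<in> idx m \<Longrightarrow> Y q = Z q) \<Longrightarrow> vec m Y = vec m Z"
  by (auto simp: vec_def intro!: restrict_ext)

lemma vec_inj: "Y \<in> fam m \<Longrightarrow> vec m Y = vec m Z \<Longrightarrow> q \<in> idx m \<Longrightarrow> Y q = Z q"
proof -
  assume Y: "Y \<in> fam m" and eq: "vec m Y = vec m Z" and q: "q \<in> idx m"
  have "tfib (B (fst q)) (Y q) = tfib (B (fst q)) (Z q)"
    using fun_cong[OF eq, of q] q by (simp add: vec_def)
  then show "Y q = Z q"
    by (rule tfib_inj[OF rb[OF idx_le[OF q]] Equi_PolW[OF famD[OF Y q]]])
qed

lemma covariants_U: "i \<le> n \<Longrightarrow> covariants sV G sW (U i) (\<rho> i) = covariants sV G sW (W.span (B i)) (\<rho> i)"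
  using U by simp

lemma carrier_msum: "carrier (msum m) = vec m ` fam m"
proof
  have fin: "finite (idx m)" by (intro finite_SigmaI) auto
  show "carrier (msum m) \<subseteq> vec m ` fam m"
  proof
    fix x assume x: "x \<in> carrier (msum m)"
    then have "x q \<in> tfib (B (fst q)) ` Equi (B (fst q)) (\<rho> (fst q))" if "q \<in> idx m" for q
      using that by (cases q) (fastforce simp: multiplicity_sum_def direct_sum_module_def PiE_def Pi_def
          covariants_U covariants_simps[OF rb])
    then have "\<forall>q\<in>idx m. \<exists>F. F \<in> Equi (B (fst q)) (\<rho> (fst q)) \<and> x q = tfib (B (fst q)) F" by blast
    from bchoice[OF this] obtain Y where
      Y: "\<And>q. q \<in> idx m \<Longrightarrow> Y q \<in> Equi (B (fst q)) (\<rho> (fst q)) \<and> x q = tfib (B (fst q)) (Y q)" by blast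
    have "x \<in> extensional (idx m)"
      using x by (auto simp: multiplicity_sum_def direct_sum_module_def PiE_def)
    then have "x = vec m Y" using Y by (intro extensionalityI[of x "idx m"]) (auto simp: vec_def)
    then show "x \<in> vec m ` fam m" using Y by (auto simp: fam_def)
  qed
  show "vec m ` fam m \<subseteq> carrier (msum m)"
  proof
    fix x assume "x \<in> vec m ` fam m"
    then obtain Y where Y: "Y \<in> fam m" "x = vec m Y" by blast
    have "vec m Y \<in> (\<Pi>\<^sub>E q\<in>idx m. carrier (case q of (i, j) \<Rightarrow> covariants sV G sW (U i) (\<rho> i)))"
    proof (rule PiE_I)
      fix q assume q: "q \<in> idx m"
      show "vec m Y q \<in> carrier (case q of (i, j) \<Rightarrow> covariants sV G sW (U i) (\<rho> i))"
        using famD[OF Y(1) q] idx_le[OF q] q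
        by (simp add: vec_def case_prod_beta covariants_U covariants_simps[OF rb])
    qed (simp only: vec_def restrict_def if_False)
    moreover have "finite {q \<in> idx m. P q}" for P using fin by simp
    ultimately show "x \<in> carrier (msum m)"
      unfolding multiplicity_sum_def direct_sum_module_def Y(2) by simp
  qed
qed

lemma msum_ops:
  assumes Y: "Y \<in> fam m"
  shows "Z \<in> fam m \<Longrightarrow> vec m Y \<oplus>\<^bsub>msum m\<^esub> vec m Z = vec m (\<lambda>q x. Y q x + Z q x)"
    and "f \<in> Inv \<Longrightarrow> fib f \<odot>\<^bsub>msum m\<^esub> vec m Y = vec m (\<lambda>q x. sW (f x) (Y q x))"
  using Y by (auto simp: multiplicity_sum_def direct_sum_module_def vec_def fam_def
      covariants_U covariants_ops[OF rb] Inv_closed intro!: restrict_ext)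

lemma fam_closed:
  "Y \<in> fam m \<Longrightarrow> Z \<in> fam m \<Longrightarrow> (\<lambda>q x. Y q x + Z q x) \<in> fam m"
  "Y \<in> fam m \<Longrightarrow> f \<in> Inv \<Longrightarrow> (\<lambda>q x. sW (f x) (Y q x)) \<in> fam m"
  "Y \<in> fam m \<Longrightarrow> (\<lambda>q. if q \<in> Q then Y q else (\<lambda>x. 0)) \<in> fam m"
  "F \<in> Equi (B (fst p)) (\<rho> (fst p)) \<Longrightarrow> (\<lambda>q. if q = p then F else (\<lambda>x. 0)) \<in> fam m"
  by (auto simp: fam_def intro: Equi_add[OF rb] Equi_mult[OF rb] Equi_zero[OF rb])

text \<open>The component from q to p is read off by applying the map to families supported at q. As
  the index set is finite, every family is a finite sum of such families, and additivity reassembles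
  the map.\<close>

lemma msum_hom_components:
  assumes "linear_map (invariant_ring sV G) (msum m) (msum m') \<psi>"
  shows "\<exists>\<Psi>. (\<forall>q\<in>idx m. \<forall>p\<in>idx m'.
      equi_hom (B (fst q)) (\<rho> (fst q)) (B (fst p)) (\<rho> (fst p)) (\<Psi> q p)) \<and>
    (\<forall>Y\<in>fam m. \<psi> (vec m Y) = vec m' (\<lambda>p x. \<Sum>q\<in>idx m. \<Psi> q p (Y q) x))"
proof -
  have map: "\<psi> x \<in> carrier (msum m')"
    and add: "y \<in> carrier (msum m) \<Longrightarrow> \<psi> (x \<oplus>\<^bsub>msum m\<^esub> y) = \<psi> x \<oplus>\<^bsub>msum m'\<^esub> \<psi> y"
    and smult: "r \<in> carrier (invariant_ring sV G) \<Longrightarrow> \<psi> (r \<odot>\<^bsub>msum m\<^esub> x) = r \<odot>\<^bsub>msum m'\<^esub> \<psi> x"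
    if "x \<in> carrier (msum m)" for x y r
    using assms that by (auto simp: linear_map_def)
  have "\<forall>Y\<in>fam m. \<exists>Z. Z \<in> fam m' \<and> \<psi> (vec m Y) = vec m' Z"
    using map carrier_msum by blast
  \<comment> \<open>A lift of the map from tuples of tensors to families; its additivity and
    homogeneity hold only at indices in \<open>idx m'\<close>.\<close>
  from bchoice[OF this] obtain T where
    T: "\<And>Y. Y \<in> fam m \<Longrightarrow> T Y \<in> fam m'" "\<And>Y. Y \<in> fam m \<Longrightarrow> \<psi> (vec m Y) = vec m' (T Y)" by blast
  have T_add: "T (\<lambda>q x. Y q x + Z q x) p = (\<lambda>x. T Y p x + T Z p x)"
    if Y: "Y \<in> fam m" and Z: "Z \<in> fam m" and p: "p \<in> idx m'" for Y Z p
  proof -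
    have "vec m' (T (\<lambda>q x. Y q x + Z q x)) = \<psi> (vec m Y \<oplus>\<^bsub>msum m\<^esub> vec m Z)"
      by (simp add: T fam_closed Y Z msum_ops)
    also have "\<dots> = \<psi> (vec m Y) \<oplus>\<^bsub>msum m'\<^esub> \<psi> (vec m Z)"
      by (rule add) (use Y Z carrier_msum in auto)
    also have "\<dots> = vec m' (\<lambda>q x. T Y q x + T Z q x)"
      using Y Z by (simp add: T msum_ops)
    finally show ?thesis by (rule vec_inj[OF T(1)[OF fam_closed(1)[OF Y Z]] _ p])
  qed
  have T_mult: "T (\<lambda>q x. sW (f x) (Y q x)) p = (\<lambda>x. sW (f x) (T Y p x))"
    if Y: "Y \<in> fam m" and f: "f \<in> Inv" and p: "p \<in> idx m'" for Y f p
  proof -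
    have "vec m' (T (\<lambda>q x. sW (f x) (Y q x))) = \<psi> (fib f \<odot>\<^bsub>msum m\<^esub> vec m Y)"
      by (simp add: T fam_closed Y f msum_ops)
    also have "\<dots> = fib f \<odot>\<^bsub>msum m'\<^esub> \<psi> (vec m Y)"
      by (rule smult) (use Y f carrier_msum invariant_ring_simps in auto)
    also have "\<dots> = vec m' (\<lambda>q x. sW (f x) (T Y q x))"
      using Y f by (simp add: T msum_ops)
    finally show ?thesis by (rule vec_inj[OF T(1)[OF fam_closed(2)[OF Y f]] _ p])
  qed
  let ?\<delta> = "\<lambda>q F. \<lambda>i. if i = q then F else (\<lambda>x. 0)"
  define \<Psi> where "\<Psi> q p F = T (?\<delta> q F) p" for q p F
  have zero: "(\<lambda>q x. 0) \<in> fam m" by (auto simp: fam_def intro: Equi_zero[OF rb])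
  have hom: "equi_hom (B (fst q)) (\<rho> (fst q)) (B (fst p)) (\<rho> (fst p)) (\<Psi> q p)"
    if q: "q \<in> idx m" and p: "p \<in> idx m'" for q p
    unfolding equi_hom_def
  proof (intro conjI ballI)
    fix F assume F: "F \<in> Equi (B (fst q)) (\<rho> (fst q))"
    note \<delta> = fam_closed(4)[of _ q m]
    show "\<Psi> q p F \<in> Equi (B (fst p)) (\<rho> (fst p))"
      using famD[OF T(1)[OF \<delta>[OF F]] p] by (simp add: \<Psi>_def)
    show "\<Psi> q p (\<lambda>x. F x + H x) = (\<lambda>x. \<Psi> q p F x + \<Psi> q p H x)"
      if H: "H \<in> Equi (B (fst q)) (\<rho> (fst q))" for H
    proof -
      have "?\<delta> q (\<lambda>x. F x + H x) = (\<lambda>i x. ?\<delta> q F i x + ?\<delta> q H i x)" by (auto simp: fun_eq_iff)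
      then show ?thesis using T_add[OF \<delta>[OF F] \<delta>[OF H] p] by (simp add: \<Psi>_def)
    qed
    show "\<Psi> q p (\<lambda>x. sW (f x) (F x)) = (\<lambda>x. sW (f x) (\<Psi> q p F x))" if f: "f \<in> Inv" for f
    proof -
      have "?\<delta> q (\<lambda>x. sW (f x) (F x)) = (\<lambda>i x. sW (f x) (?\<delta> q F i x))" by (auto simp: fun_eq_iff)
      then show ?thesis using T_mult[OF \<delta>[OF F] f p] by (simp add: \<Psi>_def)
    qed
  qed
  \<comment> \<open>Induction over the support: Q grows by one index at a time until it is all of
    \<open>idx m\<close>.\<close>
  have sum: "T (\<lambda>q. if q \<in> Q then Y q else (\<lambda>x. 0)) p = (\<lambda>x. \<Sum>q\<in>Q. \<Psi> q p (Y q) x)"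
    if "finite Q" "Q \<subseteq> idx m" "Y \<in> fam m" "p \<in> idx m'" for Q Y p
    using that
  proof (induction Q rule: finite_induct)
    case empty
    then show ?case using T_mult[OF zero Inv_closed(2)[of 0]] by simp
  next
    case (insert i Q)
    have Yi: "Y i \<in> Equi (B (fst i)) (\<rho> (fst i))" using insert.prems by (blast intro: famD)
    have "(\<lambda>q. if q \<in> insert i Q then Y q else (\<lambda>x. 0))
        = (\<lambda>q x. ?\<delta> i (Y i) q x + (if q \<in> Q then Y q else (\<lambda>x. 0)) x)"
      using insert.hyps by (auto simp: fun_eq_iff)
    then have "T (\<lambda>q. if q \<in> insert i Q then Y q else (\<lambda>x. 0)) p
        = (\<lambda>x. \<Psi> i p (Y i) x + T (\<lambda>q. if q \<in> Q then Y q else (\<lambda>x. 0)) p x)"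
      using T_add[OF fam_closed(4)[OF Yi] fam_closed(3)[OF insert.prems(2)] insert.prems(3)]
      by (simp add: \<Psi>_def)
    then show ?case using insert by simp
  qed
  have "\<psi> (vec m Y) = vec m' (\<lambda>p x. \<Sum>q\<in>idx m. \<Psi> q p (Y q) x)" if Y: "Y \<in> fam m" for Y
  proof -
    let ?Y = "\<lambda>q. if q \<in> idx m then Y q else (\<lambda>x. 0)"
    have "vec m Y = vec m ?Y" by (rule vec_cong) simp
    then have "\<psi> (vec m Y) = vec m' (T ?Y)" using T(2)[OF fam_closed(3)[OF Y]] by simp
    also have "\<dots> = vec m' (\<lambda>p x. \<Sum>q\<in>idx m. \<Psi> q p (Y q) x)"
      using sum[OF _ subset_refl Y] by (intro vec_cong) (simp add: finite_SigmaI)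
    finally show ?thesis .
  qed
  then show ?thesis using hom by blast
qed

lemma multiplicities_le:
  assumes irr: "\<And>i. i \<le> n \<Longrightarrow> irreducible_representation G sW (U i) (\<rho> i)"
    and noniso: "\<And>i j. i \<le> n \<Longrightarrow> j \<le> n \<Longrightarrow> i \<noteq> j \<Longrightarrow>
      \<not> representation_iso G sW (U i) (\<rho> i) sW (U j) (\<rho> j)"
    and iso: "module_isomorphic (invariant_ring sV G) N (msum m)"
      "module_isomorphic (invariant_ring sV G) N (msum m')"
    and N: "\<And>x y. x \<in> carrier N \<Longrightarrow> y \<in> carrier N \<Longrightarrow> x \<oplus>\<^bsub>N\<^esub> y \<in> carrier N"
      "\<And>r x. r \<in> carrier (invariant_ring sV G) \<Longrightarrow> x \<in> carrier N \<Longrightarrow> r \<odot>\<^bsub>N\<^esub> x \<in> carrier N"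
    and i: "i \<le> n"
  shows "m i \<le> m' i"
proof -
  obtain \<psi> \<psi>' where \<psi>: "linear_map (invariant_ring sV G) (msum m) (msum m') \<psi>"
    "linear_map (invariant_ring sV G) (msum m') (msum m) \<psi>'" "\<forall>x\<in>carrier (msum m). \<psi>' (\<psi> x) = x"
    using module_isomorphic_compose[OF iso N] by blast
  obtain \<Psi> where \<Psi>: "\<forall>q\<in>idx m. \<forall>p\<in>idx m'.
      equi_hom (B (fst q)) (\<rho> (fst q)) (B (fst p)) (\<rho> (fst p)) (\<Psi> q p)"
    "\<forall>Y\<in>fam m. \<psi> (vec m Y) = vec m' (\<lambda>p x. \<Sum>q\<in>idx m. \<Psi> q p (Y q) x)"
    using msum_hom_components[OF \<psi>(1)] by blast
  obtain \<Psi>' where \<Psi>': "\<forall>q\<in>idx m'. \<forall>p\<in>idx m.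
      equi_hom (B (fst q)) (\<rho> (fst q)) (B (fst p)) (\<rho> (fst p)) (\<Psi>' q p)"
    "\<forall>Y\<in>fam m'. \<psi>' (vec m' Y) = vec m (\<lambda>p x. \<Sum>q\<in>idx m'. \<Psi>' q p (Y q) x)"
    using msum_hom_components[OF \<psi>(2)] by blast
  have fin: "finite (idx k)" for k by (intro finite_SigmaI) auto
  show ?thesis
  proof (rule multiplicity_le[of n B \<rho> m m' \<Psi> \<Psi>' i])
    show "irreducible_representation G sW (W.span (B i)) (\<rho> i)" if "i \<le> n" for i
      using irr that U by simp
    show "\<not> representation_iso G sW (W.span (B i)) (\<rho> i) sW (W.span (B j)) (\<rho> j)"
      if "i \<le> n" "j \<le> n" "i \<noteq> j" for i j using noniso that U by simp
    show "B i \<noteq> {}" using irr[OF i] U[OF i] by (auto simp: irreducible_representation_def)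
    fix q r F x
    assume q: "q \<in> idx m" and r: "r \<in> idx m" and F: "F \<in> Equi (B (fst q)) (\<rho> (fst q))"
    \<comment> \<open>The family with the single entry F at q turns
      \<open>\<psi>' (\<psi> x) = x\<close> into the componentwise identity required by
      \<open>multiplicity_le\<close>.\<close>
    let ?\<delta> = "\<lambda>i. if i = q then F else (\<lambda>x. 0)"
    have \<delta>: "?\<delta> \<in> fam m" by (rule fam_closed(4)[OF F])
    have zero: "\<Psi> s p (\<lambda>x. 0) = (\<lambda>x. 0)" if "s \<in> idx m" "p \<in> idx m'" for s p
      by (rule hom_zero[OF rb[OF idx_le[OF that(1)]] rb[OF idx_le[OF that(2)]]
            bspec[OF bspec[OF \<Psi>(1) that(1)] that(2)]])
    have "(\<Sum>s\<in>idx m. \<Psi> s p (?\<delta> s) x) = \<Psi> q p F x" if p: "p \<in> idx m'" for p x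
    proof -
      have "(\<Sum>s\<in>idx m. \<Psi> s p (?\<delta> s) x) = (\<Sum>s\<in>idx m. if s = q then \<Psi> q p F x else 0)"
        by (intro sum.cong refl) (simp add: zero p del: mem_Sigma_iff)
      then show ?thesis using q fin by simp
    qed
    then have "\<psi> (vec m ?\<delta>) = vec m' (\<lambda>p. \<Psi> q p F)"
      unfolding bspec[OF \<Psi>(2) \<delta>] by (intro vec_cong ext) blast
    moreover have F': "(\<lambda>p. \<Psi> q p F) \<in> fam m'"
      unfolding fam_def
    proof (intro CollectI ballI)
      fix p assume p: "p \<in> idx m'"
      show "\<Psi> q p F \<in> Equi (B (fst p)) (\<rho> (fst p))"
        by (rule hom_closed[OF rb[OF idx_le[OF q]] rb[OF idx_le[OF p]]
              bspec[OF bspec[OF \<Psi>(1) q] p] F])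
    qed
    ultimately have "vec m ?\<delta> = vec m (\<lambda>r x. \<Sum>p\<in>idx m'. \<Psi>' p r (\<Psi> q p F) x)"
      using bspec[OF \<psi>(3), of "vec m ?\<delta>"] \<delta> bspec[OF \<Psi>'(2) F'] carrier_msum by simp
    from vec_inj[OF \<delta> this r]
    have "?\<delta> r = (\<lambda>x. \<Sum>p\<in>idx m'. \<Psi>' p r (\<Psi> q p F) x)" .
    from fun_cong[OF this, of x] show "(\<Sum>p\<in>idx m'. \<Psi>' p r (\<Psi> q p F) x) = (if r = q then F x else 0)"
      by (auto split: if_splits)
  qed (use rb i \<Psi>(1) \<Psi>'(1) in auto)
qed

end

end

theorem corollary2p5:
  fixes sV :: "'k::alg_closed_field \<Rightarrow> 'v::ab_group_add \<Rightarrow> 'v"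
    and basis :: "'v set"
    and G :: "('v \<Rightarrow> 'v) set"
    and sW :: "'k \<Rightarrow> 'w::ab_group_add \<Rightarrow> 'w"
    and U :: "nat \<Rightarrow> 'w set"
    and \<rho> :: "nat \<Rightarrow> ('v \<Rightarrow> 'v) \<Rightarrow> 'w \<Rightarrow> 'w"
    and p d n :: nat
  assumes "prime p" and "CHAR('k) = p"
    and "finite_dimensional_vector_space sV basis" and "vector_space.dim sV UNIV = d"
    and "subgroup G (GL sV)" and "finite G" and "\<not> p dvd card G"
    and "\<forall>g\<in>G. \<not> pseudo_reflection sV g"
    and "vector_space sW"
    and "complete_irreps G sW n U \<rho>"
    and "representation_iso G sW (U 0) (\<rho> 0) (*) (UNIV :: 'k set) (\<lambda>g a. a)"
  shows "(\<forall>i\<le>n. indecomposable_module (invariant_ring sV G)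
                  (covariants sV G sW (U i) (\<rho> i))) \<and>
    (\<forall>(e::nat) (c :: nat \<Rightarrow> nat) (c' :: nat \<Rightarrow> nat).
       module_isomorphic (invariant_ring sV G)
         (frobenius_pullback p e (invariant_ring sV G) (regular_module (invariant_ring sV G)))
         (multiplicity_sum n c (\<lambda>i. covariants sV G sW (U i) (\<rho> i))) \<longrightarrow>
       module_isomorphic (invariant_ring sV G)
         (frobenius_pullback p e (invariant_ring sV G) (regular_module (invariant_ring sV G)))
         (multiplicity_sum n c' (\<lambda>i. covariants sV G sW (U i) (\<rho> i))) \<longrightarrow>
       (\<forall>i\<le>n. c i = c' i))"
proof -
  interpret group_covariants sV basis G sW
    by (intro group_covariants.intro reflection_free_group.intro linear_group.intro dual_points.intro
        dual_points_axioms.intro linear_group_axioms.intro reflection_free_group_axioms.intro)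
      (use assms infinite_alg_closed_field in blast)+
  have irr: "irreducible_representation G sW (U i) (\<rho> i)" if "i \<le> n" for i
    using assms(10) that by (simp add: complete_irreps_def)
  have noniso: "\<not> representation_iso G sW (U i) (\<rho> i) sW (U j) (\<rho> j)"
    if "i \<le> n" "j \<le> n" "i \<noteq> j" for i j
    using assms(10) that by (simp add: complete_irreps_def)
  have "\<forall>i\<in>{..n}. \<exists>B. rep_basis B (\<rho> i) \<and> W.span B = U i"
    using irreducible_rep_basis[OF irr] by (metis atMost_iff)
  from bchoice[OF this] obtain B where
    rb: "\<And>i. i \<le> n \<Longrightarrow> rep_basis (B i) (\<rho> i)" and U: "\<And>i. i \<le> n \<Longrightarrow> W.span (B i) = U i" by auto
  let ?R = "invariant_ring sV G"
  interpret R: cring ?R by (rule cring_invariant_ring)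
  have indec: "indecomposable_module ?R (covariants sV G sW (U i) (\<rho> i))" if "i \<le> n" for i
    using indecomposable_covariants[OF rb[OF that]] irr[OF that] U[OF that] by simp
  let ?N = "\<lambda>e. frobenius_pullback p e ?R (regular_module ?R)"
  have N: "x \<oplus>\<^bsub>?N e\<^esub> y \<in> carrier (?N e)" if "x \<in> carrier (?N e)" "y \<in> carrier (?N e)" for e x y
    using that by (simp add: frobenius_pullback_def regular_module_def)
  have N': "r \<odot>\<^bsub>?N e\<^esub> x \<in> carrier (?N e)" if "r \<in> carrier ?R" "x \<in> carrier (?N e)" for e r x
    using that by (simp add: frobenius_pullback_def regular_module_def)
  \<comment> \<open>Both decompositions start from the same module \<open>?N e\<close>, and the
    statement is symmetric in c and c', so the inequality yields equality.\<close>
  have le: "c i \<le> c' i"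
    if "module_isomorphic ?R (?N e) (multiplicity_sum n c (\<lambda>i. covariants sV G sW (U i) (\<rho> i)))"
      "module_isomorphic ?R (?N e) (multiplicity_sum n c' (\<lambda>i. covariants sV G sW (U i) (\<rho> i)))"
      "i \<le> n" for e i and c c' :: "nat \<Rightarrow> nat"
    using multiplicities_le[OF rb U irr noniso that(1,2) N N' that(3)] .
  show ?thesis
    using indec le by (blast intro: antisym)
qed

end
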